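(* Let $M\subset\mathbb{R}^3$ be a connected, closed (compact, without boundary), smooth embedded surface, regarded as the mm-space $\mathcal{M}$ with extrinsic Euclidean distance and normalized surface area measure, and let $\mathbb{S}^2\subset\mathbb{R}^3$ be the unit sphere regarded in the same way. If $H_{\mathcal{M}}(r)=H_{\mathbb{S}^2}(r)$ for all $r\geq0$, then $M$ is isometric to $\mathbb{S}^2$, i.e. $M$ is a round sphere of radius $1$.
   Context: For an mm-space $\mathcal{X}=(X,d_X,\mu_X)$ (compact metric space with fully supported Borel probability measure), the global distance distribution is $H_{\mathcal{X}}(r)=\mu_X\otimes\mu_X(\{(x,x')\in X\times X: d_X(x,x')\le r\})$, $r\ge0$. An embedded hypersurface $M\subset\mathbb{R}^{d+1}$ is regarded as an mm-space with $d_M$ the restriction of the Euclidean distance and $\mu_M$ the Riemannian (surface) volume normalized to total mass one. *)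

theory Defs
  imports "HOL-Analysis.Analysis"
begin

primrec Ck_on :: "nat \<Rightarrow> 'a::euclidean_space set \<Rightarrow> ('a \<Rightarrow> 'b::real_normed_vector) \<Rightarrow> bool" where
  "Ck_on 0 V f = continuous_on V f"
| "Ck_on (Suc k) V f =
     (\<exists>f'. (\<forall>x\<in>V. (f has_derivative f' x) (at x)) \<and> (\<forall>v. Ck_on k V (\<lambda>x. f' x v)))"

definition smooth_on :: "'a::euclidean_space set \<Rightarrow> ('a \<Rightarrow> 'b::real_normed_vector) \<Rightarrow> bool" where
  "smooth_on V f \<longleftrightarrow> (\<forall>k. Ck_on k V f)"

text \<open>Regular surface in the sense of do Carmo: every point has a neighbourhood W in R^3 such that
  M \<inter> W is the homeomorphic image of an open set of R^2 under a smooth immersion.\<close>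
definition smooth_embedded_surface :: "(real^3) set \<Rightarrow> bool" where
  "smooth_embedded_surface M \<longleftrightarrow>
     (\<forall>p\<in>M. \<exists>V W (\<phi> :: real^2 \<Rightarrow> real^3) \<psi>.
        open V \<and> open W \<and> p \<in> W \<and> smooth_on V \<phi> \<and>
        homeomorphism V (M \<inter> W) \<phi> \<psi> \<and>
        (\<forall>x\<in>V. \<exists>D. (\<phi> has_derivative D) (at x) \<and> inj D))"

definition hausdorff2_delta :: "real \<Rightarrow> (real^3) set \<Rightarrow> ennreal" where
  "hausdorff2_delta \<delta> A =
     (INF C \<in> {C :: nat \<Rightarrow> (real^3) set. A \<subseteq> (\<Union>n. C n) \<and>
                 (\<forall>n. bounded (C n) \<and> diameter (C n) \<le> \<delta>)}.
        (\<Sum>n. ennreal (pi / 4 * (diameter (C n))\<^sup>2)))"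

definition hausdorff2_outer :: "(real^3) set \<Rightarrow> ennreal" where
  "hausdorff2_outer A = (SUP \<delta> \<in> {0<..}. hausdorff2_delta \<delta> A)"

definition hausdorff2 :: "(real^3) measure" where
  "hausdorff2 = measure_of UNIV (sets borel) hausdorff2_outer"

text \<open>Normalised surface (= 2-dim. Hausdorff) measure on M.\<close>
definition mm_measure :: "(real^3) set \<Rightarrow> (real^3) measure" where
  "mm_measure M = density (restrict_space hausdorff2 M) (\<lambda>_. 1 / emeasure hausdorff2 M)"

definition global_dist_distr :: "(real^3) set \<Rightarrow> real \<Rightarrow> real" where
  "global_dist_distr M r =
     measure (mm_measure M \<Otimes>\<^sub>M mm_measure M) {p \<in> M \<times> M. dist (fst p) (snd p) \<le> r}"

end

theory Submission
  imports Defs "HOL-Probability.Probability"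
begin

text \<open>
  The distance distribution of a space determines its Gaussian averages, the double integrals of
  exp(-|x-y|^2/(2t)) against the normalised area. On a closed surface, writing the area element
  over the tangent plane at x, the inner integral with respect to area expands as
  2 pi t (1 + (t/8) (k1 - k2)^2) + O(t^(5/2)), where k1 and k2 are the principal curvatures at x.
  On the unit sphere the average is (t/2)(1 - exp(-2/t)). Comparing leading terms shows that the
  area is 4 pi; comparing the next terms shows that the integral of (k1 - k2)^2 vanishes, so the
  surface is totally umbilic. It therefore lies in a sphere (a plane is excluded at a point
  farthest from the origin), equals it by invariance of domain, and has radius 1 by its area.

  The surface measure is the 2-dimensional Hausdorff measure. The area formula is obtained only up
  to the constant by which it differs from Lebesgue measure on a plane.
\<close>

section \<open>Two-dimensional Hausdorff measure\<close>

text \<open>Only inequalities are used, each in its cheap direction. From exp(-y) \<ge> 1 - y and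
  1/(1 - s/2) \<ge> 1 + s/2 comes a lower bound for the inner integral, with a loss of order
  t^(5/2); dropping its nonnegative curvature term makes it uniform on M. The upper bound on M is of
  leading order and serves the area alone. Umbilicity comes from the lower bound on M against the
  ceiling t/2 for the average on the sphere: a set of positive area with a gain of order t^2 would
  beat the t^(5/2) loss. The square (k1 - k2)^2 arises by cancellation. The area element 1/cos
  contributes |S u|^2 / 2, the height over the tangent plane contributes -(S u . u)^2 / (8 t)
  through the kernel, and after u = sqrt t w the Gaussian means of the two add up to (t/8) (k1 -
  k2)^2. Hausdorff measure is given by coverings, so the area formula is built from that definition:
  Borel sets are measurable by Caratheodory's criterion, planes carry a multiple of Lebesgue measure
  by translation invariance, and small pieces of a surface project almost isometrically to a
  plane.\<close>

lemma hausdorff2_delta_empty: "0 < \<delta> \<Longrightarrow> hausdorff2_delta \<delta> {} = 0"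
proof -
  assume "0 < \<delta>"
  have "hausdorff2_delta \<delta> {} \<le> (\<Sum>n::nat. ennreal (pi / 4 * (diameter ({}::(real^3) set))\<^sup>2))"
    unfolding hausdorff2_delta_def
    by (rule INF_lower2[of "\<lambda>_. {}"]) (use \<open>0 < \<delta>\<close> in auto)
  then show ?thesis by simp
qed

lemma hausdorff2_delta_mono: "A \<subseteq> B \<Longrightarrow> hausdorff2_delta \<delta> A \<le> hausdorff2_delta \<delta> B"
  unfolding hausdorff2_delta_def by (rule INF_superset_mono) auto

lemma hausdorff2_delta_antimono: "\<delta> \<le> \<delta>' \<Longrightarrow> hausdorff2_delta \<delta>' A \<le> hausdorff2_delta \<delta> A"
  unfolding hausdorff2_delta_def by (rule INF_superset_mono) (auto intro: order_trans)

lemma hausdorff2_delta_le: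
  fixes C :: "nat \<Rightarrow> (real^3) set"
  assumes "A \<subseteq> (\<Union>n. C n)" "\<And>n. bounded (C n)" "\<And>n. diameter (C n) \<le> \<delta>"
  shows "hausdorff2_delta \<delta> A \<le> (\<Sum>n. ennreal (pi / 4 * (diameter (C n))\<^sup>2))"
  unfolding hausdorff2_delta_def using assms by (intro INF_lower) auto

text \<open>Near-optimal covers of the sets A i, with total excess e, are merged into one sequence
  by the pairing function.\<close>

lemma hausdorff2_delta_UN_le:
  fixes A :: "nat \<Rightarrow> (real^3) set"
  shows "hausdorff2_delta \<delta> (\<Union>i. A i) \<le> (\<Sum>i. hausdorff2_delta \<delta> (A i))"
proof (rule ennreal_le_epsilon)
  fix e :: real assume "0 < e" and fin: "(\<Sum>i. hausdorff2_delta \<delta> (A i)) < \<top>"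
  let ?w = "\<lambda>S::(real^3) set. ennreal (pi / 4 * (diameter S)\<^sup>2)"
  have f: "hausdorff2_delta \<delta> (A i) < \<top>" for i
  proof (rule ccontr)
    assume "\<not> ?thesis"
    then have "hausdorff2_delta \<delta> (A i) = \<top>" using less_top by blast
    moreover have "hausdorff2_delta \<delta> (A i) \<le> (\<Sum>i. hausdorff2_delta \<delta> (A i))"
      by (metis ennreal_suminf_lessD leI less_irrefl)
    ultimately show False using fin by simp
  qed
  have "\<exists>C. A i \<subseteq> (\<Union>n. C n) \<and> (\<forall>n. bounded (C n) \<and> diameter (C n) \<le> \<delta>) \<and>
      (\<Sum>n. ?w (C n)) \<le> hausdorff2_delta \<delta> (A i) + ennreal (e * (1/2)^Suc i)" for i
  proof -
    \<comment> \<open>Finiteness makes the inequality strict, so some cover undercuts the right-hand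
      side.\<close>
    have "hausdorff2_delta \<delta> (A i) < hausdorff2_delta \<delta> (A i) + ennreal (e * (1/2)^Suc i)"
      using f[of i] \<open>0 < e\<close>
      by (cases "hausdorff2_delta \<delta> (A i)") (auto simp: ennreal_less_iff simp flip: ennreal_plus)
    then show ?thesis
      unfolding hausdorff2_delta_def[of \<delta> "A i"] INF_less_iff
      by (auto intro: less_imp_le)
  qed
  then obtain C where C: "\<And>i. A i \<subseteq> (\<Union>n. C i n)" "\<And>i n. bounded (C i n)" "\<And>i n. diameter (C i n) \<le> \<delta>"
    "\<And>i. (\<Sum>n. ?w (C i n)) \<le> hausdorff2_delta \<delta> (A i) + ennreal (e * (1/2)^Suc i)"
    by metis
  have "hausdorff2_delta \<delta> (\<Union>i. A i) \<le> (\<Sum>k. ?w (case_prod C (prod_decode k)))"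
  proof (rule hausdorff2_delta_le)
    show "(\<Union>i. A i) \<subseteq> (\<Union>n. case prod_decode n of (x, y) \<Rightarrow> C x y)"
    proof
      fix x assume "x \<in> (\<Union>i. A i)"
      then obtain i n where "x \<in> C i n" using C(1) by blast
      then have "x \<in> case_prod C (prod_decode (prod_encode (i,n)))" by simp
      then show "x \<in> (\<Union>n. case prod_decode n of (x, y) \<Rightarrow> C x y)" by (rule UN_I[OF UNIV_I])
    qed
  qed (use C(2,3) in \<open>auto split: prod.split\<close>)
  also have "\<dots> = (\<Sum>i. \<Sum>n. ?w (C i n))"
    by (rule suminf_ennreal_2dimen[where g = "\<lambda>i. \<Sum>n. ?w (C i n)" and f = "\<lambda>p. ?w (case_prod C p)"]) simp
  also have "\<dots> \<le> (\<Sum>i. hausdorff2_delta \<delta> (A i) + ennreal (e * (1/2)^Suc i))"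
    by (intro suminf_le C(4)) auto
  also have "\<dots> = (\<Sum>i. hausdorff2_delta \<delta> (A i)) + (\<Sum>i. ennreal (e * (1/2)^Suc i))"
    by (rule suminf_add[symmetric]) auto
  also have "(\<Sum>i. ennreal (e * (1/2)^Suc i)) = ennreal e"
  proof (rule suminf_ennreal_eq)
    show "(\<lambda>i. e * (1/2)^Suc i) sums e"
      using sums_mult[OF power_half_series, of e] by simp
  qed (use \<open>0 < e\<close> in auto)
  finally show "hausdorff2_delta \<delta> (\<Union>i. A i) \<le> (\<Sum>i. hausdorff2_delta \<delta> (A i)) + ennreal e" .
qed

lemma hausdorff2_delta_le_outer: "0 < \<delta> \<Longrightarrow> hausdorff2_delta \<delta> A \<le> hausdorff2_outer A"
  unfolding hausdorff2_outer_def by (rule SUP_upper) auto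

lemma hausdorff2_outer_leI: "(\<And>\<delta>. 0 < \<delta> \<Longrightarrow> hausdorff2_delta \<delta> A \<le> b) \<Longrightarrow> hausdorff2_outer A \<le> b"
  unfolding hausdorff2_outer_def by (rule SUP_least) auto

lemma hausdorff2_outer_empty [simp]: "hausdorff2_outer {} = 0"
  by (metis hausdorff2_delta_empty hausdorff2_outer_leI le_zero_eq order_refl)

lemma hausdorff2_outer_mono: "A \<subseteq> B \<Longrightarrow> hausdorff2_outer A \<le> hausdorff2_outer B"
  by (meson hausdorff2_outer_leI hausdorff2_delta_le_outer hausdorff2_delta_mono order_trans)

lemma hausdorff2_outer_UN_le:
  fixes A :: "nat \<Rightarrow> (real^3) set"
  shows "hausdorff2_outer (\<Union>i. A i) \<le> (\<Sum>i. hausdorff2_outer (A i))"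
  by (rule hausdorff2_outer_leI, rule order_trans[OF hausdorff2_delta_UN_le])
    (auto intro!: suminf_le hausdorff2_delta_le_outer)

lemma hausdorff2_outer_Un_le: "hausdorff2_outer (A \<union> B) \<le> hausdorff2_outer A + hausdorff2_outer B"
proof -
  have "hausdorff2_outer (\<Union>i. binaryset A B i) \<le> (\<Sum>i. hausdorff2_outer (binaryset A B i))"
    by (rule hausdorff2_outer_UN_le)
  then show ?thesis
    by (simp add: UN_binaryset_eq suminf_binaryset_eq)
qed

text \<open>A covering set of diameter below \<eta> cannot meet both A and B, so every fine cover
  splits into a cover of A and a cover of B. This is the metric property behind Caratheodory's
  criterion.\<close>

lemma hausdorff2_outer_separated:
  assumes "0 < \<eta>" and sep: "\<And>a b. a \<in> A \<Longrightarrow> b \<in> B \<Longrightarrow> \<eta> \<le> dist a b"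
  shows "hausdorff2_outer A + hausdorff2_outer B \<le> hausdorff2_outer (A \<union> B)"
proof -
  let ?w = "\<lambda>S::(real^3) set. ennreal (pi / 4 * (diameter S)\<^sup>2)"
  have key: "hausdorff2_delta \<delta> A + hausdorff2_delta \<delta> B \<le> hausdorff2_delta \<delta> (A \<union> B)"
    if \<delta>: "0 < \<delta>" "\<delta> < \<eta>" for \<delta>
    unfolding hausdorff2_delta_def[of \<delta> "A \<union> B"]
  proof (rule INF_greatest)
    fix C :: "nat \<Rightarrow> (real^3) set"
    assume "C \<in> {C. A \<union> B \<subseteq> (\<Union>n. C n) \<and> (\<forall>n. bounded (C n) \<and> diameter (C n) \<le> \<delta>)}"
    then have C: "A \<subseteq> (\<Union>n. C n)" "B \<subseteq> (\<Union>n. C n)" "\<forall>n. bounded (C n) \<and> diameter (C n) \<le> \<delta>" by auto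
    \<comment> \<open>Sets missing T are replaced by the empty set, which keeps the indexing and has
      diameter 0.\<close>
    let ?R = "\<lambda>T n. if C n \<inter> T = {} then {} else C n"
    have *: "?w (?R A n) + ?w (?R B n) \<le> ?w (C n)" for n
    proof -
      have "C n \<inter> A = {} \<or> C n \<inter> B = {}"
      proof (rule ccontr)
        assume "\<not> ?thesis"
        then obtain a b where "a \<in> C n" "a \<in> A" "b \<in> C n" "b \<in> B" by blast
        with C(3) have "dist a b \<le> \<delta>"
          by (meson diameter_bounded_bound order_trans)
        with sep[OF \<open>a \<in> A\<close> \<open>b \<in> B\<close>] \<delta> show False by simp
      qed
      then show ?thesis by auto
    qed
    have "hausdorff2_delta \<delta> A + hausdorff2_delta \<delta> B \<le> (\<Sum>n. ?w (?R A n)) + (\<Sum>n. ?w (?R B n))"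
      by (intro add_mono hausdorff2_delta_le) (use C \<delta> in \<open>auto split: if_splits, blast+\<close>)
    also have "\<dots> = (\<Sum>n. ?w (?R A n) + ?w (?R B n))"
      by (rule suminf_add) auto
    also have "\<dots> \<le> (\<Sum>n. ?w (C n))"
      by (intro suminf_le *) auto
    finally show "hausdorff2_delta \<delta> A + hausdorff2_delta \<delta> B \<le> (\<Sum>n. ?w (C n))" .
  qed
  \<comment> \<open>The two suprema may be taken jointly because both quantities grow as \<delta>
    shrinks: the smaller of two scales serves both.\<close>
  have "hausdorff2_outer A + hausdorff2_outer B
     = (SUP \<delta>\<in>{0<..}. hausdorff2_delta \<delta> A + hausdorff2_delta \<delta> B)"
    unfolding hausdorff2_outer_def
  proof (rule SUP_add_directed_ennreal[symmetric])
    fix i j :: real assume "i \<in> {0<..}" "j \<in> {0<..}"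
    then show "\<exists>k\<in>{0<..}. hausdorff2_delta i A + hausdorff2_delta j B
        \<le> hausdorff2_delta k A + hausdorff2_delta k B"
      by (intro bexI[of _ "min i j"] add_mono hausdorff2_delta_antimono) auto
  qed
  also have "\<dots> \<le> hausdorff2_outer (A \<union> B)"
  proof (rule SUP_least)
    fix \<delta> :: real assume "\<delta> \<in> {0<..}"
    then have p: "0 < min \<delta> (\<eta>/2)" "min \<delta> (\<eta>/2) < \<eta>" using \<open>0 < \<eta>\<close> by auto
    have "hausdorff2_delta \<delta> A + hausdorff2_delta \<delta> B
       \<le> hausdorff2_delta (min \<delta> (\<eta>/2)) A + hausdorff2_delta (min \<delta> (\<eta>/2)) B"
      by (intro add_mono hausdorff2_delta_antimono) auto
    also have "\<dots> \<le> hausdorff2_outer (A \<union> B)"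
      using key[OF p] hausdorff2_delta_le_outer[OF p(1)] order_trans by blast
    finally show "hausdorff2_delta \<delta> A + hausdorff2_delta \<delta> B \<le> hausdorff2_outer (A \<union> B)" .
  qed
  finally show ?thesis .
qed

text \<open>Caratheodory's criterion. \<open>G k\<close>, the part of A at distance at least 1/(k+1)
  from F, is separated from \<open>A \<inter> F\<close>, so outer measures add up there. What
  \<open>G N\<close> misses of A - F lies in the shells \<open>R j\<close> with j \<ge> N, and the
  outer measures of the shells form a convergent series.\<close>

lemma closed_in_lambda_system_hausdorff2:
  fixes F :: "(real^3) set"
  assumes "closed F"
  shows "F \<in> lambda_system UNIV UNIV hausdorff2_outer"
proof -
  have main: "hausdorff2_outer (A \<inter> F) + hausdorff2_outer (A - F) \<le> hausdorff2_outer A"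
    if "F \<noteq> {}" and fin: "hausdorff2_outer A \<noteq> \<top>" for A
  proof -
    define G where "G = (\<lambda>k::nat. {x\<in>A. 1 / real (Suc k) \<le> infdist x F})"
    define R where "R = (\<lambda>k. G (Suc k) - G k)"
    have GF: "hausdorff2_outer (A \<inter> F) + hausdorff2_outer (G k) \<le> hausdorff2_outer A" for k
    proof -
      have "hausdorff2_outer (A \<inter> F) + hausdorff2_outer (G k) \<le> hausdorff2_outer ((A \<inter> F) \<union> G k)"
      proof (rule hausdorff2_outer_separated[of "1 / real (Suc k)"])
        fix a b assume "a \<in> A \<inter> F" "b \<in> G k"
        then show "1 / real (Suc k) \<le> dist a b"
          using infdist_le[of a F b] by (auto simp: G_def dist_commute)
      qed auto
      also have "\<dots> \<le> hausdorff2_outer A"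
        by (rule hausdorff2_outer_mono) (auto simp: G_def)
      finally show ?thesis .
    qed
    \<comment> \<open>Consecutive shells may touch, but shells whose indices differ by at least 2
      are a positive distance apart; hence the split by parity.\<close>
    have part: "(\<Sum>j<n. hausdorff2_outer (R (2*j+s))) \<le> hausdorff2_outer (\<Union>j<n. R (2*j+s))" for n s
    proof (induction n)
      case (Suc n)
      show ?case
      proof (cases "n = 0")
        case False
        \<comment> \<open>Earlier shells of the same parity keep distance at least 1/(2n+s) from F,
          while points of \<open>R (2*n+s)\<close> are closer than 1/(2n+s+1). For n = 0 there is no
          earlier shell.\<close>
        define \<eta> where "\<eta> = 1 / real (2*n+s) - 1 / real (2*n+s+1)"
        have "hausdorff2_outer (\<Union>j<n. R (2*j+s)) + hausdorff2_outer (R (2*n+s))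
           \<le> hausdorff2_outer ((\<Union>j<n. R (2*j+s)) \<union> R (2*n+s))"
        proof (rule hausdorff2_outer_separated[of \<eta>])
          show "0 < \<eta>" using False by (auto simp: \<eta>_def intro!: divide_strict_left_mono)
          fix a b assume "a \<in> (\<Union>j<n. R (2*j+s))" and b: "b \<in> R (2*n+s)"
          then obtain j where j: "j < n" "a \<in> R (2*j+s)" by auto
          have "1 / real (2*n+s) \<le> 1 / real (Suc (Suc (2*j+s)))"
            using j by (intro divide_left_mono) auto
          also have "\<dots> \<le> infdist a F" using j(2) by (simp add: R_def G_def)
          finally have 1: "1 / real (2*n+s) \<le> infdist a F" .
          have 2: "infdist b F < 1 / real (2*n+s+1)"
            using b by (auto simp: R_def G_def)
          have "infdist a F \<le> infdist b F + dist a b" by (rule infdist_triangle)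
          with 1 2 show "\<eta> \<le> dist a b" by (simp add: \<eta>_def)
        qed
        with Suc.IH show ?thesis
          by (simp add: lessThan_Suc Un_commute add.commute) (meson add_left_mono order_trans)
      qed auto
    qed simp
    \<comment> \<open>Each parity contributes at most the outer measure of A.\<close>
    have sumR: "(\<Sum>j. hausdorff2_outer (R j)) \<le> 2 * hausdorff2_outer A"
    proof (rule suminf_le_const[OF summableI])
      fix n
      have "(\<Sum>j<n. hausdorff2_outer (R j)) \<le> (\<Sum>j<2*n. hausdorff2_outer (R j))"
        by (rule sum_mono2) auto
      also have "\<dots> = (\<Sum>j<n. hausdorff2_outer (R (2*j+0))) + (\<Sum>j<n. hausdorff2_outer (R (2*j+1)))"
        by (induction n) (auto simp: algebra_simps)
      also have "\<dots> \<le> hausdorff2_outer A + hausdorff2_outer A"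
        by (intro add_mono order_trans[OF part] hausdorff2_outer_mono) (auto simp: R_def G_def)
      finally show "(\<Sum>j<n. hausdorff2_outer (R j)) \<le> 2 * hausdorff2_outer A"
        by (simp add: mult_2)
    qed
    have nt: "(\<Sum>j. hausdorff2_outer (R j)) \<noteq> \<top>"
      using sumR fin by (auto simp: top_unique ennreal_mult_eq_top_iff)
    define r where "r = (\<lambda>j. enn2real (hausdorff2_outer (R j)))"
    have Rr: "hausdorff2_outer (R j) = ennreal (r j)" for j
    proof -
      have "hausdorff2_outer (R j) \<noteq> \<top>"
        using nt by (metis ennreal_suminf_lessD less_top)
      then show ?thesis by (simp add: r_def less_top)
    qed
    have r0: "0 \<le> r j" for j by (simp add: r_def)
    have sr: "summable r"
      using nt r0 by (intro summable_suminf_not_top) (auto simp: Rr)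
    show ?thesis
    proof (rule ennreal_le_epsilon)
      fix e :: real assume "0 < e"
      obtain N where N: "\<And>n. n \<ge> N \<Longrightarrow> norm (\<Sum>i. r (i + n)) < e"
        using suminf_exist_split[OF \<open>0 < e\<close> sr] by blast
      have cov: "A - F \<subseteq> G N \<union> (\<Union>j. R (j + N))"
      proof
        fix x assume x: "x \<in> A - F"
        have "infdist x F > 0"
          using x \<open>closed F\<close> \<open>F \<noteq> {}\<close> infdist_pos_not_in_closed by auto
        then obtain k where "1 / real (Suc k) < infdist x F"
          using nat_approx_posE by blast
        then have ex: "x \<in> G k" using x by (auto simp: G_def)
        \<comment> \<open>If the first index m with x in \<open>G m\<close> exceeds N, then x lies
          in the shell \<open>R (m - 1)\<close> of the tail.\<close>
        define m where "m = (LEAST k. x \<in> G k)"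
        have m: "x \<in> G m" unfolding m_def by (rule LeastI[of "\<lambda>k. x \<in> G k", OF ex])
        show "x \<in> G N \<union> (\<Union>j. R (j + N))"
        proof (cases "m \<le> N")
          case True
          then have "1 / real (Suc N) \<le> 1 / real (Suc m)" by (intro divide_left_mono) auto
          then show ?thesis using m by (auto simp: G_def)
        next
          case False
          then obtain j where j: "m = Suc (j + N)" by (metis add.commute less_imp_Suc_add not_le)
          have "x \<notin> G (j + N)"
            using not_less_Least[of "j+N" "\<lambda>k. x \<in> G k"] j m_def by auto
          then show ?thesis using m j by (auto simp: R_def)
        qed
      qed
      have "hausdorff2_outer (A - F) \<le> hausdorff2_outer (G N) + hausdorff2_outer (\<Union>j. R (j + N))"
        using cov hausdorff2_outer_mono hausdorff2_outer_Un_le order_trans by blast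
      also have "\<dots> \<le> hausdorff2_outer (G N) + (\<Sum>j. hausdorff2_outer (R (j + N)))"
        by (intro add_left_mono hausdorff2_outer_UN_le)
      also have "(\<Sum>j. hausdorff2_outer (R (j + N))) = ennreal (\<Sum>j. r (j + N))"
        unfolding Rr using sr r0 by (intro suminf_ennreal2) (auto simp: summable_iff_shift)
      also have "\<dots> \<le> ennreal e"
        using N[of N] by (intro ennreal_leI) auto
      finally have "hausdorff2_outer (A - F) \<le> hausdorff2_outer (G N) + ennreal e"
        by (simp add: add_left_mono)
      then have "hausdorff2_outer (A \<inter> F) + hausdorff2_outer (A - F)
          \<le> (hausdorff2_outer (A \<inter> F) + hausdorff2_outer (G N)) + ennreal e"
        by (simp add: add.assoc add_left_mono)
      also have "\<dots> \<le> hausdorff2_outer A + ennreal e" by (intro add_right_mono GF)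
      finally show "hausdorff2_outer (A \<inter> F) + hausdorff2_outer (A - F) \<le> hausdorff2_outer A + ennreal e" .
    qed
  qed
  have "hausdorff2_outer (F \<inter> A) + hausdorff2_outer ((UNIV - F) \<inter> A) = hausdorff2_outer A" for A
  proof (rule antisym)
    have *: "(UNIV - F) \<inter> A = A - F" "F \<inter> A = A \<inter> F" by auto
    show "hausdorff2_outer (F \<inter> A) + hausdorff2_outer ((UNIV - F) \<inter> A) \<le> hausdorff2_outer A"
      unfolding * using main[of A] by (cases "F = {}"; cases "hausdorff2_outer A = \<top>") auto
    have "A = F \<inter> A \<union> (UNIV - F) \<inter> A" by auto
    then show "hausdorff2_outer A \<le> hausdorff2_outer (F \<inter> A) + hausdorff2_outer ((UNIV - F) \<inter> A)"
      using hausdorff2_outer_Un_le by metis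
  qed
  then show ?thesis by (auto simp: lambda_system_def)
qed

lemma space_hausdorff2 [simp]: "space hausdorff2 = UNIV"
  by (simp add: hausdorff2_def)

lemma sets_hausdorff2 [simp, measurable_cong]: "sets hausdorff2 = sets borel"
  unfolding hausdorff2_def by (metis sets.sets_measure_of_eq space_borel)

text \<open>\<open>measure_of\<close> returns the given set function only where it is countably
  additive. The sets satisfying Caratheodory's condition form a sigma-algebra with this property,
  and it contains the closed sets, hence all Borel sets.\<close>

lemma emeasure_hausdorff2:
  assumes "A \<in> sets borel"
  shows "emeasure hausdorff2 A = hausdorff2_outer A"
proof -
  interpret U: sigma_algebra UNIV "UNIV :: (real^3) set set"
    using sigma_algebra_Pow[of UNIV] by simp
  let ?L = "lambda_system UNIV UNIV hausdorff2_outer"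
  have oms: "outer_measure_space UNIV hausdorff2_outer"
    by (auto simp: outer_measure_space_def positive_def increasing_def countably_subadditive_def
        intro: hausdorff2_outer_mono hausdorff2_outer_UN_le)
  have ms: "measure_space UNIV ?L hausdorff2_outer"
    by (rule U.caratheodory_lemma[OF oms])
  then have L: "sigma_algebra UNIV ?L" by (simp add: measure_space_def)
  have "sets (borel :: (real^3) measure) = sigma_sets UNIV (Collect closed)"
    by (simp add: borel_eq_closed)
  also have "\<dots> \<subseteq> ?L"
    by (rule sigma_algebra.sigma_sets_subset[OF L]) (auto intro: closed_in_lambda_system_hausdorff2)
  finally have sub: "sets (borel :: (real^3) measure) \<subseteq> ?L" .
  show ?thesis
    unfolding hausdorff2_def
  proof (rule emeasure_measure_of_sigma)
    show "sigma_algebra UNIV (sets borel :: (real^3) set set)"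
      using sets.sigma_algebra_axioms[of "borel :: (real^3) measure"] by simp
    show "positive (sets borel) hausdorff2_outer" by (simp add: positive_def)
    show "countably_additive (sets borel) hausdorff2_outer"
      using ms sub by (auto simp: measure_space_def countably_additive_def)
  qed fact
qed

text \<open>The images of a cover form a cover whose diameters are scaled by L and whose weights by
  L^2. Both halves of the area formula rest on this.\<close>

lemma hausdorff2_outer_lipschitz_image_le:
  fixes f :: "real^3 \<Rightarrow> real^3"
  assumes "0 < L" and lip: "\<And>x y. x \<in> A \<Longrightarrow> y \<in> A \<Longrightarrow> dist (f x) (f y) \<le> L * dist x y"
  shows "hausdorff2_outer (f ` A) \<le> ennreal (L\<^sup>2) * hausdorff2_outer A"
proof (rule hausdorff2_outer_leI)
  fix \<delta> :: real assume "0 < \<delta>"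
  let ?w = "\<lambda>S::(real^3) set. ennreal (pi / 4 * (diameter S)\<^sup>2)"
  have "hausdorff2_delta \<delta> (f ` A) \<le> ennreal (L\<^sup>2) * hausdorff2_delta (\<delta>/L) A"
  proof -
    let ?I = "{C. A \<subseteq> (\<Union>n. C n) \<and> (\<forall>n::nat. bounded (C n) \<and> diameter (C n) \<le> \<delta>/L)}"
    have K: "0 < ennreal (L\<^sup>2)" "ennreal (L\<^sup>2) \<noteq> \<top>" using \<open>0 < L\<close> by auto
    \<comment> \<open>Division by L^2 turns the claim into a lower bound for an infimum, which is
      checked cover by cover.\<close>
    have "hausdorff2_delta \<delta> (f ` A) / ennreal (L\<^sup>2) \<le> (INF C\<in>?I. \<Sum>n. ?w (C n))"
    proof (rule INF_greatest)
      fix C assume "C \<in> ?I"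
      then have C: "A \<subseteq> (\<Union>n. C n)" "\<And>n. bounded (C n)" "\<And>n. diameter (C n) \<le> \<delta>/L" by auto
      \<comment> \<open>The pieces are cut down to A, where the Lipschitz bound holds.\<close>
      let ?D = "\<lambda>n. f ` (C n \<inter> A)"
      have d: "dist (f x) (f y) \<le> L * diameter (C n)" if "x \<in> C n \<inter> A" "y \<in> C n \<inter> A" for x y n
      proof -
        have "dist (f x) (f y) \<le> L * dist x y" using lip that by auto
        also have "\<dots> \<le> L * diameter (C n)"
          using that \<open>0 < L\<close> C(2) by (intro mult_left_mono diameter_bounded_bound) auto
        finally show ?thesis .
      qed
      have bd: "bounded (?D n)" for n
        using d unfolding bounded_two_points by blast
      have dia: "diameter (?D n) \<le> L * diameter (C n)" for n
      proof (rule diameter_le)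
        show "?D n \<noteq> {} \<or> 0 \<le> L * diameter (C n)"
          using \<open>0 < L\<close> diameter_ge_0[OF C(2)] by simp
      qed (use d in \<open>auto simp: dist_norm\<close>)
      have "hausdorff2_delta \<delta> (f ` A) \<le> (\<Sum>n. ?w (?D n))"
      proof (rule hausdorff2_delta_le)
        show "f ` A \<subseteq> (\<Union>n. ?D n)" using C(1) by blast
        show "diameter (?D n) \<le> \<delta>" for n
          using dia[of n] C(3)[of n] \<open>0 < L\<close> by (simp add: field_simps)
      qed (rule bd)
      also have "\<dots> \<le> (\<Sum>n. ennreal (L\<^sup>2) * ?w (C n))"
      proof (rule suminf_le)
        fix n
        have "(diameter (?D n))\<^sup>2 \<le> (L * diameter (C n))\<^sup>2"
          using dia bd by (intro power_mono diameter_ge_0) auto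
        then show "?w (?D n) \<le> ennreal (L\<^sup>2) * ?w (C n)"
          by (simp add: ennreal_mult[symmetric] power_mult_distrib ennreal_leI mult.left_commute)
      qed auto
      also have "\<dots> = ennreal (L\<^sup>2) * (\<Sum>n. ?w (C n))" by simp
      finally show "hausdorff2_delta \<delta> (f ` A) / ennreal (L\<^sup>2) \<le> (\<Sum>n. ?w (C n))"
        by (rule divide_le_posI_ennreal[OF K(1)])
    qed
    then have "ennreal (L\<^sup>2) * (hausdorff2_delta \<delta> (f ` A) / ennreal (L\<^sup>2))
        \<le> ennreal (L\<^sup>2) * hausdorff2_delta (\<delta>/L) A"
      unfolding hausdorff2_delta_def[of "\<delta>/L"] by (rule mult_left_mono) simp
    moreover have "ennreal (L\<^sup>2) * (hausdorff2_delta \<delta> (f ` A) / ennreal (L\<^sup>2)) = hausdorff2_delta \<delta> (f ` A)"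
      unfolding ennreal_times_divide mult.commute[of "ennreal (L\<^sup>2)"]
      using K by (intro mult_divide_eq_ennreal) auto
    ultimately show ?thesis by simp
  qed
  also have "\<dots> \<le> ennreal (L\<^sup>2) * hausdorff2_outer A"
    using \<open>0 < L\<close> \<open>0 < \<delta>\<close> by (intro mult_left_mono hausdorff2_delta_le_outer) auto
  finally show "hausdorff2_delta \<delta> (f ` A) \<le> ennreal (L\<^sup>2) * hausdorff2_outer A" .
qed

lemma hausdorff2_outer_isometry:
  fixes f :: "real^3 \<Rightarrow> real^3"
  assumes "\<And>x y. x \<in> A \<Longrightarrow> y \<in> A \<Longrightarrow> dist (f x) (f y) = dist x y"
  shows "hausdorff2_outer (f ` A) = hausdorff2_outer A"
proof (rule antisym)
  show "hausdorff2_outer (f ` A) \<le> hausdorff2_outer A"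
    using hausdorff2_outer_lipschitz_image_le[of 1 A f] assms by simp
  have inj: "inj_on f A" using assms by (metis dist_eq_0_iff inj_onI)
  have "hausdorff2_outer (inv_into A f ` f ` A) \<le> ennreal (1\<^sup>2) * hausdorff2_outer (f ` A)"
  proof (rule hausdorff2_outer_lipschitz_image_le)
    fix x y assume "x \<in> f ` A" "y \<in> f ` A"
    then show "dist (inv_into A f x) (inv_into A f y) \<le> 1 * dist x y"
      using assms inj by auto
  qed simp
  then show "hausdorff2_outer A \<le> hausdorff2_outer (f ` A)"
    using inj by simp
qed

section \<open>Hausdorff measure on planes\<close>

text \<open>Uniqueness of Haar measure: the double integral of
  \<open>indicator E x * indicator F (x + y)\<close> is evaluated in both orders. The symmetric
  product form avoids dividing by a measure that might be 0 or infinite.\<close>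

lemma translation_invariant_proportional_lborel:
  fixes \<mu> :: "'a::euclidean_space measure"
  assumes sets_mu [measurable_cong]: "sets \<mu> = sets borel" and "sigma_finite_measure \<mu>"
    and inv: "\<And>a. distr \<mu> borel ((+) a) = \<mu>"
    and [measurable]: "E \<in> sets borel" "F \<in> sets borel"
  shows "emeasure \<mu> E * emeasure lborel F = emeasure \<mu> F * emeasure lborel E"
proof -
  interpret sigma_finite_measure \<mu> by fact
  interpret P: pair_sigma_finite \<mu> lborel ..
  have "emeasure \<mu> E * emeasure lborel F = (\<integral>\<^sup>+x. indicator E x * emeasure lborel F \<partial>\<mu>)"
    by (simp add: nn_integral_multc)
  also have "\<dots> = (\<integral>\<^sup>+x. (\<integral>\<^sup>+y. indicator E x * indicator F (x + y) \<partial>lborel) \<partial>\<mu>)"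
  proof (rule nn_integral_cong)
    fix x
    have "emeasure lborel F = (\<integral>\<^sup>+y. indicator F y \<partial>distr lborel borel ((+) x))"
      by (simp add: lborel_distr_plus)
    also have "\<dots> = (\<integral>\<^sup>+y. indicator F (x + y) \<partial>lborel)"
      by (subst nn_integral_distr) auto
    finally show "indicator E x * emeasure lborel F = (\<integral>\<^sup>+y. indicator E x * indicator F (x + y) \<partial>lborel)"
      by (simp add: nn_integral_cmult)
  qed
  also have "\<dots> = (\<integral>\<^sup>+y. (\<integral>\<^sup>+x. indicator E x * indicator F (x + y) \<partial>\<mu>) \<partial>lborel)"
    by (rule P.Fubini'[symmetric]) measurable
  also have "\<dots> = (\<integral>\<^sup>+y. (\<integral>\<^sup>+x. indicator E (x - y) * indicator F x \<partial>\<mu>) \<partial>lborel)"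
  proof (rule nn_integral_cong)
    fix y
    have "(\<integral>\<^sup>+x. indicator E (x - y) * indicator F x \<partial>\<mu>)
        = (\<integral>\<^sup>+x. indicator E (x - y) * indicator F x \<partial>distr \<mu> borel ((+) y))"
      by (simp add: inv)
    also have "\<dots> = (\<integral>\<^sup>+x. indicator E x * indicator F (x + y) \<partial>\<mu>)"
      by (subst nn_integral_distr) (auto simp: add.commute)
    finally show "(\<integral>\<^sup>+x. indicator E x * indicator F (x + y) \<partial>\<mu>)
        = (\<integral>\<^sup>+x. indicator E (x - y) * indicator F x \<partial>\<mu>)" by simp
  qed
  also have "\<dots> = (\<integral>\<^sup>+x. (\<integral>\<^sup>+y. indicator E (x - y) * indicator F x \<partial>lborel) \<partial>\<mu>)"
    by (rule P.Fubini') measurable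
  also have "\<dots> = (\<integral>\<^sup>+x. emeasure lborel E * indicator F x \<partial>\<mu>)"
  proof (rule nn_integral_cong)
    fix x
    \<comment> \<open>The reflection y to x - y preserves Lebesgue measure, the affine factor being
      |-1|^n.\<close>
    have "emeasure lborel E = (\<integral>\<^sup>+y. indicator E y \<partial>density (distr lborel borel (\<lambda>y. x + (-1) *\<^sub>R y)) (\<lambda>_. ennreal (\<bar>-1::real\<bar>^DIM('a))))"
      by (subst lborel_affine[symmetric]) auto
    also have "\<dots> = (\<integral>\<^sup>+y. indicator E (x - y) \<partial>lborel)"
      unfolding power_abs abs_minus_cancel abs_one power_one ennreal_1 density_1
      by (subst nn_integral_distr) auto
    finally show "(\<integral>\<^sup>+y. indicator E (x - y) * indicator F x \<partial>lborel) = emeasure lborel E * indicator F x"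
      by (simp add: nn_integral_multc)
  qed
  also have "\<dots> = emeasure \<mu> F * emeasure lborel E"
    by (subst nn_integral_cmult) (auto simp: mult.commute)
  finally show ?thesis .
qed

definition plane_embed :: "real^2 \<Rightarrow> real^3" where
  "plane_embed u = vector [u $ 1, u $ 2, 0]"

definition plane_proj :: "real^3 \<Rightarrow> real^2" where
  "plane_proj y = vector [y $ 1, y $ 2]"

lemma plane_proj_embed [simp]: "plane_proj (plane_embed u) = u"
  by (simp add: vec_eq_iff forall_2 plane_proj_def plane_embed_def)

lemma plane_embed_diff: "plane_embed u - plane_embed v = plane_embed (u - v)"
  by (simp add: vec_eq_iff forall_3 plane_embed_def)

lemma plane_embed_add: "plane_embed (u + v) = plane_embed u + plane_embed v"
  by (simp add: vec_eq_iff forall_3 plane_embed_def)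

lemma norm_plane_embed [simp]: "norm (plane_embed u) = norm u"
  by (simp add: norm_vec_def L2_set_def sum_2 sum_3 plane_embed_def)

lemma dist_plane_embed [simp]: "dist (plane_embed u) (plane_embed v) = dist u v"
  by (simp add: dist_norm plane_embed_diff)

lemma plane_embed_proj: "y $ 3 = 0 \<Longrightarrow> plane_embed (plane_proj y) = y"
  by (simp add: vec_eq_iff forall_3 plane_embed_def plane_proj_def)

lemma bounded_linear_plane_proj: "bounded_linear plane_proj"
  by (intro linear_conv_bounded_linear[THEN iffD1] linearI)
    (simp_all add: vec_eq_iff forall_2 plane_proj_def)

lemma dist_plane_proj_le: "dist (plane_proj x) (plane_proj y) \<le> dist x y"
proof -
  have "norm (plane_proj (x - y)) \<le> norm (x - y)"
    by (simp add: norm_vec_def L2_set_def sum_2 sum_3 plane_proj_def)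
  then show ?thesis
    using linear_diff[OF bounded_linear.linear[OF bounded_linear_plane_proj], of x y]
    by (simp add: dist_norm)
qed

lemma measurable_plane_proj [measurable]: "plane_proj \<in> borel_measurable borel"
  by (intro borel_measurable_continuous_onI linear_continuous_on bounded_linear_plane_proj)

text \<open>A preimage cut with a closed plane is visibly Borel.\<close>

lemma image_plane_embed: "plane_embed ` B = plane_proj -` B \<inter> {y. y $ 3 = 0}"
  using plane_embed_proj by (auto simp: plane_embed_def[of "_"] image_iff)
    (metis plane_proj_embed plane_embed_def, metis)

lemma closed_plane: "closed {y::real^3. y $ 3 = 0}"
  by (intro closed_Collect_eq continuous_intros)

lemma plane_embed_image_borel [measurable]: "B \<in> sets borel \<Longrightarrow> plane_embed ` B \<in> sets borel"
  unfolding image_plane_embed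
  using measurable_sets_borel[OF measurable_plane_proj, of B] borel_closed[OF closed_plane]
  by auto

text \<open>A grid of N^2 squares of side 1/N, of diameter at most 2/N by the l1 bound, has total
  weight at most N^2 (pi/4) (2/N)^2 = pi.\<close>

lemma hausdorff2_outer_unit_square_le: "hausdorff2_outer (plane_embed ` cbox 0 1) \<le> ennreal pi"
proof (rule hausdorff2_outer_leI)
  fix \<delta> :: real assume "0 < \<delta>"
  obtain N :: nat where N: "2 / \<delta> < real N" using reals_Archimedean2 by blast
  then have N0: "N > 0" using \<open>0 < \<delta>\<close> by (metis divide_pos_pos gr0I of_nat_0 order_less_asym zero_less_numeral)
  \<comment> \<open>Cell k has first coordinate index k div N and second k mod N; from index N^2 on
    the sets are empty and add nothing to the series.\<close>
  define C :: "nat \<Rightarrow> (real^3) set" where "C = (\<lambda>k. if k < N * N then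
     {y. y $ 3 = 0 \<and> y $ 1 \<in> {real (k div N) / N .. (real (k div N) + 1) / N}
        \<and> y $ 2 \<in> {real (k mod N) / N .. (real (k mod N) + 1) / N}} else {})"
  have d: "dist x y \<le> 2 / N" if "x \<in> C k" "y \<in> C k" for x y k
  proof -
    have *: "\<bar>a - b\<bar> \<le> 1 / N" if "a \<in> {r / N .. (r + 1) / N}" "b \<in> {r / N .. (r + 1) / N}" for a b r :: real
      using that by (auto simp: abs_le_iff add_divide_distrib)
    have "dist x y \<le> (\<Sum>i\<in>UNIV. \<bar>(x - y) $ i\<bar>)" unfolding dist_norm by (rule norm_le_l1_cart)
    also have "\<dots> \<le> 1 / N + 1 / N + 0"
      unfolding sum_3
    proof (intro add_mono)
      show "\<bar>(x - y) $ 1\<bar> \<le> 1 / N" "\<bar>(x - y) $ 2\<bar> \<le> 1 / N"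
        using that by (auto simp: C_def intro!: * split: if_splits)
      show "\<bar>(x - y) $ 3\<bar> \<le> 0" using that by (auto simp: C_def split: if_splits)
    qed
    finally show ?thesis by simp
  qed
  have bd: "bounded (C k)" for k using d unfolding bounded_two_points by blast
  have dia: "diameter (C k) \<le> 2 / N" for k
    by (rule diameter_le) (use d in \<open>auto simp: dist_norm\<close>)
  have "hausdorff2_delta \<delta> (plane_embed ` cbox 0 1) \<le> (\<Sum>k. ennreal (pi / 4 * (diameter (C k))\<^sup>2))"
  proof (rule hausdorff2_delta_le)
    show "plane_embed ` cbox 0 1 \<subseteq> (\<Union>k. C k)"
    proof clarify
      fix u :: "real^2" assume "u \<in> cbox 0 1"
      then have u: "0 \<le> u $ 1" "u $ 1 \<le> 1" "0 \<le> u $ 2" "u $ 2 \<le> 1"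
        by (auto simp: mem_box_cart forall_2)
      have ex: "\<exists>i<N. s \<in> {real i / N .. (real i + 1) / N}" if "0 \<le> s" "s \<le> 1" for s :: real
      \<comment> \<open>The right endpoint goes to the last cell, since the floor would point to a
        nonexistent cell N.\<close>
      proof (cases "s = 1")
        case True
        then show ?thesis using N0 by (intro exI[of _ "N - 1"]) (auto simp: field_simps of_nat_diff)
      next
        case False
        have *: "real (nat \<lfloor>s * N\<rfloor>) \<le> s * N" "s * N < real (nat \<lfloor>s * N\<rfloor>) + 1"
          using that by (auto simp: of_nat_nat)
        have "s * N < N" using False that N0 by simp
        with * have "real (nat \<lfloor>s * N\<rfloor>) < real N" by linarith
        then have "nat \<lfloor>s * N\<rfloor> < N" by simp
        with * show ?thesis
          using N0 by (intro exI[of _ "nat \<lfloor>s * N\<rfloor>"]) (auto simp: field_simps)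
      qed
      obtain i j where ij: "i < N" "u $ 1 \<in> {real i / N .. (real i + 1) / N}"
          "j < N" "u $ 2 \<in> {real j / N .. (real j + 1) / N}"
        using ex u by meson
      have "i * N + j < N * N"
      proof -
        have "i * N + j < Suc i * N" using ij by simp
        also have "\<dots> \<le> N * N" using ij by (intro mult_le_mono1) simp
        finally show ?thesis .
      qed
      then have "plane_embed u \<in> C (i * N + j)"
        using ij N0 by (simp add: C_def plane_embed_def)
      then show "plane_embed u \<in> (\<Union>k. C k)" by blast
    qed
    show "diameter (C k) \<le> \<delta>" for k
    proof -
      have "2 / N \<le> \<delta>" using N \<open>0 < \<delta>\<close> N0 by (simp add: field_simps)
      then show ?thesis using dia[of k] by linarith
    qed
  qed (rule bd)
  also have "\<dots> = (\<Sum>k<N*N. ennreal (pi / 4 * (diameter (C k))\<^sup>2))"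
    by (rule suminf_finite) (auto simp: C_def)
  also have "\<dots> \<le> (\<Sum>k<N*N. ennreal (pi / 4 * (2 / N)\<^sup>2))"
    by (intro sum_mono ennreal_leI mult_left_mono power_mono dia diameter_ge_0 bd) auto
  also have "\<dots> = ennreal pi"
    using N0 by (simp add: ennreal_of_nat_eq_real_of_nat ennreal_mult[symmetric] power2_eq_square field_simps)
  finally show "hausdorff2_delta \<delta> (plane_embed ` cbox 0 1) \<le> ennreal pi" .
qed

lemma One_eq_1: "(One :: real^'n) = 1"
proof -
  have "(One :: real^'n) $ i = 1" for i
    using inner_sum_left_Basis[of "axis i 1 :: real^'n" "\<lambda>_. 1"] by (simp add: inner_axis)
  then show ?thesis by (simp add: vec_eq_iff)
qed

text \<open>A covering set of diameter d projects into a square of side 2 d, whose area 4 d^2 is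
  16/pi times the weight (pi/4) d^2. Subadditivity of Lebesgue measure bounds the total weight below
  by pi/16.\<close>

lemma hausdorff2_outer_unit_square_ge: "ennreal (pi / 16) \<le> hausdorff2_outer (plane_embed ` cbox 0 1)"
proof -
  let ?w = "\<lambda>S::(real^3) set. ennreal (pi / 4 * (diameter S)\<^sup>2)"
  have "ennreal (pi / 16) \<le> hausdorff2_delta 1 (plane_embed ` cbox 0 1)"
    unfolding hausdorff2_delta_def
  proof (rule INF_greatest)
    fix C :: "nat \<Rightarrow> (real^3) set"
    assume "C \<in> {C. plane_embed ` cbox 0 1 \<subseteq> (\<Union>n. C n) \<and> (\<forall>n. bounded (C n) \<and> diameter (C n) \<le> 1)}"
    then have C: "plane_embed ` cbox 0 1 \<subseteq> (\<Union>n. C n)" "\<And>n. bounded (C n)" by auto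
    \<comment> \<open>Any point of the set can serve as the centre. For an empty set it is
      arbitrary, and the square shrinks to a point.\<close>
    define z where "z = (\<lambda>n. plane_proj (SOME y. y \<in> C n))"
    define B where "B = (\<lambda>n. cbox (z n - diameter (C n) *\<^sub>R One) (z n + diameter (C n) *\<^sub>R One))"
    have d0: "0 \<le> diameter (C n)" for n using C(2) by (rule diameter_ge_0)
    have "plane_proj ` C n \<subseteq> B n" for n
    proof clarify
      fix y assume y: "y \<in> C n"
      then have "(SOME y. y \<in> C n) \<in> C n" by (rule someI)
      then have "dist (plane_proj y) (z n) \<le> diameter (C n)"
        unfolding z_def using dist_plane_proj_le y C(2) diameter_bounded_bound order_trans by blast
      moreover have "\<bar>(plane_proj y - z n) \<bullet> b\<bar> \<le> dist (plane_proj y) (z n)" if "b \<in> Basis" for b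
        using Basis_le_norm[OF that] by (simp add: dist_norm)
      ultimately have "\<bar>(plane_proj y - z n) \<bullet> b\<bar> \<le> diameter (C n)" if "b \<in> Basis" for b
        using that order_trans by blast
      then show "plane_proj y \<in> B n"
        by (auto simp: B_def mem_box inner_diff_left inner_add_left abs_le_iff algebra_simps)
    qed
    then have cov: "cbox 0 One \<subseteq> (\<Union>n. B n)"
    proof -
      have "u \<in> (\<Union>n. B n)" if "u \<in> cbox 0 One" for u
      proof -
        have "plane_embed u \<in> (\<Union>n. C n)"
          using that by (intro subsetD[OF C(1)] imageI) (simp add: One_eq_1)
        then obtain n where "plane_embed u \<in> C n" by auto
        then have "plane_proj (plane_embed u) \<in> B n" using \<open>\<And>n. plane_proj ` C n \<subseteq> B n\<close> by blast
        then show ?thesis by auto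
      qed
      then show ?thesis by blast
    qed
    have "1 = emeasure lborel (cbox 0 One :: (real^2) set)"
      by (subst emeasure_lborel_cbox) auto
    also have "\<dots> \<le> emeasure lborel (\<Union>n. B n)"
      using cov by (intro emeasure_mono) (auto simp: B_def)
    also have "\<dots> \<le> (\<Sum>n. emeasure lborel (B n))"
      by (rule emeasure_subadditive_countably) (auto simp: B_def)
    also have "\<dots> = (\<Sum>n. ennreal (16 / pi) * ?w (C n))"
    proof (rule arg_cong[where f = suminf], rule ext)
      fix n
      have "emeasure lborel (B n) = ennreal (\<Prod>b\<in>(Basis::(real^2) set). 2 * diameter (C n))"
      proof -
        have "z n + diameter (C n) *\<^sub>R One - (z n - diameter (C n) *\<^sub>R One) = (2 * diameter (C n)) *\<^sub>R One"
          by (simp add: vec_eq_iff)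
        then show ?thesis
          unfolding B_def using d0[of n]
          by (subst emeasure_lborel_cbox) (simp_all add: inner_diff_left inner_add_left)
      qed
      also have "\<dots> = ennreal (16 / pi) * ?w (C n)"
        by (simp add: ennreal_mult[symmetric] power2_eq_square)
      finally show "emeasure lborel (B n) = ennreal (16 / pi) * ?w (C n)" .
    qed
    also have "\<dots> = ennreal (16 / pi) * (\<Sum>n. ?w (C n))" by simp
    finally have "ennreal (pi / 16) * 1 \<le> ennreal (pi / 16) * (ennreal (16 / pi) * (\<Sum>n. ?w (C n)))"
      by (rule mult_left_mono) simp
    also have "\<dots> = (\<Sum>n. ?w (C n))"
      by (simp add: mult.assoc[symmetric] ennreal_mult[symmetric] del: ennreal_suminf_cmult)
    finally show "ennreal (pi / 16) \<le> (\<Sum>n. ?w (C n))" by simp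
  qed
  also have "\<dots> \<le> hausdorff2_outer (plane_embed ` cbox 0 1)"
    by (rule hausdorff2_delta_le_outer) simp
  finally show ?thesis .
qed

text \<open>Built as the pushforward of a restricted measure, so that countable additivity is
  automatic.\<close>

definition plane_measure :: "(real^2) measure" where
  "plane_measure = distr (density hausdorff2 (indicator {y. y $ 3 = 0})) borel plane_proj"

lemma sets_plane_measure [simp, measurable_cong]: "sets plane_measure = sets borel"
  by (simp add: plane_measure_def)

lemma emeasure_plane_measure:
  assumes [measurable]: "B \<in> sets borel"
  shows "emeasure plane_measure B = hausdorff2_outer (plane_embed ` B)"
proof -
  have [measurable]: "{y::real^3. y $ 3 = 0} \<in> sets borel" by (rule borel_closed[OF closed_plane])
  have m: "plane_proj \<in> measurable (density hausdorff2 (indicator {y. y $ 3 = 0})) borel"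
    by measurable
  have [measurable]: "plane_proj -` B \<in> sets borel"
    using measurable_sets_borel[OF measurable_plane_proj] by auto
  have "emeasure plane_measure B = emeasure hausdorff2 ({y. y $ 3 = 0} \<inter> plane_proj -` B)"
    unfolding plane_measure_def
    by (subst emeasure_distr[OF m]) (auto simp: emeasure_density indicator_inter_arith[symmetric] nn_integral_indicator)
  also have "{y. y $ 3 = 0} \<inter> plane_proj -` B = plane_embed ` B"
    by (auto simp: image_plane_embed)
  finally show ?thesis by (simp add: emeasure_hausdorff2)
qed

text \<open>The value is 1 by the isodiametric inequality. Only positivity and finiteness matter here, because
  the constant cancels between \<open>M\<close> and the sphere.\<close>
definition hausdorff2_const :: real where
  "hausdorff2_const = enn2real (hausdorff2_outer (plane_embed ` cbox 0 1))"

lemma ennreal_hausdorff2_const: "ennreal hausdorff2_const = hausdorff2_outer (plane_embed ` cbox 0 1)"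
  unfolding hausdorff2_const_def using hausdorff2_outer_unit_square_le
  by (intro ennreal_enn2real) (simp add: le_less_trans)

lemma hausdorff2_const_pos: "0 < hausdorff2_const"
  unfolding hausdorff2_const_def using hausdorff2_outer_unit_square_le hausdorff2_outer_unit_square_ge
  by (auto simp: enn2real_positive_iff intro: le_less_trans less_le_trans[of 0 "ennreal (pi / 16)"])

text \<open>Translations are isometries, so the measure induced on the plane is translation
  invariant and hence a multiple of Lebesgue measure; the unit square fixes the factor.
  Sigma-finiteness is seen on squares obtained from the unit square by scaling.\<close>

theorem hausdorff2_plane:
  assumes [measurable]: "B \<in> sets borel"
  shows "hausdorff2_outer (plane_embed ` B) = ennreal hausdorff2_const * emeasure lborel B"
proof -
  have fin: "emeasure plane_measure (cbox (- (real n *\<^sub>R 1)) (real n *\<^sub>R 1)) \<noteq> \<top>" for n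
  proof -
    \<comment> \<open>An affine map taking the unit square to the square [-n, n]^2.\<close>
    let ?f = "\<lambda>y. (2 * real n) *\<^sub>R y - real n *\<^sub>R plane_embed 1"
    \<comment> \<open>The factor 2n + 1 instead of 2n keeps the Lipschitz constant positive at n =
      0.\<close>
    have "hausdorff2_outer (?f ` (plane_embed ` cbox 0 1)) \<le> ennreal ((2 * real n + 1)\<^sup>2) * hausdorff2_outer (plane_embed ` cbox 0 1)"
      by (rule hausdorff2_outer_lipschitz_image_le)
         (auto simp: dist_norm scaleR_diff_right[symmetric] plane_embed_diff intro!: mult_right_mono)
    also have "\<dots> < \<top>"
      by (simp add: ennreal_hausdorff2_const[symmetric] ennreal_mult[symmetric] less_imp_le[OF hausdorff2_const_pos])
    finally have "hausdorff2_outer (?f ` (plane_embed ` cbox 0 1)) < \<top>" .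
    moreover have "plane_embed ` (cbox (- (real n *\<^sub>R 1)) (real n *\<^sub>R 1)) \<subseteq> ?f ` (plane_embed ` cbox 0 1)"
    proof (cases "n = 0")
      case True
      then have "(cbox (- (real n *\<^sub>R 1)) (real n *\<^sub>R 1) :: (real^2) set) \<subseteq> {0}" by simp
      moreover have "plane_embed 0 = ?f (plane_embed 0)"
        using True by (simp add: vec_eq_iff plane_embed_def forall_3)
      moreover have "(0::real^2) \<in> cbox 0 1" by (simp add: mem_box_cart)
      ultimately show ?thesis by blast
    next
      case False
      show ?thesis
      proof clarify
        fix u :: "real^2" assume u: "u \<in> cbox (- (real n *\<^sub>R 1)) (real n *\<^sub>R 1)"
        let ?v = "(1 / (2 * real n)) *\<^sub>R (u + real n *\<^sub>R 1)"
        have "0 \<le> real n + u $ i \<and> u $ i \<le> real n" for i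
          using u by (simp add: mem_box_cart) (metis add.commute neg_le_iff_le minus_le_iff real_0_le_add_iff)
        then have "?v \<in> cbox 0 1" using False by (auto simp: mem_box_cart field_simps)
        moreover have "plane_embed u = ?f (plane_embed ?v)"
          using False by (simp add: vec_eq_iff plane_embed_def forall_3 field_simps)
        ultimately show "plane_embed u \<in> ?f ` (plane_embed ` cbox 0 1)" by blast
      qed
    qed
    ultimately show ?thesis
      using le_less_trans[OF hausdorff2_outer_mono] by (simp add: emeasure_plane_measure less_top)
  qed
  have sf: "sigma_finite_measure plane_measure"
  proof
    let ?A = "range (\<lambda>n. cbox (- (real n *\<^sub>R 1)) (real n *\<^sub>R 1) :: (real^2) set)"
    have "x \<in> \<Union>?A" for x
    proof -
      obtain n where n: "norm x \<le> real n" using real_arch_simple by blast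
      have "\<bar>x $ i\<bar> \<le> real n" for i using component_le_norm_cart[of x i] n by linarith
      then have "x \<in> cbox (- (real n *\<^sub>R 1)) (real n *\<^sub>R 1)"
        by (auto simp: mem_box_cart abs_le_iff) (metis minus_le_iff)
      then show ?thesis by blast
    qed
    then show "\<exists>A. countable A \<and> A \<subseteq> sets plane_measure \<and> \<Union>A = space plane_measure \<and> (\<forall>a\<in>A. emeasure plane_measure a \<noteq> \<infinity>)"
      using fin by (intro exI[of _ ?A]) (auto simp: plane_measure_def[THEN arg_cong[where f=space]])
  qed
  have inv: "distr plane_measure borel ((+) a) = plane_measure" for a
  proof (rule measure_eqI)
    fix A assume "A \<in> sets (distr plane_measure borel ((+) a))"
    then have [measurable]: "A \<in> sets borel" by simp
    have [measurable]: "(+) a -` A \<in> sets borel"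
      using measurable_sets_borel[of "(+) a" borel A] by simp
    have "emeasure (distr plane_measure borel ((+) a)) A = emeasure plane_measure ((+) a -` A)"
      by (subst emeasure_distr) (auto simp: plane_measure_def[THEN arg_cong[where f=space]])
    also have "\<dots> = hausdorff2_outer ((+) (plane_embed a) ` plane_embed ` ((+) a -` A))"
      by (simp add: emeasure_plane_measure hausdorff2_outer_isometry dist_norm)
    also have "(+) (plane_embed a) ` plane_embed ` ((+) a -` A) = plane_embed ` A"
    proof -
      have "(+) (plane_embed a) ` plane_embed ` ((+) a -` A) = plane_embed ` ((+) a ` ((+) a -` A))"
        unfolding image_image plane_embed_add ..
      also have "(+) a ` ((+) a -` A) = A"
        by (simp add: surj_image_vimage_eq)
      finally show ?thesis .
    qed
    finally show "emeasure (distr plane_measure borel ((+) a)) A = emeasure plane_measure A"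
      by (simp add: emeasure_plane_measure)
  qed simp
  have "emeasure plane_measure B * emeasure lborel (cbox 0 1 :: (real^2) set)
      = emeasure plane_measure (cbox 0 1) * emeasure lborel B"
    by (rule translation_invariant_proportional_lborel[OF _ sf inv]) auto
  moreover have "emeasure lborel (cbox 0 1 :: (real^2) set) = 1"
    unfolding One_eq_1[symmetric] by (subst emeasure_lborel_cbox) auto
  ultimately show ?thesis
    by (simp add: emeasure_plane_measure ennreal_hausdorff2_const)
qed

section \<open>Globalising local inequalities between measures; change of variables\<close>

lemma ennreal_le_mult_1_plus_epsilon:
  fixes x y :: ennreal
  assumes "\<And>e::real. 0 < e \<Longrightarrow> x \<le> ennreal (1 + e) * y"
  shows "x \<le> y"
proof (cases "y = \<top>")
  case False
  then obtain r where r: "y = ennreal r" "0 \<le> r" by (cases y) auto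
  show ?thesis
  proof (rule ennreal_le_epsilon)
    fix e :: real assume "0 < e"
    then have "x \<le> ennreal (1 + e / (r + 1)) * y" using r by (intro assms) auto
    also have "\<dots> = ennreal ((1 + e / (r + 1)) * r)" using r \<open>0 < e\<close> by (simp add: ennreal_mult)
    also have "\<dots> \<le> ennreal (r + e)"
      using r \<open>0 < e\<close> by (intro ennreal_leI) (auto simp: field_simps)
    finally show "x \<le> y + ennreal e" using r \<open>0 < e\<close> by (simp add: ennreal_plus)
  qed
qed simp

text \<open>Lindelof reduces the local comparisons to countably many balls, which are made disjoint
  and summed; then e tends to 0. The statement is about set functions additive inside V because one
  of them will be the Hausdorff measure of the image of E under a chart.\<close>

lemma countably_additive_le_local:
  fixes \<mu> \<nu> :: "'a::{second_countable_topology,metric_space} set \<Rightarrow> ennreal"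
  assumes empty: "\<mu> {} = 0"
    and mu: "\<And>A. range A \<subseteq> sets borel \<Longrightarrow> disjoint_family A \<Longrightarrow> (\<Union>i. A i) \<subseteq> V \<Longrightarrow> \<mu> (\<Union>i::nat. A i) = (\<Sum>i. \<mu> (A i))"
    and nu: "\<And>A. range A \<subseteq> sets borel \<Longrightarrow> disjoint_family A \<Longrightarrow> (\<Union>i. A i) \<subseteq> V \<Longrightarrow> \<nu> (\<Union>i::nat. A i) = (\<Sum>i. \<nu> (A i))"
    and loc: "\<And>a e::real. a \<in> V \<Longrightarrow> 0 < e \<Longrightarrow> \<exists>r>0. \<forall>E\<in>sets borel. E \<subseteq> ball a r \<inter> V \<longrightarrow> \<mu> E \<le> ennreal (1 + e) * \<nu> E"
    and E: "E \<in> sets borel" "E \<subseteq> V"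
  shows "\<mu> E \<le> \<nu> E"
proof (cases "V = {}")
  case True
  then show ?thesis using E empty by simp
next
  case False
  show ?thesis
  proof (rule ennreal_le_mult_1_plus_epsilon)
    fix e :: real assume "0 < e"
    then have "\<forall>a\<in>V. \<exists>r>0. \<forall>E\<in>sets borel. E \<subseteq> ball a r \<inter> V \<longrightarrow> \<mu> E \<le> ennreal (1 + e) * \<nu> E"
      using loc by auto
    from bchoice[OF this] obtain r where r: "\<And>a. a \<in> V \<Longrightarrow> r a > 0"
      "\<And>a E. a \<in> V \<Longrightarrow> E \<in> sets borel \<Longrightarrow> E \<subseteq> ball a (r a) \<inter> V \<Longrightarrow> \<mu> E \<le> ennreal (1 + e) * \<nu> E"
      by blast
    obtain \<F> where \<F>: "\<F> \<subseteq> (\<lambda>a. ball a (r a)) ` V" "countable \<F>" "\<Union>\<F> = \<Union>((\<lambda>a. ball a (r a)) ` V)"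
      by (rule Lindelof[of "(\<lambda>a. ball a (r a)) ` V"]) auto
    have VF: "V \<subseteq> \<Union>\<F>" using r(1) \<F>(3) by force
    then have ne: "\<F> \<noteq> {}" using False by auto
    define B where "B = from_nat_into \<F>"
    have BF: "B n \<in> \<F>" for n unfolding B_def using ne by (rule from_nat_into)
    have rB: "range B = \<F>" unfolding B_def using ne \<F>(2) by (rule range_from_nat_into)
    have Bb: "B n \<in> sets borel" for n using BF[of n] \<F>(1) by auto
    define A where "A = (\<lambda>n. E \<inter> disjointed B n)"
    have Ab: "A n \<in> sets borel" for n
      using sets.range_disjointed_sets[of B borel] Bb E(1) by (auto simp: A_def)
    then have Ar: "range A \<subseteq> sets borel" by blast
    have Adisj: "disjoint_family A"
      using disjoint_family_disjointed[of B] by (auto simp: A_def disjoint_family_on_def)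
    have UA: "(\<Union>n. A n) = E"
      using UN_disjointed_eq[of B] rB VF E(2) by (auto simp: A_def)
    have le: "\<mu> (A n) \<le> ennreal (1 + e) * \<nu> (A n)" for n
    proof -
      obtain a where a: "a \<in> V" "B n = ball a (r a)" using BF[of n] \<F>(1) by auto
      have "A n \<subseteq> ball a (r a) \<inter> V"
        using E(2) disjointed_subset[of B n] a(2) by (auto simp: A_def)
      then show ?thesis using r(2) a(1) Ab by blast
    qed
    have "\<mu> E = (\<Sum>n. \<mu> (A n))"
      using mu[OF Ar Adisj] UA E(2) by simp
    also have "\<dots> \<le> (\<Sum>n. ennreal (1 + e) * \<nu> (A n))" by (intro suminf_le le) auto
    also have "\<dots> = ennreal (1 + e) * \<nu> E"
      using nu[OF Ar Adisj] UA E(2) by simp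
    finally show "\<mu> E \<le> ennreal (1 + e) * \<nu> E" .
  qed
qed

text \<open>Images under f are preimages under its continuous inverse.\<close>

lemma homeomorphism_image_borel:
  fixes f :: "'a::topological_space \<Rightarrow> 'b::topological_space"
  assumes "homeomorphism S T f g" "T \<in> sets borel" "E \<in> sets borel" "E \<subseteq> S"
  shows "f ` E \<in> sets borel"
proof -
  have "continuous_on T g" using assms(1) by (simp add: homeomorphism_def)
  then have "g \<in> borel_measurable (restrict_space borel T)"
    by (rule borel_measurable_continuous_on_restrict)
  then have "g -` E \<inter> space (restrict_space borel T) \<in> sets (restrict_space borel T)"
    using assms(3) by (rule measurable_sets)
  then have "g -` E \<inter> T \<in> sets borel"
    using assms(2) by (simp add: space_restrict_space sets_restrict_space_iff)
  moreover have "f ` E = g -` E \<inter> T"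
    using assms(1,4) unfolding homeomorphism_def by force
  ultimately show ?thesis by simp
qed

text \<open>The formula for measures of images says that \<nu> restricted to T is the pushforward
  along f of Lebesgue measure with density w; every Borel function can then be integrated.\<close>

lemma nn_integral_image_density:
  fixes f :: "'a::euclidean_space \<Rightarrow> 'b::euclidean_space" and \<nu> :: "'b measure"
  assumes hom: "homeomorphism S T f g" and S [measurable]: "S \<in> sets borel" and T [measurable]: "T \<in> sets borel"
    and nu [measurable_cong]: "sets \<nu> = sets borel"
    and w: "(\<lambda>x. w x * indicator S x) \<in> borel_measurable borel"
    and eq: "\<And>E. E \<in> sets borel \<Longrightarrow> E \<subseteq> S \<Longrightarrow> emeasure \<nu> (f ` E) = (\<integral>\<^sup>+x. w x * indicator E x \<partial>lborel)"
    and F [measurable]: "F \<in> borel_measurable borel"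
  shows "(\<integral>\<^sup>+y. F y * indicator T y \<partial>\<nu>) = (\<integral>\<^sup>+x. w x * F (f x) * indicator S x \<partial>lborel)"
proof -
  \<comment> \<open>Extension by 0 makes f a Borel map on the whole space.\<close>
  define f' where "f' = (\<lambda>x. if x \<in> S then f x else 0)"
  have f'[measurable]: "f' \<in> borel_measurable borel"
    unfolding f'_def using hom S
    by (intro borel_measurable_continuous_on_if) (auto simp: homeomorphism_def)
  note w[measurable]
  have "density \<nu> (indicator T) = distr (density lborel (\<lambda>x. w x * indicator S x)) borel f'"
  proof (rule measure_eqI)
    fix B assume "B \<in> sets (density \<nu> (indicator T))"
    then have B[measurable]: "B \<in> sets borel" by (simp add: nu)
    have "f' -` B \<inter> space borel \<in> sets borel" using f' B by (rule measurable_sets)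
    then have fB[measurable]: "f' -` B \<in> sets borel" by simp
    have "f ` (S \<inter> f' -` B) = T \<inter> B"
      using hom unfolding homeomorphism_def f'_def by force
    then have "emeasure \<nu> (T \<inter> B) = (\<integral>\<^sup>+x. w x * indicator (S \<inter> f' -` B) x \<partial>lborel)"
      using eq[of "S \<inter> f' -` B"] by auto
    also have "\<dots> = emeasure (distr (density lborel (\<lambda>x. w x * indicator S x)) borel f') B"
      by (subst emeasure_distr) (auto simp: emeasure_density indicator_inter_arith mult.assoc)
    finally show "emeasure (density \<nu> (indicator T)) B = \<dots>"
      by (simp add: emeasure_density indicator_inter_arith[symmetric] nn_integral_indicator nu)
  qed (simp add: nu)
  then have "(\<integral>\<^sup>+y. F y \<partial>density \<nu> (indicator T)) = (\<integral>\<^sup>+y. F y \<partial>distr (density lborel (\<lambda>x. w x * indicator S x)) borel f')"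
    by simp
  also have "\<dots> = (\<integral>\<^sup>+x. w x * indicator S x * F (f' x) \<partial>lborel)"
    by (subst nn_integral_distr) (auto simp: nn_integral_density)
  also have "\<dots> = (\<integral>\<^sup>+x. w x * F (f x) * indicator S x \<partial>lborel)"
    by (intro nn_integral_cong) (auto simp: f'_def indicator_def)
  finally show ?thesis by (simp add: nn_integral_density nu mult.commute)
qed

text \<open>The change of variables for gauge integrals, transferred to nonnegative integrals.
  Boundedness supplies the finite measure that the real-valued formula requires.\<close>

lemma emeasure_lborel_injective_image:
  fixes f :: "real^'n::{finite,wellorder} \<Rightarrow> real^'n::_"
  assumes [measurable]: "E \<in> sets borel" "f ` E \<in> sets borel" and "bounded (f ` E)"
    and d: "\<And>x. x \<in> E \<Longrightarrow> (f has_derivative f' x) (at x)" and "inj_on f E"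
  shows "emeasure lborel (f ` E) = (\<integral>\<^sup>+x. ennreal \<bar>det (matrix (f' x))\<bar> * indicator E x \<partial>lborel)"
proof -
  have "f ` E \<in> lmeasurable"
    using assms(2,3) by (intro bounded_set_imp_lmeasurable) auto
  then have "((\<lambda>x. \<bar>det (matrix (f' x))\<bar>) has_integral measure lebesgue (f ` E)) E"
    using has_measure_differentiable_image[of E f f' "measure lebesgue (f ` E)"] assms(1,5) d
    by (auto intro: has_derivative_at_withinI)
  then have "(\<integral>\<^sup>+x. ennreal \<bar>det (matrix (f' x))\<bar> * indicator E x \<partial>lborel) = ennreal (measure lebesgue (f ` E))"
    by (intro nn_integral_has_integral_lebesgue') auto
  also have "\<dots> = emeasure lebesgue (f ` E)"
    using \<open>f ` E \<in> lmeasurable\<close> by (simp add: emeasure_eq_measure2)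
  finally show ?thesis by simp
qed

section \<open>Orthonormal frames and projection to a tangent plane\<close>

definition oframe :: "real^3 \<Rightarrow> real^3 \<Rightarrow> real^3 \<Rightarrow> bool" where
  "oframe e1 e2 n \<longleftrightarrow> norm e1 = 1 \<and> norm e2 = 1 \<and> e1 \<bullet> e2 = 0 \<and> cross3 e1 e2 = n"

definition tproj :: "real^3 \<Rightarrow> real^3 \<Rightarrow> real^3 \<Rightarrow> real^2" where
  "tproj e1 e2 v = vector [v \<bullet> e1, v \<bullet> e2]"

text \<open>For a unit vector e1 orthogonal to n put e2 = n \<times> e1; Lagrange's identity returns
  n as e1 \<times> e2.\<close>

lemma oframe_exists:
  assumes "norm n = 1"
  shows "\<exists>e1 e2. oframe e1 e2 n"
proof -
  obtain u :: "real^3" where u: "u \<noteq> 0" "orthogonal n u"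
    using orthogonal_to_vector_exists[of n] by auto
  define e1 where "e1 = u /\<^sub>R norm u"
  have e1: "norm e1 = 1" "e1 \<bullet> n = 0"
    using u by (auto simp: e1_def orthogonal_def inner_commute)
  have "cross3 e1 (cross3 n e1) = n"
    using e1 by (simp add: Lagrange norm_eq_1)
  moreover have "(norm (cross3 n e1))\<^sup>2 = 1"
    using norm_cross_dot[of n e1] e1 assms by (simp add: inner_commute)
  then have "norm (cross3 n e1) = 1"
    using power2_eq_imp_eq[of "norm (cross3 n e1)" 1] by simp
  ultimately show ?thesis
    using e1 dot_cross_self(2)[of e1 n] unfolding oframe_def by blast
qed

text \<open>Pythagoras, read off from |v \<times> n|^2 + (v . n)^2 = |v|^2 and v \<times> n = (v .
  e2) e1 - (v . e1) e2.\<close>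

lemma norm_tproj:
  assumes "oframe e1 e2 n"
  shows "(norm v)\<^sup>2 = (norm (tproj e1 e2 v))\<^sup>2 + (v \<bullet> n)\<^sup>2"
proof -
  have e: "e1 \<bullet> e1 = 1" "e2 \<bullet> e2 = 1" "e1 \<bullet> e2 = 0" "cross3 e1 e2 = n"
    using assms by (auto simp: oframe_def norm_eq_1)
  have "(norm n)\<^sup>2 = 1"
    using norm_cross_dot[of e1 e2] assms by (auto simp: oframe_def)
  then have nn: "n \<bullet> n = 1" by (simp add: power2_norm_eq_inner)
  have "cross3 v n = (v \<bullet> e2) *\<^sub>R e1 - (v \<bullet> e1) *\<^sub>R e2"
    unfolding e(4)[symmetric] by (rule Lagrange)
  then have "(norm (cross3 v n))\<^sup>2 = (v \<bullet> e2)\<^sup>2 + (v \<bullet> e1)\<^sup>2"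
    using e unfolding power2_norm_eq_inner
    by (simp add: inner_diff_left inner_diff_right power2_eq_square inner_commute)
  then have "(v \<bullet> e2)\<^sup>2 + (v \<bullet> e1)\<^sup>2 + (v \<bullet> n)\<^sup>2 = (norm v)\<^sup>2"
    using norm_cross_dot[of v n] nn by (simp add: norm_eq_1[symmetric])
  moreover have "(norm (tproj e1 e2 v))\<^sup>2 = (v \<bullet> e1)\<^sup>2 + (v \<bullet> e2)\<^sup>2"
    by (simp add: norm_vec_def L2_set_def sum_2 tproj_def)
  ultimately show ?thesis by simp
qed

lemma linear_tproj: "linear (tproj e1 e2)"
  by (rule linearI) (simp_all add: tproj_def vec_eq_iff forall_2 inner_add_left)

lemma tproj_diff: "tproj e1 e2 (u - v) = tproj e1 e2 u - tproj e1 e2 v"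
  by (rule linear_diff[OF linear_tproj])

lemma bounded_linear_tproj: "bounded_linear (tproj e1 e2)"
  using linear_tproj linear_conv_bounded_linear by blast

lemma norm_tproj_le: "oframe e1 e2 n \<Longrightarrow> norm (tproj e1 e2 v) \<le> norm v"
  using norm_tproj[of e1 e2 n v] by (metis le_add_same_cancel1 norm_ge_zero power2_le_imp_le zero_le_power2)

text \<open>Strict differentiability of a C^1 map, by the mean value inequality for f minus its
  linear part at a. Continuity of the derivative is given direction by direction, and in the plane
  two directions control all others.\<close>

lemma C1_linearization:
  fixes f :: "real^2 \<Rightarrow> 'b::real_normed_vector"
  assumes "open V" and der: "\<And>x. x \<in> V \<Longrightarrow> (f has_derivative f' x) (at x)"
    and cont: "\<And>v. continuous_on V (\<lambda>x. f' x v)" and "a \<in> V" "0 < \<eta>"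
  shows "\<exists>r>0. ball a r \<subseteq> V \<and> (\<forall>x\<in>ball a r. \<forall>y\<in>ball a r. norm (f x - f y - f' a (x - y)) \<le> \<eta> * norm (x - y))"
proof -
  have lin: "linear (f' x)" if "x \<in> V" for x
    using der[OF that] has_derivative_linear by blast
  have "\<exists>r>0. \<forall>x\<in>V. dist x a < r \<longrightarrow> dist (f' x v) (f' a v) < \<eta>/2" for v
    using cont[of v] \<open>a \<in> V\<close> \<open>0 < \<eta>\<close> unfolding continuous_on_iff by (meson half_gt_zero)
  then obtain \<rho> where \<rho>: "\<And>v. \<rho> v > 0" "\<And>v x. x \<in> V \<Longrightarrow> dist x a < \<rho> v \<Longrightarrow> dist (f' x v) (f' a v) < \<eta>/2"
    by metis
  obtain r0 where r0: "r0 > 0" "ball a r0 \<subseteq> V" using \<open>open V\<close> \<open>a \<in> V\<close> openE by blast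
  define r where "r = min r0 (min (\<rho> (axis 1 1)) (\<rho> (axis 2 1)))"
  have r: "r > 0" "ball a r \<subseteq> V" using r0 \<rho>(1) by (auto simp: r_def subset_iff)
  have close: "norm (f' x v - f' a v) \<le> \<eta> * norm v" if x: "x \<in> ball a r" for x v
  proof -
    have xV: "x \<in> V" using r(2) x by blast
    have v: "v = v$1 *\<^sub>R axis 1 1 + v$2 *\<^sub>R axis 2 1"
      by (simp add: vec_eq_iff forall_2 axis_def)
    have exp: "f' z v = v$1 *\<^sub>R f' z (axis 1 1) + v$2 *\<^sub>R f' z (axis 2 1)" if "z \<in> V" for z
      by (subst v) (simp add: linear_add[OF lin[OF that]] linear_scale[OF lin[OF that]])
    have "f' x v - f' a v = v$1 *\<^sub>R (f' x (axis 1 1) - f' a (axis 1 1)) + v$2 *\<^sub>R (f' x (axis 2 1) - f' a (axis 2 1))"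
      using exp[OF xV] exp[OF \<open>a \<in> V\<close>] by (simp add: algebra_simps)
    also have "norm \<dots> \<le> \<bar>v$1\<bar> * norm (f' x (axis 1 1) - f' a (axis 1 1)) + \<bar>v$2\<bar> * norm (f' x (axis 2 1) - f' a (axis 2 1))"
      by (rule norm_triangle_le) simp
    also have "\<dots> \<le> norm v * (\<eta>/2) + norm v * (\<eta>/2)"
    proof (intro add_mono mult_mono)
      show "\<bar>v$1\<bar> \<le> norm v" "\<bar>v$2\<bar> \<le> norm v" by (rule component_le_norm_cart)+
      show "norm (f' x (axis 1 1) - f' a (axis 1 1)) \<le> \<eta>/2" "norm (f' x (axis 2 1) - f' a (axis 2 1)) \<le> \<eta>/2"
        using \<rho>(2)[OF xV, of "axis 1 1"] \<rho>(2)[OF xV, of "axis 2 1"] x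
        by (auto simp: r_def dist_norm norm_minus_commute)
    qed auto
    finally show ?thesis by (simp add: mult.commute)
  qed
  have "norm (f x - f y - f' a (x - y)) \<le> \<eta> * norm (x - y)" if "x \<in> ball a r" "y \<in> ball a r" for x y
  proof -
    have la: "linear (f' a)" using lin \<open>a \<in> V\<close> by blast
    have "norm ((f x - f' a x) - (f y - f' a y)) \<le> \<eta> * norm (x - y)"
    proof (rule differentiable_bound[OF convex_ball _ _ that])
      fix z assume z: "z \<in> ball a r"
      have "bounded_linear (f' a)" using der[OF \<open>a \<in> V\<close>] has_derivative_bounded_linear by blast
      then have "((\<lambda>x. f' a x) has_derivative f' a) (at z within ball a r)"
        by (rule bounded_linear_imp_has_derivative)
      moreover have "(f has_derivative f' z) (at z within ball a r)"
        by (rule has_derivative_at_withinI[OF der]) (use z r(2) in blast)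
      ultimately show "((\<lambda>x. f x - f' a x) has_derivative (\<lambda>v. f' z v - f' a v)) (at z within ball a r)"
        by (rule has_derivative_diff[rotated])
      show "onorm (\<lambda>v. f' z v - f' a v) \<le> \<eta>"
        by (rule onorm_bound) (use close[OF z] \<open>0 < \<eta>\<close> in auto)
    qed
    then show ?thesis by (simp add: linear_diff[OF la] algebra_simps)
  qed
  with r show ?thesis by blast
qed

section \<open>The area formula for immersed patches\<close>

locale immersion =
  fixes V :: "(real^2) set" and \<phi> :: "real^2 \<Rightarrow> real^3" and D :: "real^2 \<Rightarrow> real^2 \<Rightarrow> real^3"
    and \<xi> :: "real^3 \<Rightarrow> real^2"
  assumes open_V: "open V"
    and deriv: "\<And>x. x \<in> V \<Longrightarrow> (\<phi> has_derivative D x) (at x)"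
    and cont_D: "\<And>v. continuous_on V (\<lambda>x. D x v)"
    and inj_D: "\<And>x. x \<in> V \<Longrightarrow> inj (D x)"
    and homeo: "homeomorphism V (\<phi> ` V) \<phi> \<xi>"
    and borel_image: "\<phi> ` V \<in> sets borel"
begin

definition cr :: "real^2 \<Rightarrow> real^3" where
  "cr x = cross3 (D x (axis 1 1)) (D x (axis 2 1))"

text \<open>By Lagrange's identity this is the square root of the Gram determinant, the area element
  of the patch.\<close>

definition jac :: "real^2 \<Rightarrow> real" where "jac x = norm (cr x)"

definition nrm :: "real^2 \<Rightarrow> real^3" where "nrm x = cr x /\<^sub>R norm (cr x)"

lemma V_borel [measurable]: "V \<in> sets borel"
  using open_V by simp

lemma linear_D: "x \<in> V \<Longrightarrow> linear (D x)"
  using deriv has_derivative_linear by blast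

lemma continuous_on_phi: "continuous_on V \<phi>"
  using homeo by (simp add: homeomorphism_def)

lemma inj_on_phi: "inj_on \<phi> V"
  using homeo by (metis homeomorphism_def inj_on_inverseI)

lemma D_expand: "x \<in> V \<Longrightarrow> D x v = v$1 *\<^sub>R D x (axis 1 1) + v$2 *\<^sub>R D x (axis 2 1)"
proof -
  assume x: "x \<in> V"
  have v: "v = v$1 *\<^sub>R axis 1 1 + v$2 *\<^sub>R axis 2 1"
    by (simp add: vec_eq_iff forall_2 axis_def)
  show ?thesis
    by (subst v) (simp add: linear_add[OF linear_D[OF x]] linear_scale[OF linear_D[OF x]])
qed

text \<open>Parallel partial derivatives would give the derivative a nontrivial kernel.\<close>

lemma cr_nonzero: "x \<in> V \<Longrightarrow> cr x \<noteq> 0"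
proof
  assume x: "x \<in> V" and "cr x = 0"
  let ?p = "D x (axis 1 1)" and ?q = "D x (axis 2 1)"
  have p: "?p \<noteq> 0"
  proof
    assume "?p = 0"
    then have "axis 1 1 = (0::real^2)" using inj_D[OF x] linear_0[OF linear_D[OF x]] by (metis injD)
    then show False by (simp add: axis_eq_0_iff)
  qed
  have "collinear {0, ?p, ?q}" using \<open>cr x = 0\<close> by (simp add: cr_def cross_eq_0)
  then obtain c where c: "?q = c *\<^sub>R ?p" using p by (auto simp: collinear_lemma)
  then have "D x (c *\<^sub>R axis 1 1) = D x (axis 2 1)"
    by (simp add: linear_scale[OF linear_D[OF x]])
  then have "c *\<^sub>R axis 1 1 = (axis 2 1 :: real^2)" using inj_D[OF x] by (simp add: inj_eq)
  then show False by (simp add: vec_eq_iff forall_2 axis_def)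
qed

lemma jac_pos: "x \<in> V \<Longrightarrow> 0 < jac x"
  by (simp add: jac_def cr_nonzero)

lemma norm_nrm: "x \<in> V \<Longrightarrow> norm (nrm x) = 1"
  by (simp add: nrm_def cr_nonzero)

lemma continuous_on_cr: "continuous_on V cr"
  unfolding cr_def by (intro continuous_on_cross cont_D)

lemma continuous_on_jac: "continuous_on V jac"
  unfolding jac_def by (intro continuous_intros continuous_on_cr)

lemma continuous_on_nrm: "continuous_on V nrm"
  unfolding nrm_def using cr_nonzero by (intro continuous_intros continuous_on_cr) auto

lemma cr_eq: "x \<in> V \<Longrightarrow> cr x = jac x *\<^sub>R nrm x"
  by (simp add: jac_def nrm_def cr_nonzero)

lemma nrm_D: "x \<in> V \<Longrightarrow> nrm x \<bullet> D x v = 0"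
  using D_expand[of x v] by (simp add: nrm_def cr_def inner_add_right dot_cross_self)

lemma jac_borel [measurable]: "(\<lambda>x. ennreal (jac x) * indicator V x) \<in> borel_measurable borel"
proof -
  have "(\<lambda>x. if x \<in> V then jac x else 0) \<in> borel_measurable borel"
    by (intro borel_measurable_continuous_on_if continuous_on_jac) auto
  then have "(\<lambda>x. ennreal (if x \<in> V then jac x else 0)) \<in> borel_measurable borel" by simp
  moreover have "(\<lambda>x. ennreal (if x \<in> V then jac x else 0)) = (\<lambda>x. ennreal (jac x) * indicator V x)"
    by (auto simp: indicator_def)
  ultimately show ?thesis by simp
qed

text \<open>The patch seen through orthogonal projection to its tangent plane at \<phi> a. The frame
  is an argument, so it can be chosen afresh for each a.\<close>

definition tcoord :: "real^3 \<Rightarrow> real^3 \<Rightarrow> real^2 \<Rightarrow> real^2 \<Rightarrow> real^2" where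
  "tcoord e1 e2 a x = tproj e1 e2 (\<phi> x - \<phi> a)"

lemma tcoord_deriv: "x \<in> V \<Longrightarrow> (tcoord e1 e2 a has_derivative (\<lambda>v. tproj e1 e2 (D x v))) (at x)"
  unfolding tcoord_def
  by (rule bounded_linear.has_derivative[OF bounded_linear_tproj])
     (auto intro!: derivative_eq_intros deriv)

text \<open>By the Binet-Cauchy identity the determinant is the inner product of two cross products:
  projection scales area by the cosine of the angle between the normals. The orientation built into
  \<open>oframe\<close> fixes the sign.\<close>

lemma det_tcoord:
  assumes "x \<in> V" "oframe e1 e2 n"
  shows "det (matrix (\<lambda>v. tproj e1 e2 (D x v))) = jac x * (nrm x \<bullet> n)"
proof -
  have "det (matrix (\<lambda>v. tproj e1 e2 (D x v))) = cr x \<bullet> cross3 e1 e2"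
    by (simp add: det_2 matrix_def tproj_def cr_def dot_cross)
  then show ?thesis using assms by (simp add: cr_eq oframe_def)
qed

lemma D_bounded_below: "a \<in> V \<Longrightarrow> \<exists>l>0. \<forall>v. l * norm v \<le> norm (D a v)"
  using linear_inj_bounded_below_pos[OF linear_D inj_D] by (metis mult.commute)

text \<open>A short chord differs little from D a (x - y), which is tangent at a. Its normal
  component is thus at most e times its length, and the projection keeps at least the fraction 1 - e
  of it, as (1 - e)^2 \<le> 1 - e^2.\<close>

lemma tcoord_near_isometry:
  assumes a: "a \<in> V" and fr: "oframe e1 e2 (nrm a)" and e: "0 < e" "e < 1"
  shows "\<exists>r>0. ball a r \<subseteq> V \<and> (\<forall>x\<in>ball a r. 1 - e \<le> nrm x \<bullet> nrm a) \<and>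
    (\<forall>x\<in>ball a r. \<forall>y\<in>ball a r. (1 - e) * dist (\<phi> x) (\<phi> y) \<le> dist (tcoord e1 e2 a x) (tcoord e1 e2 a y))"
proof -
  obtain l where l: "l > 0" "\<And>v. l * norm v \<le> norm (D a v)" using D_bounded_below[OF a] by blast
  \<comment> \<open>The bound \<eta> \<le> l/2 leaves chords of length at least (l/2) |x - y|; the
    factor e makes their normal part at most e times that length.\<close>
  define \<eta> where "\<eta> = l * e / 2"
  have \<eta>: "0 < \<eta>" "\<eta> \<le> l / 2" using l e by (auto simp: \<eta>_def)
  obtain r1 where r1: "r1 > 0" "ball a r1 \<subseteq> V"
     "\<And>x y. x \<in> ball a r1 \<Longrightarrow> y \<in> ball a r1 \<Longrightarrow> norm (\<phi> x - \<phi> y - D a (x - y)) \<le> \<eta> * norm (x - y)"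
    using C1_linearization[OF open_V deriv cont_D a \<eta>(1)] by blast
  have "continuous_on V (\<lambda>x. nrm x \<bullet> nrm a)" by (intro continuous_intros continuous_on_nrm)
  moreover have "nrm a \<bullet> nrm a = 1" using norm_nrm[OF a] by (simp add: norm_eq_1)
  ultimately obtain r2 where r2: "r2 > 0" "\<And>x. x \<in> V \<Longrightarrow> dist x a < r2 \<Longrightarrow> dist (nrm x \<bullet> nrm a) 1 < e"
    using a e(1) unfolding continuous_on_iff by metis
  define r where "r = min r1 r2"
  have iso: "(1 - e) * dist (\<phi> x) (\<phi> y) \<le> dist (tcoord e1 e2 a x) (tcoord e1 e2 a y)"
    if "x \<in> ball a r" "y \<in> ball a r" for x y
  proof -
    let ?w = "\<phi> x - \<phi> y" and ?h = "x - y"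
    have lin: "norm (?w - D a ?h) \<le> \<eta> * norm ?h" using that by (intro r1(3)) (auto simp: r_def)
    have "norm (D a ?h) - norm ?w \<le> norm (?w - D a ?h)" by (metis norm_minus_commute norm_triangle_ineq2)
    then have "l * norm ?h - \<eta> * norm ?h \<le> norm ?w" using lin l(2)[of ?h] by linarith
    moreover have "(l - \<eta>) * norm ?h \<ge> (l / 2) * norm ?h" using \<eta> by (intro mult_right_mono) auto
    ultimately have low: "l / 2 * norm ?h \<le> norm ?w" by (simp add: algebra_simps)
    have "\<bar>?w \<bullet> nrm a\<bar> = \<bar>(?w - D a ?h) \<bullet> nrm a\<bar>"
      using nrm_D[OF a, of ?h] by (simp add: inner_diff_left inner_commute[of "D a ?h"])
    also have "\<dots> \<le> norm (?w - D a ?h) * norm (nrm a)" by (rule Cauchy_Schwarz_ineq2)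
    also have "\<dots> \<le> \<eta> * norm ?h" using lin norm_nrm[OF a] by simp
    also have "\<dots> = e * (l / 2 * norm ?h)" by (simp add: \<eta>_def)
    also have "\<dots> \<le> e * norm ?w" using low e by (intro mult_left_mono) auto
    finally have "(?w \<bullet> nrm a)\<^sup>2 \<le> (e * norm ?w)\<^sup>2"
      using power_mono[of "\<bar>?w \<bullet> nrm a\<bar>" "e * norm ?w" 2] by simp
    then have "(norm ?w)\<^sup>2 - (e * norm ?w)\<^sup>2 \<le> (norm (tproj e1 e2 ?w))\<^sup>2"
      using norm_tproj[OF fr, of ?w] by simp
    moreover have "((1 - e) * norm ?w)\<^sup>2 \<le> (norm ?w)\<^sup>2 - (e * norm ?w)\<^sup>2"
    proof -
      have "(1 - e)\<^sup>2 \<le> 1 - e\<^sup>2" using e by (simp add: power2_eq_square algebra_simps)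
      then have "(1 - e)\<^sup>2 * (norm ?w)\<^sup>2 \<le> (1 - e\<^sup>2) * (norm ?w)\<^sup>2" by (intro mult_right_mono) auto
      then show ?thesis by (simp only: power_mult_distrib) (simp add: algebra_simps)
    qed
    ultimately have "((1 - e) * norm ?w)\<^sup>2 \<le> (norm (tproj e1 e2 ?w))\<^sup>2" by linarith
    then have "(1 - e) * norm ?w \<le> norm (tproj e1 e2 ?w)" by (rule power2_le_imp_le) simp
    then show ?thesis by (simp add: dist_norm tcoord_def tproj_diff[symmetric])
  qed
  have "1 - e \<le> nrm x \<bullet> nrm a" if "x \<in> ball a r" for x
    using r2(2)[of x] that r1(2) by (auto simp: r_def dist_real_def dist_commute subset_iff)
  then show ?thesis using iso r1 r2 by (intro exI[of _ r]) (auto simp: r_def)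
qed

lemma phi_image_borel: "E \<in> sets borel \<Longrightarrow> E \<subseteq> V \<Longrightarrow> \<phi> ` E \<in> sets borel"
  using homeomorphism_image_borel[OF homeo borel_image] .

text \<open>Projection to the tangent plane is 1-Lipschitz with a 1/(1 - e)-Lipschitz inverse, so
  Hausdorff measure changes by at most the square of that factor. The projected set is planar, and
  its Lebesgue measure is the integral of \<open>jac\<close> times a cosine between 1 - e and
  1.\<close>

lemma hausdorff2_image_compare:
  assumes a: "a \<in> V" and e: "0 < e" "e < 1"
  shows "\<exists>r>0. \<forall>E\<in>sets borel. E \<subseteq> ball a r \<inter> V \<longrightarrow>
     ennreal (hausdorff2_const * (1 - e)) * (\<integral>\<^sup>+x. ennreal (jac x) * indicator E x \<partial>lborel) \<le> hausdorff2_outer (\<phi> ` E) \<and>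
     hausdorff2_outer (\<phi> ` E) \<le> ennreal (hausdorff2_const / (1 - e)\<^sup>2) * (\<integral>\<^sup>+x. ennreal (jac x) * indicator E x \<partial>lborel)"
proof -
  let ?c = "hausdorff2_const"
  obtain e1 e2 where fr: "oframe e1 e2 (nrm a)" using oframe_exists norm_nrm[OF a] by blast
  let ?\<psi> = "tcoord e1 e2 a"
  obtain r where r: "r > 0" "ball a r \<subseteq> V" "\<And>x. x \<in> ball a r \<Longrightarrow> 1 - e \<le> nrm x \<bullet> nrm a"
    "\<And>x y. x \<in> ball a r \<Longrightarrow> y \<in> ball a r \<Longrightarrow> (1 - e) * dist (\<phi> x) (\<phi> y) \<le> dist (?\<psi> x) (?\<psi> y)"
    using tcoord_near_isometry[OF a fr e] by blast
  \<comment> \<open>On the smaller ball the projected image is bounded, being contained in the image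
    of a compact ball.\<close>
  obtain r' where r': "0 < r'" "r' < r" using r(1) dense by blast
  have sub: "ball a r' \<subseteq> ball a r" using r' by (auto simp: subset_ball)
  have cont: "continuous_on V ?\<psi>"
    by (rule continuous_at_imp_continuous_on) (auto intro: has_derivative_continuous[OF tcoord_deriv])
  have inj: "inj_on ?\<psi> (ball a r)"
  proof (rule inj_onI)
    fix x y assume xy: "x \<in> ball a r" "y \<in> ball a r" "?\<psi> x = ?\<psi> y"
    then have "(1 - e) * dist (\<phi> x) (\<phi> y) \<le> 0" using r(4)[of x y] by simp
    then have "\<phi> x = \<phi> y" using e by (simp add: mult_le_0_iff)
    then show "x = y" using inj_on_phi xy r(2) by (meson inj_onD subsetD)
  qed
  have hom: "homeomorphism (ball a r) (?\<psi> ` ball a r) ?\<psi> (inv_into (ball a r) ?\<psi>)"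
  proof -
    have "continuous_on (?\<psi> ` ball a r) (inv_into (ball a r) ?\<psi>)"
      by (rule continuous_on_inverse_open[OF open_ball])
         (use inj continuous_on_subset[OF cont r(2)] in auto)
    then show ?thesis
      using inj continuous_on_subset[OF cont r(2)] by (simp add: homeomorphism_def)
  qed
  have op: "open (?\<psi> ` ball a r)"
    by (rule invariance_of_domain[OF continuous_on_subset[OF cont r(2)] open_ball inj])
  have bdd: "bounded (?\<psi> ` ball a r')"
  proof (rule bounded_subset)
    have "compact (?\<psi> ` cball a r')"
      using r' r(2) by (intro compact_continuous_image continuous_on_subset[OF cont]) (auto simp: subset_iff)
    then show "bounded (?\<psi> ` cball a r')" by (rule compact_imp_bounded)
  qed auto
  have key: "ennreal (?c * (1 - e)) * (\<integral>\<^sup>+x. ennreal (jac x) * indicator E x \<partial>lborel) \<le> hausdorff2_outer (\<phi> ` E) \<and>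
     hausdorff2_outer (\<phi> ` E) \<le> ennreal (?c / (1 - e)\<^sup>2) * (\<integral>\<^sup>+x. ennreal (jac x) * indicator E x \<partial>lborel)"
    if E[measurable]: "E \<in> sets borel" and ER: "E \<subseteq> ball a r' \<inter> V" for E
  proof -
    have Er: "E \<subseteq> ball a r" using ER sub by blast
    have EV: "E \<subseteq> V" using ER by blast
    let ?I = "\<integral>\<^sup>+x. ennreal (jac x) * indicator E x \<partial>lborel"
    have psiE: "?\<psi> ` E \<in> sets borel"
      using op by (intro homeomorphism_image_borel[OF hom _ E Er]) auto
    have [measurable]: "(\<lambda>x. ennreal (jac x) * indicator E x) \<in> borel_measurable borel"
    proof -
      have "(\<lambda>x. ennreal (jac x) * indicator V x * indicator E x) \<in> borel_measurable borel" by measurable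
      moreover have "(\<lambda>x. ennreal (jac x) * indicator V x * indicator E x) = (\<lambda>x. ennreal (jac x) * indicator E x)"
        using EV by (auto simp: fun_eq_iff indicator_def)
      ultimately show ?thesis by simp
    qed
    have dets: "(1 - e) * jac x \<le> \<bar>det (matrix (\<lambda>v. tproj e1 e2 (D x v)))\<bar> \<and>
       \<bar>det (matrix (\<lambda>v. tproj e1 e2 (D x v)))\<bar> \<le> jac x" if "x \<in> E" for x
    proof -
      have x: "x \<in> V" "x \<in> ball a r" using that EV Er by auto
      have "nrm x \<bullet> nrm a \<le> 1" using norm_cauchy_schwarz[of "nrm x" "nrm a"] norm_nrm x a by simp
      moreover have "1 - e \<le> nrm x \<bullet> nrm a" using r(3) x by blast
      ultimately show ?thesis
        using jac_pos[OF x(1)] e unfolding det_tcoord[OF x(1) fr]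
        by (auto simp: abs_mult mult.commute mult_left_le intro!: mult_left_mono)
    qed
    have vol: "emeasure lborel (?\<psi> ` E) = (\<integral>\<^sup>+x. ennreal \<bar>det (matrix (\<lambda>v. tproj e1 e2 (D x v)))\<bar> * indicator E x \<partial>lborel)"
    proof (rule emeasure_lborel_injective_image)
      show "bounded (?\<psi> ` E)" using ER by (intro bounded_subset[OF bdd]) auto
      show "inj_on ?\<psi> E" using inj Er by (rule inj_on_subset)
    qed (use E psiE EV tcoord_deriv in auto)
    have volu: "emeasure lborel (?\<psi> ` E) \<le> ?I"
      unfolding vol using dets by (intro nn_integral_mono) (auto simp: indicator_def intro!: ennreal_leI)
    have "ennreal (1 - e) * ?I = (\<integral>\<^sup>+x. ennreal ((1 - e) * jac x) * indicator E x \<partial>lborel)"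
      using e by (subst nn_integral_cmult[symmetric]) (auto simp: ennreal_mult' mult.assoc)
    also have "\<dots> \<le> emeasure lborel (?\<psi> ` E)"
      unfolding vol using dets by (intro nn_integral_mono) (auto simp: indicator_def intro!: ennreal_leI)
    finally have voll: "ennreal (1 - e) * ?I \<le> emeasure lborel (?\<psi> ` E)" .
    let ?g = "\<lambda>y. plane_embed (tproj e1 e2 (y - \<phi> a))"
    have gim: "?g ` \<phi> ` E = plane_embed ` ?\<psi> ` E"
      by (simp add: image_image tcoord_def)
    have planeE: "hausdorff2_outer (plane_embed ` ?\<psi> ` E) = ennreal ?c * emeasure lborel (?\<psi> ` E)"
      using psiE by (rule hausdorff2_plane)
    have "hausdorff2_outer (?g ` \<phi> ` E) \<le> ennreal (1\<^sup>2) * hausdorff2_outer (\<phi> ` E)"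
    proof (rule hausdorff2_outer_lipschitz_image_le)
      fix x y
      show "dist (?g x) (?g y) \<le> 1 * dist x y"
        using norm_tproj_le[OF fr, of "x - y"] by (simp add: dist_norm plane_embed_diff tproj_diff[symmetric])
    qed simp
    then have low: "ennreal ?c * emeasure lborel (?\<psi> ` E) \<le> hausdorff2_outer (\<phi> ` E)"
      unfolding gim planeE by simp
    let ?h = "\<lambda>y. \<phi> (inv_into (ball a r) ?\<psi> (plane_proj y))"
    have him: "?h ` plane_embed ` ?\<psi> ` E = \<phi> ` E"
      using Er inj by (force simp: image_image inv_into_f_f)
    have "hausdorff2_outer (?h ` plane_embed ` ?\<psi> ` E) \<le> ennreal ((1 / (1 - e))\<^sup>2) * hausdorff2_outer (plane_embed ` ?\<psi> ` E)"
    proof (rule hausdorff2_outer_lipschitz_image_le)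
      fix x y assume "x \<in> plane_embed ` ?\<psi> ` E" "y \<in> plane_embed ` ?\<psi> ` E"
      then obtain x' y' where xy: "x' \<in> E" "x = plane_embed (?\<psi> x')" "y' \<in> E" "y = plane_embed (?\<psi> y')" by blast
      then have "(1 - e) * dist (\<phi> x') (\<phi> y') \<le> dist x y"
        using r(4)[OF subsetD[OF Er xy(1)] subsetD[OF Er xy(3)]] by simp
      moreover have "?h x = \<phi> x'" "?h y = \<phi> y'" using xy Er inj by (auto simp: inv_into_f_f subsetD)
      ultimately show "dist (?h x) (?h y) \<le> 1 / (1 - e) * dist x y"
        using e by (simp add: field_simps)
    qed (use e in simp)
    then have "hausdorff2_outer (\<phi> ` E) \<le> ennreal ((1 / (1 - e))\<^sup>2) * (ennreal ?c * emeasure lborel (?\<psi> ` E))"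
      unfolding him planeE .
    also have "\<dots> \<le> ennreal ((1 / (1 - e))\<^sup>2) * (ennreal ?c * ?I)"
      by (intro mult_left_mono volu) auto
    also have "\<dots> = ennreal (?c / (1 - e)\<^sup>2) * ?I"
      using hausdorff2_const_pos
      by (simp add: mult.assoc[symmetric] ennreal_mult[symmetric] power_divide)
    finally have up: "hausdorff2_outer (\<phi> ` E) \<le> ennreal (?c / (1 - e)\<^sup>2) * ?I" .
    have "ennreal (?c * (1 - e)) * ?I = ennreal ?c * (ennreal (1 - e) * ?I)"
      using hausdorff2_const_pos e by (simp add: ennreal_mult mult.assoc)
    also have "\<dots> \<le> ennreal ?c * emeasure lborel (?\<psi> ` E)" by (intro mult_left_mono voll) auto
    also note low
    finally show ?thesis using up by blast
  qed
  show ?thesis using r'(1) key by blast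
qed

text \<open>Both sides are countably additive on Borel subsets of V and agree near each point up to
  a factor close to 1, so each dominates the other.\<close>

theorem hausdorff2_area_formula:
  assumes E: "E \<in> sets borel" "E \<subseteq> V"
  shows "emeasure hausdorff2 (\<phi> ` E) = ennreal hausdorff2_const * (\<integral>\<^sup>+x. ennreal (jac x) * indicator E x \<partial>lborel)"
proof -
  let ?c = "hausdorff2_const"
  let ?\<rho> = "density lborel (\<lambda>x. ennreal (jac x) * indicator V x)"
  define \<mu> where "\<mu> = (\<lambda>E. hausdorff2_outer (\<phi> ` E))"
  define \<nu> where "\<nu> = (\<lambda>E. ennreal ?c * emeasure ?\<rho> E)"
  have nu: "\<nu> E = ennreal ?c * (\<integral>\<^sup>+x. ennreal (jac x) * indicator E x \<partial>lborel)"
    if [measurable]: "E \<in> sets borel" and "E \<subseteq> V" for E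
  proof -
    have "emeasure ?\<rho> E = (\<integral>\<^sup>+x. ennreal (jac x) * indicator V x * indicator E x \<partial>lborel)"
      by (simp add: emeasure_density)
    also have "\<dots> = (\<integral>\<^sup>+x. ennreal (jac x) * indicator E x \<partial>lborel)"
      using that by (intro nn_integral_cong) (auto simp: indicator_def)
    finally show ?thesis by (simp add: \<nu>_def)
  qed
  have mu_add: "\<mu> (\<Union>i::nat. A i) = (\<Sum>i. \<mu> (A i))"
    if A: "range A \<subseteq> sets borel" "disjoint_family A" "(\<Union>i. A i) \<subseteq> V" for A
  proof -
    have b: "\<phi> ` A i \<in> sets borel" for i using A by (intro phi_image_borel) auto
    have "disjoint_family (\<lambda>i. \<phi> ` A i)"
      unfolding disjoint_family_on_def
    proof (intro ballI impI)
      fix m n :: nat assume "m \<noteq> n"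
      then have "A m \<inter> A n = {}" using A(2) by (auto simp: disjoint_family_on_def)
      then show "\<phi> ` A m \<inter> \<phi> ` A n = {}"
        using A(3) inj_on_image_Int[OF inj_on_phi, of "A m" "A n"] by (auto simp: UN_subset_iff)
    qed
    then have "(\<Sum>i. emeasure hausdorff2 (\<phi> ` A i)) = emeasure hausdorff2 (\<Union>i. \<phi> ` A i)"
      using b by (intro suminf_emeasure) auto
    then show ?thesis using b by (simp add: \<mu>_def emeasure_hausdorff2 image_UN)
  qed
  have nu_add: "\<nu> (\<Union>i::nat. A i) = (\<Sum>i. \<nu> (A i))"
    if A: "range A \<subseteq> sets borel" "disjoint_family A" for A
    using suminf_emeasure[of A ?\<rho>] A by (simp add: \<nu>_def)
  have loc: "\<exists>r>0. \<forall>E\<in>sets borel. E \<subseteq> ball a r \<inter> V \<longrightarrow> \<mu> E \<le> ennreal (1 + e) * \<nu> E \<and> \<nu> E \<le> ennreal (1 + e) * \<mu> E"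
    if a: "a \<in> V" and "0 < e" for a and e :: real
  proof -
    \<comment> \<open>For x \<le> 1/4 the factor 1 + 8x outweighs both 1/(1 - x)^2 and 1/(1 - x),
      and 8x \<le> e.\<close>
    define x where "x = min (1/4) (e/8)"
    have x: "0 < x" "x < 1" "x \<le> 1/4" "8 * x \<le> e" using \<open>0 < e\<close> by (auto simp: x_def)
    have "0 \<le> x * (6 - 15 * x + 8 * x\<^sup>2)" using x by (intro mult_nonneg_nonneg) auto
    then have "1 \<le> (1 + 8 * x) * (1 - x)\<^sup>2" by (simp add: power2_eq_square algebra_simps)
    also have "\<dots> \<le> (1 + e) * (1 - x)\<^sup>2" using x by (intro mult_right_mono) auto
    finally have q1: "1 / (1 - x)\<^sup>2 \<le> 1 + e" using x by (simp add: divide_le_eq)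
    have "0 \<le> x * (7 - 8 * x)" using x by (intro mult_nonneg_nonneg) auto
    then have "1 \<le> (1 + 8 * x) * (1 - x)" by (simp add: algebra_simps)
    also have "\<dots> \<le> (1 + e) * (1 - x)" using x by (intro mult_right_mono) auto
    finally have q2: "1 \<le> (1 + e) * (1 - x)" .
    obtain r where r: "r > 0" and rE: "\<And>E. E \<in> sets borel \<Longrightarrow> E \<subseteq> ball a r \<inter> V \<Longrightarrow>
       ennreal (?c * (1 - x)) * (\<integral>\<^sup>+x. ennreal (jac x) * indicator E x \<partial>lborel) \<le> hausdorff2_outer (\<phi> ` E) \<and>
       hausdorff2_outer (\<phi> ` E) \<le> ennreal (?c / (1 - x)\<^sup>2) * (\<integral>\<^sup>+x. ennreal (jac x) * indicator E x \<partial>lborel)"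
      using hausdorff2_image_compare[OF a x(1,2)] by blast
    have "\<mu> E \<le> ennreal (1 + e) * \<nu> E \<and> \<nu> E \<le> ennreal (1 + e) * \<mu> E"
      if E: "E \<in> sets borel" "E \<subseteq> ball a r \<inter> V" for E
    proof
      let ?I = "\<integral>\<^sup>+x. ennreal (jac x) * indicator E x \<partial>lborel"
      have nE: "\<nu> E = ennreal ?c * ?I" using nu E by blast
      have "\<mu> E \<le> ennreal (?c / (1 - x)\<^sup>2) * ?I" using rE[OF E] by (simp add: \<mu>_def)
      also have "\<dots> \<le> ennreal ((1 + e) * ?c) * ?I"
        using mult_right_mono[OF q1, of ?c] hausdorff2_const_pos by (intro mult_right_mono ennreal_leI) auto
      also have "\<dots> = ennreal (1 + e) * \<nu> E"
        using \<open>0 < e\<close> hausdorff2_const_pos by (simp add: nE ennreal_mult mult.assoc)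
      finally show "\<mu> E \<le> ennreal (1 + e) * \<nu> E" .
      have "\<nu> E \<le> ennreal ((1 + e) * (?c * (1 - x))) * ?I"
        unfolding nE using mult_right_mono[OF q2, of ?c] hausdorff2_const_pos
        by (intro mult_right_mono ennreal_leI) (auto simp: algebra_simps)
      also have "\<dots> = ennreal (1 + e) * (ennreal (?c * (1 - x)) * ?I)"
        using \<open>0 < e\<close> x hausdorff2_const_pos by (simp add: ennreal_mult mult.assoc)
      also have "\<dots> \<le> ennreal (1 + e) * \<mu> E"
        using rE[OF E] by (intro mult_left_mono) (auto simp: \<mu>_def)
      finally show "\<nu> E \<le> ennreal (1 + e) * \<mu> E" .
    qed
    with r show ?thesis by blast
  qed
  have "\<mu> E \<le> \<nu> E"
  proof (rule countably_additive_le_local[where V = V, OF _ mu_add nu_add _ E])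
    show "\<exists>r>0. \<forall>E\<in>sets borel. E \<subseteq> ball a r \<inter> V \<longrightarrow> \<mu> E \<le> ennreal (1 + e) * \<nu> E"
      if "a \<in> V" "0 < e" for a e using loc[OF that] by blast
  qed (simp_all add: \<mu>_def)
  moreover have "\<nu> E \<le> \<mu> E"
  proof (rule countably_additive_le_local[where V = V, OF _ nu_add mu_add _ E])
    show "\<exists>r>0. \<forall>E\<in>sets borel. E \<subseteq> ball a r \<inter> V \<longrightarrow> \<nu> E \<le> ennreal (1 + e) * \<mu> E"
      if "a \<in> V" "0 < e" for a e using loc[OF that] by blast
  qed (simp_all add: \<nu>_def)
  ultimately have "\<mu> E = \<nu> E" by (rule antisym)
  then show ?thesis using nu[OF E] phi_image_borel[OF E] by (simp add: \<mu>_def emeasure_hausdorff2)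
qed

theorem nn_integral_hausdorff2_image:
  assumes U [measurable]: "U \<in> sets borel" and "U \<subseteq> V" and F [measurable]: "F \<in> borel_measurable borel"
  shows "(\<integral>\<^sup>+y. F y * indicator (\<phi> ` U) y \<partial>hausdorff2)
       = ennreal hausdorff2_const * (\<integral>\<^sup>+x. ennreal (jac x) * F (\<phi> x) * indicator U x \<partial>lborel)"
proof -
  let ?c = "ennreal hausdorff2_const"
  have eqU: "(\<lambda>x. ennreal (jac x) * indicator V x * indicator U x) = (\<lambda>x. ennreal (jac x) * indicator U x)"
    using \<open>U \<subseteq> V\<close> by (auto simp: fun_eq_iff indicator_def)
  have mU [measurable]: "(\<lambda>x. ennreal (jac x) * indicator U x) \<in> borel_measurable borel"
    unfolding eqU[symmetric] by measurable
  have hom: "homeomorphism U (\<phi> ` U) \<phi> \<xi>"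
    using homeo \<open>U \<subseteq> V\<close> by (auto intro: homeomorphism_of_subsets)
  have "(\<integral>\<^sup>+y. F y * indicator (\<phi> ` U) y \<partial>hausdorff2) = (\<integral>\<^sup>+x. ?c * ennreal (jac x) * F (\<phi> x) * indicator U x \<partial>lborel)"
  proof (rule nn_integral_image_density[OF hom U phi_image_borel[OF U \<open>U \<subseteq> V\<close>]])
    show "(\<lambda>x. ?c * ennreal (jac x) * indicator U x) \<in> borel_measurable borel"
      unfolding mult.assoc by measurable
    fix E assume E [measurable]: "E \<in> sets borel" and "E \<subseteq> U"
    have eqE: "(\<lambda>x. ennreal (jac x) * indicator U x * indicator E x) = (\<lambda>x. ennreal (jac x) * indicator E x)"
      using \<open>E \<subseteq> U\<close> by (auto simp: fun_eq_iff indicator_def)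
    have [measurable]: "(\<lambda>x. ennreal (jac x) * indicator E x) \<in> borel_measurable borel"
      unfolding eqE[symmetric] by measurable
    show "emeasure hausdorff2 (\<phi> ` E) = (\<integral>\<^sup>+x. ?c * ennreal (jac x) * indicator E x \<partial>lborel)"
      using \<open>E \<subseteq> U\<close> \<open>U \<subseteq> V\<close> unfolding mult.assoc
      by (subst nn_integral_cmult) (auto simp: hausdorff2_area_formula)
  qed auto
  also have "\<dots> = (\<integral>\<^sup>+x. ?c * (ennreal (jac x) * F (\<phi> x) * indicator U x) \<partial>lborel)"
    by (simp add: mult.assoc)
  also have "\<dots> = ?c * (\<integral>\<^sup>+x. ennreal (jac x) * F (\<phi> x) * indicator U x \<partial>lborel)"
  proof (rule nn_integral_cmult)
    define \<phi>' where "\<phi>' = (\<lambda>x. if x \<in> U then \<phi> x else 0)"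
    have [measurable]: "\<phi>' \<in> borel_measurable borel"
      unfolding \<phi>'_def using continuous_on_subset[OF continuous_on_phi \<open>U \<subseteq> V\<close>]
      by (intro borel_measurable_continuous_on_if) auto
    have "(\<lambda>x. (ennreal (jac x) * indicator U x) * F (\<phi>' x)) \<in> borel_measurable lborel" by measurable
    moreover have "(\<lambda>x. (ennreal (jac x) * indicator U x) * F (\<phi>' x)) = (\<lambda>x. ennreal (jac x) * F (\<phi> x) * indicator U x)"
      by (auto simp: indicator_def \<phi>'_def)
    ultimately show "(\<lambda>x. ennreal (jac x) * F (\<phi> x) * indicator U x) \<in> borel_measurable lborel" by simp
  qed
  finally show ?thesis .
qed

end

section \<open>Calculus of C^k maps on open sets\<close>

lemma Ck_on_SucD: "Ck_on (Suc k) V f \<Longrightarrow> Ck_on k V f"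
proof (induction k arbitrary: f)
  case 0
  then show ?case
    by (auto intro!: continuous_at_imp_continuous_on dest: has_derivative_continuous)
next
  case (Suc k)
  then obtain f' where "\<forall>x\<in>V. (f has_derivative f' x) (at x)" "\<forall>v. Ck_on (Suc k) V (\<lambda>x. f' x v)"
    by (auto simp only: Ck_on.simps(2)[of "Suc k"])
  with Suc.IH show ?case by auto
qed

lemma Ck_on_const: "Ck_on k V (\<lambda>x. c)"
proof (induction k arbitrary: c)
  case (Suc k)
  show ?case unfolding Ck_on.simps
    by (rule exI[of _ "\<lambda>x v. 0"]) (auto intro: Suc.IH)
qed simp

lemma Ck_on_add: "Ck_on k V f \<Longrightarrow> Ck_on k V g \<Longrightarrow> Ck_on k V (\<lambda>x. f x + g x)"
proof (induction k arbitrary: f g)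
  case (Suc k)
  then obtain f' g' where "\<forall>x\<in>V. (f has_derivative f' x) (at x)" "\<forall>v. Ck_on k V (\<lambda>x. f' x v)"
    "\<forall>x\<in>V. (g has_derivative g' x) (at x)" "\<forall>v. Ck_on k V (\<lambda>x. g' x v)" by auto
  then show ?case
    by (auto intro!: exI[of _ "\<lambda>x v. f' x v + g' x v"] Suc.IH derivative_intros)
qed (auto intro: continuous_intros)

text \<open>The product rule, by induction on k; it covers the scalar, inner and cross products from
  which the unit normal is formed.\<close>

lemma Ck_on_bilinear:
  fixes pr :: "'b::real_normed_vector \<Rightarrow> 'c::real_normed_vector \<Rightarrow> 'd::real_normed_vector"
  assumes "bounded_bilinear pr"
  shows "Ck_on k V f \<Longrightarrow> Ck_on k V g \<Longrightarrow> Ck_on k V (\<lambda>x. pr (f x) (g x))"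
proof (induction k arbitrary: f g)
  case 0
  then show ?case by (auto intro: bounded_bilinear.continuous_on[OF assms])
next
  case (Suc k)
  obtain f' g' where d: "\<forall>x\<in>V. (f has_derivative f' x) (at x)" "\<forall>v. Ck_on k V (\<lambda>x. f' x v)"
    "\<forall>x\<in>V. (g has_derivative g' x) (at x)" "\<forall>v. Ck_on k V (\<lambda>x. g' x v)" using Suc.prems by auto
  have "Ck_on k V f" "Ck_on k V g" using Suc.prems Ck_on_SucD by blast+
  with d show ?case unfolding Ck_on.simps
    by (intro exI[of _ "\<lambda>x v. pr (f x) (g' x v) + pr (f' x v) (g x)"] conjI ballI allI)
       (auto intro!: Ck_on_add Suc.IH bounded_bilinear.FDERIV[OF assms])
qed

text \<open>The exponent varies in the induction because differentiation lowers it by one. The case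
  p = -1/2 normalises vector fields.\<close>

lemma Ck_on_powr:
  fixes f :: "'a::euclidean_space \<Rightarrow> real"
  assumes "\<And>x. x \<in> V \<Longrightarrow> 0 < f x"
  shows "Ck_on k V f \<Longrightarrow> Ck_on k V (\<lambda>x. f x powr p)"
proof (induction k arbitrary: p)
  case 0
  then show ?case using assms by (auto intro!: continuous_intros simp: less_imp_neq[symmetric])
next
  case (Suc k)
  obtain f' where d: "\<forall>x\<in>V. (f has_derivative f' x) (at x)" "\<forall>v. Ck_on k V (\<lambda>x. f' x v)"
    using Suc.prems by auto
  have fk: "Ck_on k V f" using Suc.prems Ck_on_SucD by blast
  have "((\<lambda>x. f x powr p) has_derivative (\<lambda>v. p * (f x powr (p - 1) * f' x v))) (at x)" if "x \<in> V" for x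
  proof -
    have "((\<lambda>y. y powr p) has_real_derivative p * f x powr (p - 1)) (at (f x))"
      using assms[OF that] by (rule has_real_derivative_powr)
    then have "((\<lambda>y. y powr p) has_derivative (\<lambda>v. v * (p * f x powr (p - 1)))) (at (f x))"
      by (simp add: has_field_derivative_def mult.commute[of _ "p * _"] mult_commute_abs)
    from has_derivative_compose[OF d(1)[rule_format, OF that] this] show ?thesis
      by (simp add: mult_ac)
  qed
  with d show ?case unfolding Ck_on.simps
    by (intro exI[of _ "\<lambda>x v. p * (f x powr (p - 1) * f' x v)"] conjI ballI allI)
       (auto intro!: Ck_on_bilinear[OF bounded_bilinear_mult] Ck_on_const Suc.IH fk)
qed

lemma Ck_on_transform:
  assumes "open V" "\<And>x. x \<in> V \<Longrightarrow> f x = g x"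
  shows "Ck_on k V f \<Longrightarrow> Ck_on k V g"
proof (cases k)
  case 0
  then show "Ck_on k V f \<Longrightarrow> Ck_on k V g" using assms(2) by (auto cong: continuous_on_cong)
next
  case (Suc m)
  have "(g has_derivative f') (at x)" if "x \<in> V" "(f has_derivative f') (at x)" for f' x
    by (rule has_derivative_transform_within_open[OF that(2) assms(1) that(1) assms(2)])
  then show "Ck_on k V f \<Longrightarrow> Ck_on k V g"
    using Suc by auto
qed

text \<open>Uniqueness of derivatives replaces the existential in \<open>Ck_on\<close> by the
  derivative at hand.\<close>

lemma Ck_on_Suc_iff:
  assumes "open V" "\<And>x. x \<in> V \<Longrightarrow> (f has_derivative f' x) (at x)"
  shows "Ck_on (Suc k) V f \<longleftrightarrow> (\<forall>v. Ck_on k V (\<lambda>x. f' x v))"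
proof
  assume "Ck_on (Suc k) V f"
  then obtain g where g: "\<forall>x\<in>V. (f has_derivative g x) (at x)" "\<forall>v. Ck_on k V (\<lambda>x. g x v)" by auto
  then have "g x = f' x" if "x \<in> V" for x using assms(2) that has_derivative_unique by blast
  then show "\<forall>v. Ck_on k V (\<lambda>x. f' x v)" using g(2) Ck_on_transform[OF assms(1)] by metis
qed (use assms(2) in auto)

lemma real2_expand: "v = v$1 *\<^sub>R axis 1 1 + v$2 *\<^sub>R (axis 2 1 :: real^2)"
  by (simp add: vec_eq_iff forall_2 axis_def)

lemma linear_real2:
  assumes "linear (f :: real^2 \<Rightarrow> 'b::real_vector)"
  shows "f v = v$1 *\<^sub>R f (axis 1 1) + v$2 *\<^sub>R f (axis 2 1)"
  by (subst real2_expand) (simp add: linear_add[OF assms] linear_scale[OF assms])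

lemma norm_linear_real2_le:
  assumes "linear (f :: real^2 \<Rightarrow> 'b::real_normed_vector)" "norm (f (axis 1 1)) \<le> c" "norm (f (axis 2 1)) \<le> c"
  shows "norm (f v) \<le> 2 * c * norm v"
proof -
  have "norm (f v) \<le> \<bar>v$1\<bar> * norm (f (axis 1 1)) + \<bar>v$2\<bar> * norm (f (axis 2 1))"
    by (subst linear_real2[OF assms(1)]) (rule norm_triangle_le, simp)
  also have "\<dots> \<le> norm v * c + norm v * c"
    using assms(2,3) by (intro add_mono mult_mono component_le_norm_cart) auto
  finally show ?thesis by simp
qed

text \<open>Compactness bounds the derivative in the two axis directions, hence in all; convexity
  turns this into a Lipschitz bound by the mean value inequality.\<close>

lemma C1_bounds:
  fixes f :: "real^2 \<Rightarrow> 'b::real_normed_vector"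
  assumes "open V" and der: "\<And>x. x \<in> V \<Longrightarrow> (f has_derivative f' x) (at x)" and C1: "Ck_on 1 V f"
    and K: "compact K" "convex K" "K \<subseteq> V"
  shows "\<exists>B>0. \<forall>x\<in>K. \<forall>y\<in>K. \<forall>v. norm (f' x v) \<le> B * norm v \<and> norm (f x - f y) \<le> B * norm (x - y)"
proof -
  have lin: "linear (f' x)" if "x \<in> V" for x using der[OF that] has_derivative_linear by blast
  have "\<exists>c. \<forall>x\<in>K. norm (f' x v) \<le> c" for v
  proof -
    have "Ck_on 0 V (\<lambda>x. f' x v)" using C1 Ck_on_Suc_iff[OF \<open>open V\<close> der, of 0] by simp
    then have "continuous_on K (\<lambda>x. f' x v)" using K(3) by (simp add: continuous_on_subset)
    then have "bounded ((\<lambda>x. f' x v) ` K)"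
      using compact_imp_bounded[OF compact_continuous_image[OF _ K(1)]] by blast
    then show ?thesis unfolding bounded_iff by auto
  qed
  then obtain c where c: "\<And>v x. x \<in> K \<Longrightarrow> norm (f' x v) \<le> c v" by metis
  define B where "B = 2 * max 1 (max (c (axis 1 1)) (c (axis 2 1)))"
  have B: "norm (f' x v) \<le> B * norm v" if "x \<in> K" for x v
    unfolding B_def using that K(3) by (intro norm_linear_real2_le lin) (auto intro!: order_trans[OF c])
  have "B > 0" by (simp add: B_def)
  moreover have "norm (f x - f y) \<le> B * norm (x - y)" if "x \<in> K" "y \<in> K" for x y
  proof (rule differentiable_bound[OF K(2) _ _ that])
    show "(f has_derivative f' z) (at z within K)" if "z \<in> K" for z
      by (rule has_derivative_at_withinI[OF der]) (use that K(3) in blast)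
    show "onorm (f' z) \<le> B" if "z \<in> K" for z
      by (rule onorm_bound) (use B[OF that] \<open>B > 0\<close> in auto)
  qed
  ultimately show ?thesis using B by blast
qed

text \<open>The bounds for C^1 maps, applied to each partial derivative, make the derivative
  Lipschitz. The quadratic Taylor remainder then follows from the mean value inequality for f minus
  its linear part at y.\<close>

lemma C2_bounds:
  fixes f :: "real^2 \<Rightarrow> 'b::real_normed_vector"
  assumes "open V" and der: "\<And>x. x \<in> V \<Longrightarrow> (f has_derivative f' x) (at x)" and C2: "Ck_on 2 V f"
    and K: "compact K" "convex K" "K \<subseteq> V"
  shows "\<exists>B>0. \<forall>x\<in>K. \<forall>y\<in>K. (\<forall>v. norm (f' x v) \<le> B * norm v) \<and> norm (f x - f y) \<le> B * norm (x - y) \<and>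
    (\<forall>v. norm (f' x v - f' y v) \<le> B * norm (x - y) * norm v) \<and>
    norm (f x - f y - f' y (x - y)) \<le> B * (norm (x - y))\<^sup>2"
proof -
  have lin: "linear (f' x)" if "x \<in> V" for x using der[OF that] has_derivative_linear by blast
  have C1: "Ck_on 1 V f" using C2 Ck_on_SucD[of 1] by (simp add: numeral_2_eq_2)
  have d1: "Ck_on 1 V (\<lambda>x. f' x v)" for v
    using C2 Ck_on_Suc_iff[OF \<open>open V\<close> der, of 1] by (simp add: numeral_2_eq_2)
  have "\<exists>B>0. \<forall>x\<in>K. \<forall>y\<in>K. norm (f' x v - f' y v) \<le> B * norm (x - y)" for v
  proof -
    obtain g where "\<And>x. x \<in> V \<Longrightarrow> ((\<lambda>x. f' x v) has_derivative g x) (at x)"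
      using d1[of v] by auto
    from C1_bounds[OF \<open>open V\<close> this d1 K] show ?thesis by blast
  qed
  then obtain b where b: "\<And>v. b v > 0" "\<And>v x y. x \<in> K \<Longrightarrow> y \<in> K \<Longrightarrow> norm (f' x v - f' y v) \<le> b v * norm (x - y)"
    by metis
  obtain B1 where B1: "B1 > 0" "\<And>x v. x \<in> K \<Longrightarrow> norm (f' x v) \<le> B1 * norm v"
      "\<And>x y. x \<in> K \<Longrightarrow> y \<in> K \<Longrightarrow> norm (f x - f y) \<le> B1 * norm (x - y)"
    using C1_bounds[OF \<open>open V\<close> der C1 K] by blast
  define m where "m = max (b (axis 1 1)) (b (axis 2 1))"
  define B where "B = max B1 (2 * m)"
  have B0: "B > 0" using B1 by (simp add: B_def)
  have Lip: "norm (f' x v - f' y v) \<le> B * norm (x - y) * norm v" if "x \<in> K" "y \<in> K" for x y v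
  proof -
    have "linear (\<lambda>v. f' x v - f' y v)"
      using lin that K(3) by (intro linear_compose_sub) auto
    moreover have "norm (f' x (axis i 1) - f' y (axis i 1)) \<le> m * norm (x - y)" if "i = 1 \<or> i = 2" for i
      using order_trans[OF b(2)[OF \<open>x \<in> K\<close> \<open>y \<in> K\<close>, of "axis i 1"] mult_right_mono[of "b (axis i 1)" m]] that
      by (auto simp: m_def)
    ultimately have "norm (f' x v - f' y v) \<le> 2 * (m * norm (x - y)) * norm v"
      by (intro norm_linear_real2_le[where f = "\<lambda>v. f' x v - f' y v"]) auto
    also have "\<dots> \<le> B * norm (x - y) * norm v"
      unfolding mult.assoc[symmetric] by (intro mult_right_mono) (auto simp: B_def)
    finally show ?thesis .
  qed
  have Taylor: "norm (f x - f y - f' y (x - y)) \<le> B * (norm (x - y))\<^sup>2" if "x \<in> K" "y \<in> K" for x y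
  proof -
    \<comment> \<open>On this set the derivative deviates from that at y by at most B |x - y|, which
      supplies the second factor |x - y| of the remainder.\<close>
    let ?S = "K \<inter> cball y (norm (x - y))"
    have yV: "y \<in> V" using that K(3) by blast
    have bl: "bounded_linear (f' y)" using der[OF yV] has_derivative_bounded_linear by blast
    have "norm ((f x - f' y x) - (f y - f' y y)) \<le> B * norm (x - y) * norm (x - y)"
    proof (rule differentiable_bound)
      show "convex ?S" using K(2) by (intro convex_Int) auto
      show "x \<in> ?S" "y \<in> ?S" using that by (auto simp: dist_norm norm_minus_commute)
      fix z assume z: "z \<in> ?S"
      have "(f has_derivative f' z) (at z within ?S)"
        by (rule has_derivative_at_withinI[OF der]) (use z K(3) in blast)
      moreover have "(f' y has_derivative f' y) (at z within ?S)"
        using bl by (rule bounded_linear_imp_has_derivative)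
      ultimately show "((\<lambda>x. f x - f' y x) has_derivative (\<lambda>v. f' z v - f' y v)) (at z within ?S)"
        by (rule has_derivative_diff)
      show "onorm (\<lambda>v. f' z v - f' y v) \<le> B * norm (x - y)"
      proof (rule onorm_bound)
        fix v
        have "norm (f' z v - f' y v) \<le> B * norm (z - y) * norm v" using Lip z \<open>y \<in> K\<close> by blast
        also have "\<dots> \<le> B * norm (x - y) * norm v"
          using z B0 by (intro mult_right_mono mult_left_mono) (auto simp: dist_norm norm_minus_commute)
        finally show "norm (f' z v - f' y v) \<le> B * norm (x - y) * norm v" .
      qed (use B0 in auto)
    qed
    then show ?thesis
      by (simp add: linear_diff[OF lin[OF yV]] power2_eq_square algebra_simps)
  qed
  have "norm (f' x v) \<le> B * norm v" if "x \<in> K" for x v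
    using order_trans[OF B1(2)[OF that, of v] mult_right_mono[of B1 B]] by (auto simp: B_def)
  moreover have "norm (f x - f y) \<le> B * norm (x - y)" if "x \<in> K" "y \<in> K" for x y
    using order_trans[OF B1(3)[OF that] mult_right_mono[of B1 B]] by (auto simp: B_def)
  ultimately show ?thesis using B0 Lip Taylor by blast
qed

section \<open>Second-order expansion of a patch over its tangent plane\<close>

lemma bounded_bilinear_cross3: "bounded_bilinear cross3"
  using bilinear_cross bilinear_conv_bounded_bilinear by blast

lemma norm_cross3_le: "norm (cross3 x y) \<le> norm x * norm y"
proof -
  have "(norm (cross3 x y))\<^sup>2 \<le> (norm x * norm y)\<^sup>2"
    using norm_cross_dot[of x y] by (metis le_add_same_cancel1 zero_le_power2)
  then show ?thesis by (rule power2_le_imp_le) simp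
qed

text \<open>Polarisation of \<open>norm_tproj\<close>.\<close>

lemma inner_tproj:
  assumes "oframe e1 e2 n"
  shows "v \<bullet> w = tproj e1 e2 v \<bullet> tproj e1 e2 w + (v \<bullet> n) * (w \<bullet> n)"
proof -
  have "4 * (v \<bullet> w) = (norm (v + w))\<^sup>2 - (norm (v - w))\<^sup>2"
    by (simp add: power2_norm_eq_inner inner_add_left inner_add_right inner_diff_left inner_diff_right inner_commute)
  also have "\<dots> = (norm (tproj e1 e2 v + tproj e1 e2 w))\<^sup>2 - (norm (tproj e1 e2 v - tproj e1 e2 w))\<^sup>2
     + (v \<bullet> n + w \<bullet> n)\<^sup>2 - (v \<bullet> n - w \<bullet> n)\<^sup>2"
    unfolding norm_tproj[OF assms] linear_add[OF linear_tproj] tproj_diff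
    by (simp add: inner_add_left inner_diff_left)
  also have "\<dots> = 4 * (tproj e1 e2 v \<bullet> tproj e1 e2 w + (v \<bullet> n) * (w \<bullet> n))"
    unfolding power2_norm_eq_inner
    by (simp add: inner_add_left inner_add_right inner_diff_left inner_diff_right inner_commute power2_eq_square algebra_simps)
  finally show ?thesis by simp
qed

locale surface_patch = immersion +
  assumes smooth: "smooth_on V \<phi>"
begin

lemma Ck_D: "Ck_on k V (\<lambda>x. D x v)"
  using smooth Ck_on_Suc_iff[OF open_V deriv, of k] unfolding smooth_on_def by blast

lemma Ck_cr: "Ck_on k V cr"
  unfolding cr_def by (intro Ck_on_bilinear[OF bounded_bilinear_cross3] Ck_D)

text \<open>Writing the inverse length as a power of an inner product makes the closure rules
  applicable.\<close>

lemma Ck_nrm: "Ck_on k V nrm"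
proof (rule Ck_on_transform[OF open_V])
  show "Ck_on k V (\<lambda>x. (cr x \<bullet> cr x) powr (-1/2) *\<^sub>R cr x)"
    by (intro Ck_on_bilinear[OF bounded_bilinear_scaleR] Ck_on_powr Ck_on_bilinear[OF bounded_bilinear_inner] Ck_cr)
       (simp add: cr_nonzero)
  fix x assume "x \<in> V"
  have "(cr x \<bullet> cr x) powr (-1/2) = inverse (sqrt (cr x \<bullet> cr x))"
    by (simp add: powr_minus powr_half_sqrt)
  then show "(cr x \<bullet> cr x) powr (-1/2) *\<^sub>R cr x = nrm x"
    by (simp add: nrm_def norm_eq_sqrt_inner)
qed

definition DN :: "real^2 \<Rightarrow> real^2 \<Rightarrow> real^3" where
  "DN x = frechet_derivative nrm (at x)"

lemma nrm_deriv: "x \<in> V \<Longrightarrow> (nrm has_derivative DN x) (at x)"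
  unfolding DN_def using Ck_nrm[of "Suc 0"]
  by (intro frechet_derivative_works[THEN iffD1]) (auto simp: differentiable_def)

lemma linear_DN: "x \<in> V \<Longrightarrow> linear (DN x)"
  using nrm_deriv has_derivative_linear by blast

text \<open>Differentiating |nrm|^2 = 1 shows that the normal varies tangentially.\<close>

lemma nrm_DN: "x \<in> V \<Longrightarrow> nrm x \<bullet> DN x v = 0"
proof -
  assume x: "x \<in> V"
  have "((\<lambda>y. nrm y \<bullet> nrm y) has_derivative (\<lambda>v. nrm x \<bullet> DN x v + DN x v \<bullet> nrm x)) (at x)"
    using nrm_deriv[OF x] by (auto intro!: derivative_eq_intros)
  moreover have "((\<lambda>y. nrm y \<bullet> nrm y) has_derivative (\<lambda>v. 0)) (at x)"
  proof (rule has_derivative_transform_within_open[OF _ open_V x])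
    show "((\<lambda>y. 1) has_derivative (\<lambda>v. 0)) (at x)" by simp
    show "1 = nrm y \<bullet> nrm y" if "y \<in> V" for y using norm_nrm[OF that] by (simp add: norm_eq_1)
  qed
  ultimately have "(\<lambda>v. nrm x \<bullet> DN x v + DN x v \<bullet> nrm x) = (\<lambda>v. 0)" by (rule has_derivative_unique)
  then have "nrm x \<bullet> DN x v + DN x v \<bullet> nrm x = 0" by meson
  then show ?thesis by (simp add: inner_commute)
qed

text \<open>One constant B \<ge> 1 for all estimates on K, so that powers of B can be compared and
  error terms merged. Convexity keeps segments inside K.\<close>

definition patch_bound :: "(real^2) set \<Rightarrow> real \<Rightarrow> bool" where
  "patch_bound K B \<longleftrightarrow> 1 \<le> B \<and> K \<subseteq> V \<and> convex K \<and> (\<forall>x\<in>K. \<forall>y\<in>K.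
     (\<forall>v. norm (D x v) \<le> B * norm v \<and> norm v \<le> B * norm (D x v) \<and> norm (DN x v) \<le> B * norm v
        \<and> norm (D x v - D y v) \<le> B * norm (x - y) * norm v) \<and>
     norm (\<phi> x - \<phi> y) \<le> B * norm (x - y) \<and> norm (nrm x - nrm y) \<le> B * norm (x - y) \<and>
     norm (\<phi> x - \<phi> y - D y (x - y)) \<le> B * (norm (x - y))\<^sup>2 \<and>
     norm (nrm x - nrm y - DN y (x - y)) \<le> B * (norm (x - y))\<^sup>2)"

lemma patch_bound_exists:
  assumes K: "compact K" "convex K" "K \<subseteq> V"
  shows "\<exists>B. patch_bound K B"
proof -
  have "Ck_on 2 V \<phi>" using smooth by (simp add: smooth_on_def)
  from C2_bounds[OF open_V deriv this K] obtain B1 where B1: "B1 > 0"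
    "\<And>x v. x \<in> K \<Longrightarrow> norm (D x v) \<le> B1 * norm v"
    "\<And>x y. x \<in> K \<Longrightarrow> y \<in> K \<Longrightarrow> norm (\<phi> x - \<phi> y) \<le> B1 * norm (x - y)"
    "\<And>x y v. x \<in> K \<Longrightarrow> y \<in> K \<Longrightarrow> norm (D x v - D y v) \<le> B1 * norm (x - y) * norm v"
    "\<And>x y. x \<in> K \<Longrightarrow> y \<in> K \<Longrightarrow> norm (\<phi> x - \<phi> y - D y (x - y)) \<le> B1 * (norm (x - y))\<^sup>2" by blast
  from C2_bounds[OF open_V nrm_deriv Ck_nrm K] obtain B2 where B2: "B2 > 0"
    "\<And>x v. x \<in> K \<Longrightarrow> norm (DN x v) \<le> B2 * norm v"
    "\<And>x y. x \<in> K \<Longrightarrow> y \<in> K \<Longrightarrow> norm (nrm x - nrm y) \<le> B2 * norm (x - y)"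
    "\<And>x y. x \<in> K \<Longrightarrow> y \<in> K \<Longrightarrow> norm (nrm x - nrm y - DN y (x - y)) \<le> B2 * (norm (x - y))\<^sup>2" by blast
  have "\<exists>j>0. \<forall>x\<in>K. j \<le> jac x"
  proof (cases "K = {}")
    case False
    obtain z where "z \<in> K" "\<And>x. x \<in> K \<Longrightarrow> jac z \<le> jac x"
      using continuous_attains_inf[OF K(1) False continuous_on_subset[OF continuous_on_jac K(3)]] by blast
    then show ?thesis using jac_pos K(3) by blast
  qed (auto intro: exI[of _ 1])
  then obtain j where j: "j > 0" "\<And>x. x \<in> K \<Longrightarrow> j \<le> jac x" by blast
  \<comment> \<open>Cramer's rule with cross products: crossing D x v with one partial derivative
    isolates the other coordinate of v times \<open>cr x\<close>, whose length is at least j on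
    K.\<close>
  have low: "norm v \<le> (2 * B1 / j) * norm (D x v)" if x: "x \<in> K" for x v
  proof -
    let ?p = "D x (axis 1 1)" and ?q = "D x (axis 2 1)"
    have xV: "x \<in> V" using x K(3) by blast
    have Dv: "D x v = v$1 *\<^sub>R ?p + v$2 *\<^sub>R ?q" by (rule D_expand[OF xV])
    have "cross3 (D x v) ?q = v$1 *\<^sub>R cr x"
      unfolding Dv by (simp add: cross_add_left cross_mult_left cr_def)
    then have "\<bar>v$1\<bar> * jac x = norm (cross3 (D x v) ?q)" by (simp add: jac_def)
    also have "\<dots> \<le> norm (D x v) * norm ?q" by (rule norm_cross3_le)
    also have "\<dots> \<le> norm (D x v) * B1" using B1(2)[OF x, of "axis 2 1"] by (intro mult_left_mono) auto
    finally have 1: "\<bar>v$1\<bar> * j \<le> norm (D x v) * B1"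
      using mult_left_mono[OF j(2)[OF x], of "\<bar>v$1\<bar>"] by simp
    have "cross3 ?p (D x v) = v$2 *\<^sub>R cr x"
      unfolding Dv by (simp add: cross_add_right cross_mult_right cr_def)
    then have "\<bar>v$2\<bar> * jac x = norm (cross3 ?p (D x v))" by (simp add: jac_def)
    also have "\<dots> \<le> norm ?p * norm (D x v)" by (rule norm_cross3_le)
    also have "\<dots> \<le> B1 * norm (D x v)" using B1(2)[OF x, of "axis 1 1"] by (intro mult_right_mono) auto
    finally have 2: "\<bar>v$2\<bar> * j \<le> norm (D x v) * B1"
      using mult_left_mono[OF j(2)[OF x], of "\<bar>v$2\<bar>"] by (simp add: mult.commute)
    have "norm v \<le> \<bar>v$1\<bar> + \<bar>v$2\<bar>" using norm_le_l1_cart[of v] by (simp add: sum_2)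
    then have "norm v * j \<le> (\<bar>v$1\<bar> + \<bar>v$2\<bar>) * j" using j(1) by (intro mult_right_mono) auto
    then have "norm v * j \<le> 2 * B1 * norm (D x v)" using 1 2 by (simp add: algebra_simps)
    then show ?thesis using j(1) by (simp add: field_simps)
  qed
  define B where "B = max 1 (max (max B1 B2) (2 * B1 / j))"
  have BB: "B1 \<le> B" "B2 \<le> B" "2 * B1 / j \<le> B" "1 \<le> B" by (auto simp: B_def)
  have up: "z \<le> b * c \<Longrightarrow> b \<le> B \<Longrightarrow> 0 \<le> c \<Longrightarrow> z \<le> B * c" for z b c
    by (meson mult_right_mono order_trans)
  have "patch_bound K B"
    unfolding patch_bound_def
    using BB K(2,3) up[OF B1(2) BB(1)] up[OF B1(3) BB(1)] up[OF B1(5) BB(1)] up[OF B2(2) BB(2)]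
      up[OF B2(3) BB(2)] up[OF B2(4) BB(2)] up[OF low BB(3)]
      up[OF B1(4)[unfolded mult.assoc] BB(1), unfolded mult.assoc[symmetric]]
    by auto
  then show ?thesis by blast
qed

text \<open>The Weingarten map minus d(normal), in the coordinates of a frame of the tangent plane.
  As a relation it avoids choosing an inverse of the projected derivative; with this sign the height
  over the tangent plane is (S u . u)/2 to second order.\<close>

definition shape_operator :: "real^3 \<Rightarrow> real^3 \<Rightarrow> real^2 \<Rightarrow> (real^2 \<Rightarrow> real^2) \<Rightarrow> bool" where
  "shape_operator e1 e2 a S \<longleftrightarrow> linear S \<and> (\<forall>v. S (tproj e1 e2 (D a v)) = - tproj e1 e2 (DN a v))"

lemma norm_tproj_D:
  assumes "a \<in> V" "oframe e1 e2 (nrm a)"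
  shows "norm (tproj e1 e2 (D a v)) = norm (D a v)"
  using norm_tproj[OF assms(2), of "D a v"] nrm_D[OF assms(1), of v] by (simp add: inner_commute)

lemma linear_tproj_D: "a \<in> V \<Longrightarrow> linear (\<lambda>v. tproj e1 e2 (D a v))"
  using linear_compose[OF linear_D linear_tproj] by (simp add: o_def)

lemma inj_tproj_D:
  assumes "a \<in> V" "oframe e1 e2 (nrm a)"
  shows "inj (\<lambda>v. tproj e1 e2 (D a v))"
proof (subst linear_injective_0[OF linear_tproj_D[OF assms(1)]], clarify)
  fix v assume "tproj e1 e2 (D a v) = 0"
  then have "D a v = 0" using norm_tproj_D[OF assms, of v] by simp
  then show "v = 0" using inj_D[OF assms(1)] linear_injective_0[OF linear_D[OF assms(1)]] by blast
qed

text \<open>Tangent vectors project without loss of length, so the projected derivative is injective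
  and has a linear left inverse.\<close>

lemma shape_operator_exists:
  assumes "a \<in> V" "oframe e1 e2 (nrm a)"
  shows "\<exists>S. shape_operator e1 e2 a S"
proof -
  obtain g where g: "linear g" "g \<circ> (\<lambda>v. tproj e1 e2 (D a v)) = id"
    using linear_injective_left_inverse[OF linear_tproj_D[OF assms(1)] inj_tproj_D[OF assms]] by blast
  have "linear (\<lambda>w. - tproj e1 e2 (DN a (g w)))"
    using linear_compose[OF linear_compose[OF g(1) linear_DN[OF assms(1)]] linear_tproj]
    by (intro linear_compose_neg) (simp add: o_def)
  moreover have "g (tproj e1 e2 (D a v)) = v" for v using g(2) by (metis comp_apply id_apply)
  ultimately show ?thesis unfolding shape_operator_def by (intro exI[of _ "\<lambda>w. - tproj e1 e2 (DN a (g w))"]) auto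
qed

lemma shape_operator_bound:
  assumes "patch_bound K B" "a \<in> K" "oframe e1 e2 (nrm a)" "shape_operator e1 e2 a S"
  shows "norm (S w) \<le> B\<^sup>2 * norm w"
proof -
  have aV: "a \<in> V" using assms(1,2) by (auto simp: patch_bound_def)
  have B: "0 \<le> B" using assms(1) by (auto simp: patch_bound_def)
  have "surj (\<lambda>v. tproj e1 e2 (D a v))"
    by (rule linear_injective_imp_surjective[OF linear_tproj_D[OF aV] inj_tproj_D[OF aV assms(3)]]) simp
  then obtain v where v: "w = tproj e1 e2 (D a v)" by (metis surjD)
  have "norm (S w) = norm (tproj e1 e2 (DN a v))" using assms(4) by (simp add: shape_operator_def v)
  also have "\<dots> \<le> norm (DN a v)" by (rule norm_tproj_le[OF assms(3)])
  also have "\<dots> \<le> B * norm v" using assms(1,2) by (auto simp: patch_bound_def)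
  also have "\<dots> \<le> B * (B * norm (D a v))" using assms(1,2) B by (intro mult_left_mono) (auto simp: patch_bound_def)
  also have "norm (D a v) = norm w" by (simp add: v norm_tproj_D[OF aV assms(3)])
  finally show ?thesis by (simp add: power2_eq_square mult.assoc)
qed

text \<open>Monge form of the patch over its tangent plane, with h = |x - a| and r = |U|. To first
  order U is the projection of D a (x - a), so h is at most a multiple of r, the normal changes by
  -S U, and the height is (S U . U)/2 up to cubic terms.\<close>

lemma tcoord_expansion:
  assumes pb: "patch_bound K B" and a: "a \<in> K" and x: "x \<in> K" and fr: "oframe e1 e2 (nrm a)"
    and sh: "shape_operator e1 e2 a S" and small: "2 * B\<^sup>2 * norm (x - a) \<le> 1"
  defines "U \<equiv> tcoord e1 e2 a x"
  shows tcoord_lower: "norm (x - a) \<le> 2 * B * norm U"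
    and tcoord_le_1: "norm U \<le> 1"
    and normal_lower: "(norm (S U))\<^sup>2 - 16 * B^7 * norm U ^ 3 \<le> (norm (nrm x - nrm a))\<^sup>2"
    and normal_upper: "(norm (nrm x - nrm a))\<^sup>2 \<le> 4 * B^4 * (norm U)\<^sup>2"
    and height_expansion: "\<bar>(\<phi> x - \<phi> a) \<bullet> nrm a - (S U \<bullet> U) / 2\<bar> \<le> 22 * B^7 * norm U ^ 3"
proof -
  have B1: "1 \<le> B" and aV: "a \<in> V" and xV: "x \<in> V" and cK: "convex K" using pb a x by (auto simp: patch_bound_def)
  have b: "norm (D y v) \<le> B * norm v" "norm v \<le> B * norm (D y v)" "norm (DN y v) \<le> B * norm v"
     "norm (D y v - D z v) \<le> B * norm (y - z) * norm v"
     "norm (\<phi> y - \<phi> z) \<le> B * norm (y - z)" "norm (nrm y - nrm z) \<le> B * norm (y - z)"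
     "norm (\<phi> y - \<phi> z - D z (y - z)) \<le> B * (norm (y - z))\<^sup>2"
     "norm (nrm y - nrm z - DN z (y - z)) \<le> B * (norm (y - z))\<^sup>2"
    if "y \<in> K" "z \<in> K" for y z v
    using pb that unfolding patch_bound_def by blast+
  have linS: "linear S" and S: "\<And>v. S (tproj e1 e2 (D a v)) = - tproj e1 e2 (DN a v)"
    using sh by (auto simp: shape_operator_def)
  have nS: "norm (S w) \<le> B\<^sup>2 * norm w" for w by (rule shape_operator_bound[OF pb a fr sh])
  define k where "k = x - a"
  define h where "h = norm k"
  define r where "r = norm U"
  let ?P = "tproj e1 e2"
  have h0: "0 \<le> h" and r0: "0 \<le> r" by (auto simp: h_def r_def)
  have small': "2 * B\<^sup>2 * h \<le> 1" using small by (simp add: h_def k_def)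
  have F1: "norm (U - ?P (D a k)) \<le> B * h\<^sup>2"
  proof -
    have "U - ?P (D a k) = ?P (\<phi> x - \<phi> a - D a k)" by (simp add: U_def tcoord_def tproj_diff)
    then show ?thesis
      using norm_tproj_le[OF fr, of "\<phi> x - \<phi> a - D a k"] b(7)[OF x a] by (simp add: h_def k_def)
  qed
  have PD: "norm (?P (D a k)) = norm (D a k)" by (rule norm_tproj_D[OF aV fr])
  \<comment> \<open>Smallness makes the quadratic term B^2 h^2 at most h/2, which is absorbed on the
    left.\<close>
  have hB: "h \<le> 2 * B * r"
  proof -
    have "norm (D a k) \<le> r + B * h\<^sup>2"
      using F1 PD norm_triangle_ineq2[of "?P (D a k)" U] by (simp add: r_def norm_minus_commute)
    then have "B * norm (D a k) \<le> B * (r + B * h\<^sup>2)" using B1 by (intro mult_left_mono) auto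
    then have "h \<le> B * r + B\<^sup>2 * h\<^sup>2" using b(2)[OF a a, of k] by (simp add: h_def algebra_simps power2_eq_square)
    moreover have "2 * (B\<^sup>2 * h\<^sup>2) \<le> h" using mult_right_mono[OF small' h0] by (simp add: power2_eq_square algebra_simps)
    ultimately show ?thesis by linarith
  qed
  then show "norm (x - a) \<le> 2 * B * norm U" by (simp add: h_def r_def k_def)
  have r1: "r \<le> 1"
  proof -
    have "r \<le> B * h" using norm_tproj_le[OF fr, of "\<phi> x - \<phi> a"] b(5)[OF x a] by (simp add: r_def U_def tcoord_def h_def k_def)
    also have "\<dots> \<le> 2 * B\<^sup>2 * h" using B1 h0 by (intro mult_right_mono) (auto simp: power2_eq_square)
    finally show ?thesis using small' by simp
  qed
  then show "norm U \<le> 1" by (simp add: r_def)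
  have h2: "h\<^sup>2 \<le> 4 * B\<^sup>2 * r\<^sup>2" using power_mono[OF hB h0, of 2] by (simp add: power_mult_distrib)
  have h3: "h ^ 3 \<le> 8 * B^3 * r^3" using power_mono[OF hB h0, of 3] by (simp add: power_mult_distrib)
  have B_mono: "B ^ m \<le> B ^ n" if "m \<le> n" for m n using B1 that by (simp add: power_increasing)
  let ?W = "nrm x - nrm a"
  show "(norm ?W)\<^sup>2 \<le> 4 * B^4 * (norm U)\<^sup>2"
  proof -
    have "norm ?W \<le> B * h" using b(6)[OF x a] by (simp add: h_def k_def)
    then have "(norm ?W)\<^sup>2 \<le> (B * h)\<^sup>2" by (intro power_mono) auto
    also have "\<dots> = B\<^sup>2 * h\<^sup>2" by (simp add: power_mult_distrib)
    also have "\<dots> \<le> B\<^sup>2 * (4 * B\<^sup>2 * r\<^sup>2)" by (intro mult_left_mono h2) auto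
    finally show ?thesis by (simp add: r_def power2_eq_square power4_eq_xxxx algebra_simps)
  qed
  have dS: "norm (S U + ?P (DN a k)) \<le> B^3 * h\<^sup>2"
  proof -
    have "S U + ?P (DN a k) = S (U - ?P (D a k))" by (simp add: linear_diff[OF linS] S)
    then have "norm (S U + ?P (DN a k)) \<le> B\<^sup>2 * norm (U - ?P (D a k))" using nS by metis
    also have "\<dots> \<le> B\<^sup>2 * (B * h\<^sup>2)" by (intro mult_left_mono F1) auto
    finally show ?thesis by (simp add: power2_eq_square power3_eq_cube mult.assoc)
  qed
  show "(norm (S U))\<^sup>2 - 16 * B^7 * norm U ^ 3 \<le> (norm ?W)\<^sup>2"
  proof -
    \<comment> \<open>The tangential change of the normal is -S U up to order h^2: Taylor for the
      normal supplies the first term, linearity of S the second.\<close>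
    have "?P ?W + S U = ?P (?W - DN a k) + (S U + ?P (DN a k))" by (simp add: tproj_diff)
    then have "norm (?P ?W + S U) \<le> norm (?P (?W - DN a k)) + norm (S U + ?P (DN a k))"
      by (metis norm_triangle_ineq)
    also have "\<dots> \<le> B * h\<^sup>2 + B^3 * h\<^sup>2"
      using norm_tproj_le[OF fr, of "?W - DN a k"] b(8)[OF x a] dS by (simp add: h_def k_def)
    also have "\<dots> \<le> B^3 * h\<^sup>2 + B^3 * h\<^sup>2" using B_mono[of 1 3] by (intro add_mono mult_right_mono) auto
    finally have PW: "norm (?P ?W + S U) \<le> 2 * B^3 * h\<^sup>2" by simp
    \<comment> \<open>In the expanded square the square of the small vector is dropped, and the
      cross term with S U is of cubic order.\<close>
    have "(norm (?P ?W))\<^sup>2 = (norm (?P ?W + S U))\<^sup>2 - 2 * ((?P ?W + S U) \<bullet> S U) + (norm (S U))\<^sup>2"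
      unfolding power2_norm_eq_inner by (simp add: inner_add_left inner_add_right inner_commute)
    moreover have "(?P ?W + S U) \<bullet> S U \<le> norm (?P ?W + S U) * norm (S U)" by (rule norm_cauchy_schwarz)
    moreover have "norm (?P ?W + S U) * norm (S U) \<le> (2 * B^3 * h\<^sup>2) * (B\<^sup>2 * r)"
      using PW nS[of U] B1 by (intro mult_mono) (auto simp: r_def)
    moreover have "(2 * B^3 * h\<^sup>2) * (B\<^sup>2 * r) \<le> (2 * B^3 * (4 * B\<^sup>2 * r\<^sup>2)) * (B\<^sup>2 * r)"
      using B1 r0 by (intro mult_right_mono mult_left_mono h2) auto
    moreover have "(2 * B^3 * (4 * B\<^sup>2 * r\<^sup>2)) * (B\<^sup>2 * r) = 8 * B^7 * r^3"
      by (simp add: eval_nat_numeral)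
    moreover have "(norm (?P ?W))\<^sup>2 \<le> (norm ?W)\<^sup>2" using norm_tproj_le[OF fr, of ?W] by (intro power_mono) auto
    moreover have "0 \<le> (norm (?P ?W + S U))\<^sup>2" by simp
    ultimately show ?thesis unfolding r_def[symmetric] by linarith
  qed
  have seg: "\<bar>(\<phi> x - \<phi> a) \<bullet> nrm a + (DN a k \<bullet> D a k) / 2\<bar> \<le> 2 * B\<^sup>2 * h^3"
  proof -
    \<comment> \<open>The height along the segment from a to x, corrected by its expected quadratic
      part; \<open>?G'\<close> is its derivative, to be bounded by a multiple of h^3.\<close>
    let ?G = "\<lambda>s. (\<phi> (a + s *\<^sub>R k) - \<phi> a) \<bullet> nrm a + s\<^sup>2 * (DN a k \<bullet> D a k) / 2"
    let ?G' = "\<lambda>s. D (a + s *\<^sub>R k) k \<bullet> nrm a + s * (DN a k \<bullet> D a k)"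
    have inK: "a + s *\<^sub>R k \<in> K" if "s \<in> {0..1}" for s
    proof -
      have "a + s *\<^sub>R k = (1 - s) *\<^sub>R a + s *\<^sub>R x" by (simp add: k_def algebra_simps)
      then show ?thesis using convexD_alt[OF cK a x, of s] that by simp
    qed
    have "norm (?G 1 - ?G 0) \<le> (2 * B\<^sup>2 * h^3) * norm (1 - 0 :: real)"
    proof (rule differentiable_bound[where S = "{0..1}"])
      fix s :: real assume s: "s \<in> {0..1}"
      let ?y = "a + s *\<^sub>R k"
      have yK: "?y \<in> K" and yV: "?y \<in> V" using inK[OF s] pb by (auto simp: patch_bound_def)
      have "((\<lambda>s. \<phi> (a + s *\<^sub>R k)) has_derivative (\<lambda>d. D ?y (d *\<^sub>R k))) (at s)"
        by (rule has_derivative_compose[where f = "\<lambda>s. a + s *\<^sub>R k" and g = \<phi>, OF _ deriv[OF yV]])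
           (auto intro!: derivative_eq_intros)
      then have "((\<lambda>s. \<phi> (a + s *\<^sub>R k)) has_derivative (\<lambda>d. d *\<^sub>R D ?y k)) (at s)"
        by (simp add: linear_scale[OF linear_D[OF yV]])
      then have "(?G has_derivative (\<lambda>d. d * ?G' s)) (at s)"
        by (auto intro!: derivative_eq_intros simp: algebra_simps)
      then show "(?G has_derivative (\<lambda>d. d * ?G' s)) (at s within {0..1})" by (rule has_derivative_at_withinI)
      have s01: "0 \<le> s" "s \<le> 1" "\<bar>s\<bar> = s" using s by auto
      have hs: "norm (?y - a) = s * h" using s01 by (simp add: h_def)
      \<comment> \<open>D ?y k is orthogonal to the normal at ?y, so \<open>nrm a\<close> may be
        replaced by \<open>nrm a - nrm ?y\<close>. The linear part of this difference cancels
        against the correction up to the change of D.\<close>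
      have "?G' s = - ((nrm ?y - nrm a - DN a (?y - a)) \<bullet> D ?y k) - s * (DN a k \<bullet> (D ?y k - D a k))"
        using nrm_D[OF yV, of k]
        by (simp add: inner_diff_left inner_diff_right linear_scale[OF linear_DN[OF aV]] inner_commute[of "D ?y k"] algebra_simps)
      then have "\<bar>?G' s\<bar> \<le> \<bar>(nrm ?y - nrm a - DN a (?y - a)) \<bullet> D ?y k\<bar> + s * \<bar>DN a k \<bullet> (D ?y k - D a k)\<bar>"
        using abs_triangle_ineq4[of "- ((nrm ?y - nrm a - DN a (?y - a)) \<bullet> D ?y k)" "s * (DN a k \<bullet> (D ?y k - D a k))"]
        by (simp only: abs_minus_cancel abs_mult s01(3))
      also have "\<dots> \<le> B * h\<^sup>2 * (B * h) + 1 * (B * h * (B * h * h))"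
      proof (intro add_mono mult_mono)
        have sh: "s * h \<le> h" "0 \<le> s * h" using s01 h0 by (auto simp: mult_left_le_one_le)
        have "norm (nrm ?y - nrm a - DN a (?y - a)) \<le> B * (s * h)\<^sup>2" using b(8)[OF yK a] hs by simp
        also have "\<dots> \<le> B * h\<^sup>2" using B1 sh by (intro mult_left_mono power_mono) auto
        finally have "norm (nrm ?y - nrm a - DN a (?y - a)) \<le> B * h\<^sup>2" .
        then show "\<bar>(nrm ?y - nrm a - DN a (?y - a)) \<bullet> D ?y k\<bar> \<le> B * h\<^sup>2 * (B * h)"
          using b(1)[OF yK yK, of k] B1 h0
          by (intro order_trans[OF Cauchy_Schwarz_ineq2] mult_mono) (auto simp: h_def)
        have "norm (D ?y k - D a k) \<le> B * (s * h) * h" using b(4)[OF yK a, of k] unfolding hs h_def .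
        also have "\<dots> \<le> B * h * h" using B1 sh h0 by (intro mult_left_mono mult_right_mono) auto
        finally show "\<bar>DN a k \<bullet> (D ?y k - D a k)\<bar> \<le> B * h * (B * h * h)"
          using b(3)[OF a a, of k] B1 h0
          by (intro order_trans[OF Cauchy_Schwarz_ineq2] mult_mono) (auto simp: h_def)
      qed (use s01 in auto)
      also have "\<dots> = 2 * B\<^sup>2 * h^3" by (simp add: power2_eq_square power3_eq_cube)
      finally have "\<bar>?G' s\<bar> \<le> 2 * B\<^sup>2 * h^3" .
      then show "onorm (\<lambda>d. d * ?G' s) \<le> 2 * B\<^sup>2 * h^3"
        using h0 by (intro onorm_bound) (auto simp: abs_mult mult.commute intro!: mult_left_mono)
    qed auto
    then show ?thesis by (simp add: k_def)
  qed
  \<comment> \<open>The segment contributes 16 B^7 r^3 and the passage from DN a k to S U half of 12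
    B^7 r^3, which gives 22.\<close>
  show "\<bar>(\<phi> x - \<phi> a) \<bullet> nrm a - (S U \<bullet> U) / 2\<bar> \<le> 22 * B^7 * norm U ^ 3"
  proof -
    have "DN a k \<bullet> D a k = ?P (DN a k) \<bullet> ?P (D a k)"
      using inner_tproj[OF fr, of "DN a k" "D a k"] nrm_D[OF aV, of k] by (simp add: inner_commute[of _ "nrm a"])
    then have "DN a k \<bullet> D a k + S U \<bullet> U = (S U + ?P (DN a k)) \<bullet> ?P (D a k) + S U \<bullet> (U - ?P (D a k))"
      by (simp add: inner_add_left inner_diff_right)
    then have "\<bar>DN a k \<bullet> D a k + S U \<bullet> U\<bar> \<le> \<bar>(S U + ?P (DN a k)) \<bullet> ?P (D a k)\<bar> + \<bar>S U \<bullet> (U - ?P (D a k))\<bar>"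
      by (simp add: abs_triangle_ineq)
    also have "\<dots> \<le> B^3 * h\<^sup>2 * (B * h) + B\<^sup>2 * r * (B * h\<^sup>2)"
    proof (intro add_mono order_trans[OF Cauchy_Schwarz_ineq2] mult_mono)
      show "norm (?P (D a k)) \<le> B * h" unfolding PD using b(1)[OF a a] by (simp add: h_def)
      show "norm (S U) \<le> B\<^sup>2 * r" using nS by (simp add: r_def)
    qed (use dS F1 B1 h0 r0 in auto)
    also have "\<dots> = B^4 * h^3 + B^3 * (h\<^sup>2 * r)" by (simp add: eval_nat_numeral)
    also have "\<dots> \<le> B^4 * (8 * B^3 * r^3) + B^3 * ((4 * B\<^sup>2 * r\<^sup>2) * r)"
      using B1 r0 by (intro add_mono mult_left_mono mult_right_mono h2 h3) auto
    also have "\<dots> = 8 * B^7 * r^3 + 4 * B^5 * r^3" by (simp add: eval_nat_numeral)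
    also have "\<dots> \<le> 8 * B^7 * r^3 + 4 * B^7 * r^3"
      using B_mono[of 5 7] r0 B1 by (intro add_mono mult_right_mono) auto
    finally have 1: "\<bar>DN a k \<bullet> D a k + S U \<bullet> U\<bar> \<le> 12 * B^7 * r^3" by (simp add: mult_ac)
    have "2 * B\<^sup>2 * h^3 \<le> 2 * B\<^sup>2 * (8 * B^3 * r^3)" by (intro mult_left_mono h3) auto
    also have "\<dots> = 16 * B^5 * r^3" by (simp add: eval_nat_numeral)
    also have "\<dots> \<le> 16 * B^7 * r^3" using B_mono[of 5 7] r0 B1 by (intro mult_right_mono) auto
    finally show ?thesis using seg 1 unfolding r_def[symmetric] by linarith
  qed
qed

end

text \<open>The numbers stand for r = |u|, \<sigma> = |S u|, q = S u . u, s = the squared change of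
  the normal and g = the height, so that 1 - s/2 is the cosine. Linear lower bounds for exp(-y) and
  1/(1 - s/2) are multiplied. The power B^18 comes from 2 * 7 + 4 in the product of g^2 and
  s.\<close>

lemma exp_cos_lower:
  fixes B r \<sigma> q s g t :: real
  assumes B: "1 \<le> B" and r: "0 \<le> r" "r \<le> 1" and q: "\<bar>q\<bar> \<le> B\<^sup>2 * r\<^sup>2"
    and s: "\<sigma>\<^sup>2 - 16 * B^7 * r^3 \<le> s" "0 \<le> s" "s \<le> 4 * B^4 * r\<^sup>2" "s < 2"
    and g: "\<bar>g - q / 2\<bar> \<le> 22 * B^7 * r^3" and t: "0 < t"
  shows "1 + \<sigma>\<^sup>2 / 2 - q\<^sup>2 / (8 * t) - 1000 * B^18 * (r^3 + r^5 / t) \<le> exp (- g\<^sup>2 / (2 * t)) / (1 - s / 2)"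
proof -
  have B_mono: "B ^ m \<le> B ^ n" if "m \<le> n" for m n using B that by (simp add: power_increasing)
  have Bp: "0 \<le> B ^ m" for m using B by simp
  have rle: "r^3 \<le> r\<^sup>2" "r^6 \<le> r^5" using r by (auto intro: power_decreasing)
  have q': "\<bar>q\<bar> \<le> B^7 * r\<^sup>2"
    using q mult_right_mono[OF B_mono[of 2 7], of "r\<^sup>2"] by simp
  have r3: "22 * B^7 * r^3 \<le> 22 * B^7 * r\<^sup>2" using rle B by (intro mult_left_mono) auto
  have gp: "\<bar>g + q / 2\<bar> \<le> 23 * B^7 * r\<^sup>2" "\<bar>g\<bar> \<le> 23 * B^7 * r\<^sup>2" using g q' r3 by linarith+
  \<comment> \<open>As a difference of squares the error is a cubic factor times a quadratic one,
    hence of order r^5.\<close>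
  have "g\<^sup>2 - q\<^sup>2 / 4 = (g - q / 2) * (g + q / 2)" by (simp add: power2_eq_square algebra_simps)
  also have "\<dots> \<le> \<bar>g - q / 2\<bar> * \<bar>g + q / 2\<bar>" by (metis abs_ge_self abs_mult)
  also have "\<dots> \<le> (22 * B^7 * r^3) * (23 * B^7 * r\<^sup>2)" using g gp B r by (intro mult_mono) auto
  also have "\<dots> = 506 * B^14 * r^5" by (simp add: eval_nat_numeral)
  also have "\<dots> \<le> 506 * B^18 * r^5" using B_mono[of 14 18] r by (intro mult_right_mono mult_left_mono) auto
  finally have g1: "g\<^sup>2 \<le> q\<^sup>2 / 4 + 506 * B^18 * r^5" by simp
  have "g\<^sup>2 \<le> (23 * B^7 * r\<^sup>2)\<^sup>2" using power_mono[OF gp(2) abs_ge_zero, of 2] by simp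
  then have "g\<^sup>2 * s \<le> (23 * B^7 * r\<^sup>2)\<^sup>2 * (4 * B^4 * r\<^sup>2)" using s by (intro mult_mono) auto
  also have "\<dots> = 2116 * B^18 * r^6" by (simp add: eval_nat_numeral)
  also have "\<dots> \<le> 2116 * B^18 * r^5" using rle B by (intro mult_left_mono) auto
  finally have g2: "g\<^sup>2 * s \<le> 2116 * B^18 * r^5" .
  define y where "y = g\<^sup>2 / (2 * t)"
  have y1: "y \<le> q\<^sup>2 / (8 * t) + 253 * (B^18 * r^5 / t)"
    unfolding y_def using g1 t by (simp add: field_simps)
  have y2: "y * s / 2 \<le> 529 * (B^18 * r^5 / t)"
    unfolding y_def using g2 t by (simp add: field_simps)
  have s1: "\<sigma>\<^sup>2 / 2 - 8 * (B^18 * r^3) \<le> s / 2"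
    using s(1) mult_right_mono[OF B_mono[of 7 18], of "r^3"] r by simp
  have nn: "0 \<le> B^18 * r^3" "0 \<le> B^18 * r^5 / t" using Bp r t by auto
  \<comment> \<open>The errors add up to 253 + 529 in r^5 / t and 8 in r^3; the constant 1000 covers
    both.\<close>
  have "1 + \<sigma>\<^sup>2 / 2 - q\<^sup>2 / (8 * t) - 1000 * B^18 * (r^3 + r^5 / t)
      = 1 + \<sigma>\<^sup>2 / 2 - q\<^sup>2 / (8 * t) - 1000 * (B^18 * r^3) - 1000 * (B^18 * r^5 / t)"
    by (simp add: algebra_simps)
  also have "\<dots> \<le> 1 + s / 2 - y - y * s / 2" using y1 y2 s1 nn by linarith
  also have "\<dots> = (1 - y) * (1 + s / 2)" by (simp add: field_simps)
  also have "\<dots> \<le> exp (- y) * (1 + s / 2)"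
    using exp_ge_add_one_self[of "- y"] s by (intro mult_right_mono) auto
  also have "\<dots> \<le> exp (- y) * (1 / (1 - s / 2))"
  proof (intro mult_left_mono)
    have "(1 + s / 2) * (1 - s / 2) \<le> 1" by (simp add: algebra_simps)
    then show "1 + s / 2 \<le> 1 / (1 - s / 2)" using s by (simp add: le_divide_eq)
  qed simp
  finally show ?thesis by (simp add: y_def)
qed

section \<open>Gaussian integrals over a patch\<close>

text \<open>Identifies Lebesgue measure on \<open>real^2\<close> with the product measure, so that
  Gaussian integrals split into one-variable moments.\<close>

lemma lborel_real2:
  "(lborel :: (real^2) measure) = distr (lborel \<Otimes>\<^sub>M lborel) borel (\<lambda>p. vector [fst p, snd p])"
proof (rule lborel_eqI)
  have m [measurable]: "(\<lambda>p::real\<times>real. vector [fst p, snd p] :: real^2) \<in> borel_measurable borel"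
  proof (rule borel_measurable_continuous_onI)
    have "(\<lambda>p::real\<times>real. vector [fst p, snd p] :: real^2) = (\<lambda>p. fst p *\<^sub>R axis 1 1 + snd p *\<^sub>R axis 2 1)"
      by (simp add: fun_eq_iff vec_eq_iff forall_2 axis_def)
    then show "continuous_on UNIV (\<lambda>p::real\<times>real. vector [fst p, snd p] :: real^2)"
      by (simp only:) (intro continuous_intros)
  qed
  fix l u :: "real^2" assume le: "\<And>b. b \<in> Basis \<Longrightarrow> l \<bullet> b \<le> u \<bullet> b"
  have lu: "l $ i \<le> u $ i" for i
    using le[of "axis i 1"] by (simp add: inner_axis axis_in_Basis_iff)
  have "emeasure (distr (lborel \<Otimes>\<^sub>M lborel) borel (\<lambda>p. vector [fst p, snd p])) (box l u)
      = emeasure (lborel \<Otimes>\<^sub>M lborel) ({l$1<..<u$1} \<times> {l$2<..<u$2})"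
    by (subst emeasure_distr) (auto simp: lborel_prod space_pair_measure mem_box_cart forall_2 intro!: arg_cong[where f = "emeasure lborel"])
  also have "\<dots> = ennreal (u$1 - l$1) * ennreal (u$2 - l$2)"
    using lu by (subst lborel.emeasure_pair_measure_Times) auto
  also have "\<dots> = ennreal (\<Prod>b\<in>Basis. (u - l) \<bullet> b)"
  proof -
    have "(\<Prod>b\<in>Basis. (u - l) \<bullet> b) = (\<Prod>i\<in>UNIV. (u - l) $ i)"
      by (rule prod.reindex_bij_witness[of _ "\<lambda>i. axis i 1" "\<lambda>b. SOME i. b = axis i 1"])
         (auto simp: inner_axis axis_in_Basis_iff Basis_vec_def axis_eq_axis)
    then show ?thesis using lu by (simp add: UNIV_2 ennreal_mult)
  qed
  finally show "emeasure (distr (lborel \<Otimes>\<^sub>M lborel) borel (\<lambda>p. vector [fst p, snd p])) (box l u)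
     = ennreal (\<Prod>b\<in>Basis. (u - l) \<bullet> b)" .
qed simp

lemma has_bochner_integral_real2_prod:
  fixes f g :: "real \<Rightarrow> real"
  assumes f: "has_bochner_integral lborel f a" and g: "has_bochner_integral lborel g b"
  shows "has_bochner_integral lborel (\<lambda>w::real^2. f (w$1) * g (w$2)) (a * b)"
proof -
  have [measurable]: "f \<in> borel_measurable borel" "g \<in> borel_measurable borel"
    using f g by (auto simp: has_bochner_integral_iff dest: borel_measurable_integrable)
  have i: "integrable lborel f" "integral\<^sup>L lborel f = a" "integrable lborel g" "integral\<^sup>L lborel g = b"
    using f g by (auto simp: has_bochner_integral_iff)
  have int: "integrable (lborel \<Otimes>\<^sub>M lborel) (\<lambda>p. f (fst p) * g (snd p))"
    by (rule lborel_pair.Fubini_integrable) (use i in \<open>auto simp: abs_mult\<close>)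
  have eq: "integral\<^sup>L (lborel \<Otimes>\<^sub>M lborel) (\<lambda>p. f (fst p) * g (snd p)) = a * b"
    using lborel_pair.integral_fst'[OF int] i by simp
  have m: "(\<lambda>p::real\<times>real. vector [fst p, snd p] :: real^2) \<in> measurable (lborel \<Otimes>\<^sub>M lborel) borel"
  proof -
    have "(\<lambda>p::real\<times>real. vector [fst p, snd p] :: real^2) = (\<lambda>p. fst p *\<^sub>R axis 1 1 + snd p *\<^sub>R axis 2 1)"
      by (simp add: fun_eq_iff vec_eq_iff forall_2 axis_def)
    then show ?thesis by simp
  qed
  have [measurable]: "(\<lambda>w::real^2. f (w$1) * g (w$2)) \<in> borel_measurable borel"
    by measurable
  show ?thesis
    unfolding has_bochner_integral_iff
    by (subst (1 2) lborel_real2) (use int eq in \<open>simp add: integrable_distr_eq[OF m] integral_distr[OF m]\<close>)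
qed

definition gmon :: "nat \<Rightarrow> nat \<Rightarrow> real^2 \<Rightarrow> real" where
  "gmon i j w = exp (- (norm w)\<^sup>2 / 2) * (w$1 ^ i * w$2 ^ j)"

definition nmom :: "nat \<Rightarrow> real" where
  "nmom k = integral\<^sup>L lborel (\<lambda>x. std_normal_density x * x ^ k)"

lemma has_bochner_integral_gmon: "has_bochner_integral lborel (gmon i j) (2 * pi * nmom i * nmom j)"
proof -
  have "has_bochner_integral lborel (\<lambda>x. std_normal_density x * x ^ k) (nmom k)" for k
    unfolding nmom_def by (intro has_bochner_integral_integrable integrable_std_normal_moment)
  from has_bochner_integral_mult_right[OF has_bochner_integral_real2_prod[OF this[of i] this[of j]], of "2 * pi"]
  have "has_bochner_integral lborel (\<lambda>w::real^2. 2 * pi * (std_normal_density (w$1) * w$1 ^ i * (std_normal_density (w$2) * w$2 ^ j))) (2 * pi * (nmom i * nmom j))"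
    by simp
  moreover have "2 * pi * (std_normal_density (w$1) * w$1 ^ i * (std_normal_density (w$2) * w$2 ^ j)) = gmon i j w" for w :: "real^2"
  proof -
    have n: "(norm w)\<^sup>2 = (w$1)\<^sup>2 + (w$2)\<^sup>2" by (simp add: norm_vec_def L2_set_def sum_2)
    have "exp (- (norm w)\<^sup>2 / 2) = exp (- (w$1)\<^sup>2 / 2) * exp (- (w$2)\<^sup>2 / 2)"
      unfolding n by (simp add: exp_add[symmetric] add_divide_distrib)
    moreover have "sqrt (2 * pi) * sqrt (2 * pi) = 2 * pi" by simp
    ultimately show ?thesis
      by (simp add: gmon_def std_normal_density_def)
  qed
  ultimately show ?thesis by (simp add: mult.assoc)
qed

lemma nmom_simps: "nmom 0 = 1" "nmom (Suc 0) = 0" "nmom 1 = 0" "nmom 2 = 1" "nmom 3 = 0" "nmom 4 = 3" "nmom 6 = 15"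
  using integral_std_normal_moment_even[of 0] integral_std_normal_moment_even[of 1]
    integral_std_normal_moment_even[of 2] integral_std_normal_moment_even[of 3]
    integral_std_normal_moment_odd[of 0] integral_std_normal_moment_odd[of 1]
  by (simp_all add: nmom_def fact_numeral)

text \<open>For symmetric \<open>S\<close> this is the squared difference of the eigenvalues; the form chosen vanishes
  exactly on multiples of the identity even if symmetry of \<open>S\<close> is not known.\<close>
definition umbilic_defect :: "(real^2 \<Rightarrow> real^2) \<Rightarrow> real" where
  "umbilic_defect S = (let a = S (axis 1 1) $ 1; b = S (axis 2 1) $ 1; c = S (axis 1 1) $ 2; d = S (axis 2 1) $ 2
     in (a - d)\<^sup>2 + (b - c)\<^sup>2 + 2 * b\<^sup>2 + 2 * c\<^sup>2)"

lemma umbilic_defect_nonneg: "0 \<le> umbilic_defect S"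
  by (simp add: umbilic_defect_def Let_def)

lemma umbilic_defect_eq_0:
  assumes "linear S" "umbilic_defect S = 0"
  shows "\<exists>k. \<forall>w. S w = k *\<^sub>R w"
proof -
  let ?a = "S (axis 1 1) $ 1" and ?b = "S (axis 2 1) $ 1" and ?c = "S (axis 1 1) $ 2" and ?d = "S (axis 2 1) $ 2"
  have *: "(?a - ?d)\<^sup>2 + (?b - ?c)\<^sup>2 + 2 * ?b\<^sup>2 + 2 * ?c\<^sup>2 = 0"
    using assms(2) by (simp add: umbilic_defect_def Let_def)
  have "(?a - ?d)\<^sup>2 = 0 \<and> ?b\<^sup>2 = 0 \<and> ?c\<^sup>2 = 0"
    using * zero_le_power2[of "?a - ?d"] zero_le_power2[of "?b - ?c"] zero_le_power2[of ?b] zero_le_power2[of ?c]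
    by linarith
  then have "?d = ?a" "?b = 0" "?c = 0" by auto
  then have "S w = ?a *\<^sub>R w" for w
    by (subst linear_real2[OF assms(1)]) (simp add: vec_eq_iff forall_2)
  then show ?thesis by blast
qed

text \<open>For S with matrix rows (a, b) and (c, d) the normal means are E |S w|^2 = a^2 + b^2 +
  c^2 + d^2 and E (S w . w)^2 = 3 a^2 + 3 d^2 + (b + c)^2 + 2 a d. Half the first minus an eighth of
  the second is \<open>umbilic_defect S / 8\<close>, the origin of that form. Since E |w|^4 = 8 and
  E |w|^6 = 48, the error weighs 2 + 8 + 48 = 58.\<close>

lemma gaussian_expansion:
  assumes "linear S"
  shows "has_bochner_integral lborel (\<lambda>w::real^2. exp (- (norm w)\<^sup>2 / 2) *
     (1 + t * ((norm (S w))\<^sup>2 / 2 - (S w \<bullet> w)\<^sup>2 / 8) - \<kappa> * (2 + norm w ^ 4 + norm w ^ 6)))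
     (2 * pi * (1 + t / 8 * umbilic_defect S - 58 * \<kappa>))"
proof -
  define a b c d where abcd: "a = S (axis 1 1) $ 1" "b = S (axis 2 1) $ 1" "c = S (axis 1 1) $ 2" "d = S (axis 2 1) $ 2"
  have Sw: "S w $ 1 = a * w$1 + b * w$2" "S w $ 2 = c * w$1 + d * w$2" for w
    by (subst linear_real2[OF assms], simp add: abcd)+
  let ?E = "\<lambda>w::real^2. exp (- (norm w)\<^sup>2 / 2)"
  let ?m = "\<lambda>i j. 2 * pi * nmom i * nmom j"
  have hb: "has_bochner_integral lborel (\<lambda>w.
      (1 - 2 * \<kappa>) * gmon 0 0 w + (t / 2) * ((a\<^sup>2 + c\<^sup>2) * gmon 2 0 w + 2 * (a * b + c * d) * gmon 1 1 w + (b\<^sup>2 + d\<^sup>2) * gmon 0 2 w)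
      + (- t / 8) * (a\<^sup>2 * gmon 4 0 w + 2 * a * (b + c) * gmon 3 1 w + ((b + c)\<^sup>2 + 2 * a * d) * gmon 2 2 w
          + 2 * (b + c) * d * gmon 1 3 w + d\<^sup>2 * gmon 0 4 w)
      + (- \<kappa>) * (gmon 4 0 w + 2 * gmon 2 2 w + gmon 0 4 w)
      + (- \<kappa>) * (gmon 6 0 w + 3 * gmon 4 2 w + 3 * gmon 2 4 w + gmon 0 6 w))
     ((1 - 2 * \<kappa>) * ?m 0 0 + (t / 2) * ((a\<^sup>2 + c\<^sup>2) * ?m 2 0 + 2 * (a * b + c * d) * ?m 1 1 + (b\<^sup>2 + d\<^sup>2) * ?m 0 2)
      + (- t / 8) * (a\<^sup>2 * ?m 4 0 + 2 * a * (b + c) * ?m 3 1 + ((b + c)\<^sup>2 + 2 * a * d) * ?m 2 2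
          + 2 * (b + c) * d * ?m 1 3 + d\<^sup>2 * ?m 0 4)
      + (- \<kappa>) * (?m 4 0 + 2 * ?m 2 2 + ?m 0 4)
      + (- \<kappa>) * (?m 6 0 + 3 * ?m 4 2 + 3 * ?m 2 4 + ?m 0 6))" (is "has_bochner_integral _ ?F ?I")
    by (intro has_bochner_integral_add has_bochner_integral_mult_right has_bochner_integral_gmon)
  have eqI: "?I = 2 * pi * (1 + t / 8 * umbilic_defect S - 58 * \<kappa>)"
    by (simp add: nmom_simps umbilic_defect_def Let_def abcd[symmetric] power2_eq_square field_simps)
  have eqF: "?F w = ?E w * (1 + t * ((norm (S w))\<^sup>2 / 2 - (S w \<bullet> w)\<^sup>2 / 8) - \<kappa> * (2 + norm w ^ 4 + norm w ^ 6))" for w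
  proof -
    have n: "(norm v)\<^sup>2 = (v$1)\<^sup>2 + (v$2)\<^sup>2" for v :: "real^2" by (simp add: norm_vec_def L2_set_def sum_2)
    have n4: "norm w ^ 4 = ((w$1)\<^sup>2 + (w$2)\<^sup>2)\<^sup>2" unfolding n[symmetric] by simp
    have n6: "norm w ^ 6 = ((w$1)\<^sup>2 + (w$2)\<^sup>2) ^ 3" unfolding n[symmetric] by simp
    have inn: "S w \<bullet> w = S w $ 1 * w$1 + S w $ 2 * w$2" by (simp add: inner_vec_def sum_2)
    have g: "gmon i j w = ?E w * (w$1 ^ i * w$2 ^ j)" for i j by (simp add: gmon_def)
    define X Y e where "X = w$1" "Y = w$2" "e = ?E w"
    have fin: "(1 - 2 * \<kappa>) * (e * (X^0 * Y^0)) + (t / 2) * ((a\<^sup>2 + c\<^sup>2) * (e * (X^2 * Y^0)) + 2 * (a * b + c * d) * (e * (X^1 * Y^1)) + (b\<^sup>2 + d\<^sup>2) * (e * (X^0 * Y^2)))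
      + (- t / 8) * (a\<^sup>2 * (e * (X^4 * Y^0)) + 2 * a * (b + c) * (e * (X^3 * Y^1)) + ((b + c)\<^sup>2 + 2 * a * d) * (e * (X^2 * Y^2))
          + 2 * (b + c) * d * (e * (X^1 * Y^3)) + d\<^sup>2 * (e * (X^0 * Y^4)))
      + (- \<kappa>) * (e * (X^4 * Y^0) + 2 * (e * (X^2 * Y^2)) + e * (X^0 * Y^4))
      + (- \<kappa>) * (e * (X^6 * Y^0) + 3 * (e * (X^4 * Y^2)) + 3 * (e * (X^2 * Y^4)) + e * (X^0 * Y^6))
      = e * (1 + t * (((a * X + b * Y)\<^sup>2 + (c * X + d * Y)\<^sup>2) / 2 - ((a * X + b * Y) * X + (c * X + d * Y) * Y)\<^sup>2 / 8)
         - \<kappa> * (2 + (X\<^sup>2 + Y\<^sup>2)\<^sup>2 + (X\<^sup>2 + Y\<^sup>2) ^ 3))"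
      by (simp add: eval_nat_numeral field_simps)
    show ?thesis
      unfolding g n4 n6 n[of "S w"] inn Sw X_Y_e_def[symmetric] fin ..
  qed
  show ?thesis using hb unfolding eqI eqF .
qed

text \<open>The integrand may be negative; \<open>ennreal\<close> truncates it at 0, which only
  enlarges the right-hand side.\<close>

lemma ennreal_integral_le_nn_integral:
  fixes f :: "'a \<Rightarrow> real"
  assumes "integrable M f"
  shows "ennreal (integral\<^sup>L M f) \<le> (\<integral>\<^sup>+x. ennreal (f x) \<partial>M)"
proof -
  have "integral\<^sup>L M f \<le> integral\<^sup>L M (\<lambda>x. max 0 (f x))"
    using assms by (intro integral_mono) auto
  then have "ennreal (integral\<^sup>L M f) \<le> ennreal (integral\<^sup>L M (\<lambda>x. max 0 (f x)))" by (rule ennreal_leI)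
  also have "\<dots> = (\<integral>\<^sup>+x. ennreal (max 0 (f x)) \<partial>M)"
    using assms by (intro nn_integral_eq_integral[symmetric]) auto
  also have "\<dots> = (\<integral>\<^sup>+x. ennreal (f x) \<partial>M)" by (intro nn_integral_cong) (simp add: ennreal_neg max_def)
  finally show ?thesis .
qed

lemma nn_integral_real2_scale:
  fixes f :: "real^2 \<Rightarrow> ennreal"
  assumes [measurable]: "f \<in> borel_measurable borel" and t: "0 < t"
  shows "(\<integral>\<^sup>+u. f u \<partial>lborel) = ennreal t * (\<integral>\<^sup>+w. f (sqrt t *\<^sub>R w) \<partial>lborel)"
proof -
  have "(\<integral>\<^sup>+u. f u \<partial>lborel) = (\<integral>\<^sup>+u. f u \<partial>density (distr lborel borel (\<lambda>x. 0 + sqrt t *\<^sub>R x)) (\<lambda>_. ennreal (\<bar>sqrt t\<bar>^DIM(real^2))))"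
    using t by (subst lborel_affine[symmetric]) auto
  also have "\<dots> = (\<integral>\<^sup>+w. ennreal (\<bar>sqrt t\<bar>^DIM(real^2)) * f (sqrt t *\<^sub>R w) \<partial>lborel)"
    by (subst nn_integral_density) (auto simp: nn_integral_distr)
  also have "\<bar>sqrt t\<bar>^DIM(real^2) = t" using t by simp
  finally show ?thesis by (simp add: nn_integral_cmult)
qed

lemma gaussian_nn_integral:
  assumes "0 < t"
  shows "(\<integral>\<^sup>+u. ennreal (exp (- (norm u)\<^sup>2 / (2 * t))) \<partial>(lborel :: (real^2) measure)) = ennreal (2 * pi * t)"
proof -
  have "(\<integral>\<^sup>+u. ennreal (exp (- (norm u)\<^sup>2 / (2 * t))) \<partial>(lborel :: (real^2) measure))
      = ennreal t * (\<integral>\<^sup>+w. ennreal (exp (- (norm (sqrt t *\<^sub>R w))\<^sup>2 / (2 * t))) \<partial>(lborel :: (real^2) measure))"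
    using assms by (intro nn_integral_real2_scale) auto
  also have "(\<integral>\<^sup>+w. ennreal (exp (- (norm (sqrt t *\<^sub>R w))\<^sup>2 / (2 * t))) \<partial>(lborel :: (real^2) measure)) = (\<integral>\<^sup>+w. ennreal (gmon 0 0 w) \<partial>lborel)"
    using assms by (intro nn_integral_cong) (simp add: gmon_def power_mult_distrib)
  also have "\<dots> = ennreal (2 * pi)"
    using has_bochner_integral_gmon[of 0 0]
    by (subst nn_integral_eq_integral) (auto simp: has_bochner_integral_iff nmom_simps, simp add: gmon_def)
  finally show ?thesis using assms by (simp add: ennreal_mult[symmetric] mult.commute)
qed

text \<open>Under u = sqrt t w the error terms scale by t^(3/2) and the area by t, giving t^(5/2);
  the constant 116 is 2 * 58.\<close>

lemma gaussian_nn_integral_lower: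
  assumes S: "linear S" and t: "0 < t" and C: "0 \<le> C"
  shows "ennreal (2 * pi * t * (1 + t / 8 * umbilic_defect S) - 116 * pi * C * (t\<^sup>2 * sqrt t)) \<le>
    (\<integral>\<^sup>+u. ennreal (exp (- (norm u)\<^sup>2 / (2 * t)) *
       (1 + (norm (S u))\<^sup>2 / 2 - (S u \<bullet> u)\<^sup>2 / (8 * t) - C * (norm u ^ 3 + norm u ^ 5 / t))) \<partial>lborel)"
proof -
  let ?f = "\<lambda>u. exp (- (norm u)\<^sup>2 / (2 * t)) *
       (1 + (norm (S u))\<^sup>2 / 2 - (S u \<bullet> u)\<^sup>2 / (8 * t) - C * (norm u ^ 3 + norm u ^ 5 / t))"
  let ?g = "\<lambda>w::real^2. exp (- (norm w)\<^sup>2 / 2) *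
     (1 + t * ((norm (S w))\<^sup>2 / 2 - (S w \<bullet> w)\<^sup>2 / 8) - (C * (t * sqrt t)) * (2 + norm w ^ 4 + norm w ^ 6))"
  have bS: "bounded_linear S" using S linear_conv_bounded_linear by blast
  have [measurable]: "S \<in> borel_measurable borel"
    by (intro borel_measurable_continuous_onI linear_continuous_on bS)
  have gI: "has_bochner_integral lborel ?g (2 * pi * (1 + t / 8 * umbilic_defect S - 58 * (C * (t * sqrt t))))"
    by (rule gaussian_expansion[OF S])
  have le: "?g w \<le> ?f (sqrt t *\<^sub>R w)" for w
  proof -
    \<comment> \<open>Odd powers of the norm are traded for even ones, whose Gaussian integrals are
      polynomial moments.\<close>
    have aux: "x ^ 3 + x ^ 5 \<le> 2 + x ^ 4 + x ^ 6" if "0 \<le> x" for x :: real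
    proof (cases "x \<le> 1")
      case True
      then have "x ^ 3 \<le> 1" "x ^ 5 \<le> 1" using that by (auto intro: power_le_one)
      moreover have "0 \<le> x ^ 4" "0 \<le> x ^ 6" using that by auto
      ultimately show ?thesis by linarith
    next
      case False
      then have "x ^ 3 \<le> x ^ 4" "x ^ 5 \<le> x ^ 6" by (auto intro: power_increasing)
      then show ?thesis by linarith
    qed
    have st: "sqrt t ^ 2 = t" "sqrt t ^ 3 = t * sqrt t" "sqrt t ^ 5 / t = t * sqrt t"
      using t by (auto simp: eval_nat_numeral)
    have "?f (sqrt t *\<^sub>R w) = exp (- (norm w)\<^sup>2 / 2) * (1 + t * ((norm (S w))\<^sup>2 / 2 - (S w \<bullet> w)\<^sup>2 / 8)
        - (C * (t * sqrt t)) * (norm w ^ 3 + norm w ^ 5))"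
    proof -
      have n1: "norm (sqrt t *\<^sub>R w) = sqrt t * norm w" using t by simp
      have n2: "norm (S (sqrt t *\<^sub>R w)) = sqrt t * norm (S w)" using t by (simp add: linear_scale[OF S])
      have n3: "S (sqrt t *\<^sub>R w) \<bullet> (sqrt t *\<^sub>R w) = t * (S w \<bullet> w)"
        using t by (simp add: linear_scale[OF S] mult.assoc[symmetric])
      have n4: "(sqrt t * norm w) ^ 3 + (sqrt t * norm w) ^ 5 / t = (t * sqrt t) * (norm w ^ 3 + norm w ^ 5)"
      proof -
        have "(sqrt t * norm w) ^ 5 / t = (sqrt t ^ 5 / t) * norm w ^ 5" by (simp add: power_mult_distrib)
        then show ?thesis unfolding st(3) by (simp add: power_mult_distrib st(2) algebra_simps)
      qed
      have n5: "(sqrt t * norm (S w))\<^sup>2 / 2 - (t * (S w \<bullet> w))\<^sup>2 / (8 * t) = t * ((norm (S w))\<^sup>2 / 2 - (S w \<bullet> w)\<^sup>2 / 8)"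
        using t by (simp add: power_mult_distrib power2_eq_square field_simps)
      have n6: "- (sqrt t * norm w)\<^sup>2 / (2 * t) = - (norm w)\<^sup>2 / 2" using t by (simp add: power_mult_distrib)
      show ?thesis
        by (simp only: n1 n2 n3 n4 n6 add_diff_eq[symmetric] n5 mult.assoc)
    qed
    moreover have "(C * (t * sqrt t)) * (norm w ^ 3 + norm w ^ 5) \<le> (C * (t * sqrt t)) * (2 + norm w ^ 4 + norm w ^ 6)"
      using C t aux[of "norm w"] by (intro mult_left_mono) auto
    ultimately show ?thesis by (simp add: mult_left_mono)
  qed
  have "ennreal (2 * pi * (1 + t / 8 * umbilic_defect S - 58 * (C * (t * sqrt t)))) \<le> (\<integral>\<^sup>+w. ennreal (?g w) \<partial>lborel)"
    using ennreal_integral_le_nn_integral[of lborel ?g] gI by (simp add: has_bochner_integral_iff)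
  also have "\<dots> \<le> (\<integral>\<^sup>+w. ennreal (?f (sqrt t *\<^sub>R w)) \<partial>lborel)"
    by (intro nn_integral_mono ennreal_leI le)
  finally have "ennreal t * ennreal (2 * pi * (1 + t / 8 * umbilic_defect S - 58 * (C * (t * sqrt t))))
      \<le> ennreal t * (\<integral>\<^sup>+w. ennreal (?f (sqrt t *\<^sub>R w)) \<partial>lborel)" by (rule mult_left_mono) simp
  also have "\<dots> = (\<integral>\<^sup>+u. ennreal (?f u) \<partial>lborel)"
    using t by (intro nn_integral_real2_scale[symmetric]) auto
  finally show ?thesis
    using t by (simp add: ennreal_mult'[symmetric] power2_eq_square algebra_simps)
qed

section \<open>Tangent coordinates at finite scale and Gaussian bounds\<close>

context surface_patch
begin

text \<open>A quantitative form of injectivity: the projected increment is that of D a up to an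
  error which the smallness hypothesis makes at most half of the main term.\<close>

lemma tcoord_separation:
  assumes pb: "patch_bound K B" and K: "a \<in> K" "x \<in> K" "y \<in> K" and fr: "oframe e1 e2 (nrm a)"
    and small: "2 * B\<^sup>2 * (norm (x - y) + norm (y - a)) \<le> 1"
  shows "norm (x - y) \<le> 2 * B * norm (tcoord e1 e2 a x - tcoord e1 e2 a y)"
proof -
  let ?v = "x - y" and ?P = "tproj e1 e2"
  have B1: "1 \<le> B" and aV: "a \<in> V" using pb K by (auto simp: patch_bound_def)
  have b1: "norm ?v \<le> B * norm (D a ?v)" and b2: "norm (D y ?v - D a ?v) \<le> B * norm (y - a) * norm ?v"
    and b3: "norm (\<phi> x - \<phi> y - D y ?v) \<le> B * (norm ?v)\<^sup>2"
    using pb K unfolding patch_bound_def by blast+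
  have "tcoord e1 e2 a x - tcoord e1 e2 a y - ?P (D a ?v) = ?P ((\<phi> x - \<phi> y - D y ?v) + (D y ?v - D a ?v))"
    by (simp add: tcoord_def tproj_diff linear_add[OF linear_tproj] linear_neg[OF linear_tproj])
  then have "norm (tcoord e1 e2 a x - tcoord e1 e2 a y - ?P (D a ?v)) \<le> norm ((\<phi> x - \<phi> y - D y ?v) + (D y ?v - D a ?v))"
    using norm_tproj_le[OF fr] by metis
  also have "\<dots> \<le> B * (norm ?v)\<^sup>2 + B * norm (y - a) * norm ?v"
    using b2 b3 by (intro norm_triangle_le add_mono)
  also have "\<dots> = B * (norm ?v + norm (y - a)) * norm ?v" by (simp add: power2_eq_square algebra_simps)
  finally have 1: "norm (tcoord e1 e2 a x - tcoord e1 e2 a y - ?P (D a ?v)) \<le> B * (norm ?v + norm (y - a)) * norm ?v" .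
  have "norm (D a ?v) = norm (?P (D a ?v))" by (simp add: norm_tproj_D[OF aV fr])
  also have "\<dots> \<le> norm (tcoord e1 e2 a x - tcoord e1 e2 a y) + B * (norm ?v + norm (y - a)) * norm ?v"
    using 1 norm_triangle_ineq2[of "?P (D a ?v)" "tcoord e1 e2 a x - tcoord e1 e2 a y"] by (simp add: norm_minus_commute)
  finally have "B * norm (D a ?v) \<le> B * norm (tcoord e1 e2 a x - tcoord e1 e2 a y) + B\<^sup>2 * (norm ?v + norm (y - a)) * norm ?v"
    using B1 mult_left_mono[of "norm (D a ?v)" _ B] by (fastforce simp: algebra_simps power2_eq_square)
  moreover have "2 * B\<^sup>2 * (norm ?v + norm (y - a)) * norm ?v \<le> 1 * norm ?v"
    by (intro mult_right_mono small) auto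
  ultimately show ?thesis using b1 by linarith
qed

lemma tcoord_self [simp]: "tcoord e1 e2 a a = 0"
  by (simp add: tcoord_def linear_0[OF linear_tproj])

lemma continuous_on_tcoord: "continuous_on V (tcoord e1 e2 a)"
  by (rule continuous_at_imp_continuous_on) (auto intro: has_derivative_continuous[OF tcoord_deriv])

text \<open>The area element of the tangent plane pulls back to that of the patch times the cosine.
  The closed ball inside V keeps the image bounded.\<close>

lemma tcoord_change_of_variables:
  assumes U: "open U" "cball c \<rho> \<subseteq> V" "U \<subseteq> cball c \<rho>" and fr: "oframe e1 e2 (nrm a)"
    and inj: "inj_on (tcoord e1 e2 a) U" and F [measurable]: "F \<in> borel_measurable borel"
  shows "(\<integral>\<^sup>+u. F u * indicator (tcoord e1 e2 a ` U) u \<partial>lborel)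
     = (\<integral>\<^sup>+x. ennreal \<bar>jac x * (nrm x \<bullet> nrm a)\<bar> * F (tcoord e1 e2 a x) * indicator U x \<partial>lborel)"
proof -
  let ?\<psi> = "tcoord e1 e2 a"
  have UV: "U \<subseteq> V" using U by blast
  have cont: "continuous_on U ?\<psi>" using continuous_on_tcoord UV by (rule continuous_on_subset)
  obtain g where hom: "homeomorphism U (?\<psi> ` U) ?\<psi> g"
    using invariance_of_domain_homeomorphism[OF U(1) cont _ inj] by auto
  have op: "open (?\<psi> ` U)" by (rule invariance_of_domain[OF cont U(1) inj])
  have bdd: "bounded (?\<psi> ` U)"
  proof (rule bounded_subset)
    show "bounded (?\<psi> ` cball c \<rho>)"
      using U(2) by (intro compact_imp_bounded compact_continuous_image continuous_on_subset[OF continuous_on_tcoord]) auto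
  qed (use U in auto)
  show ?thesis
  proof (rule nn_integral_image_density[OF hom])
    have "continuous_on U (\<lambda>x. \<bar>jac x * (nrm x \<bullet> nrm a)\<bar>)"
      by (intro continuous_intros continuous_on_subset[OF continuous_on_jac UV] continuous_on_subset[OF continuous_on_nrm UV])
    then have "(\<lambda>x. if x \<in> U then \<bar>jac x * (nrm x \<bullet> nrm a)\<bar> else 0) \<in> borel_measurable borel"
      using U(1) by (intro borel_measurable_continuous_on_if) auto
    then have "(\<lambda>x. ennreal (if x \<in> U then \<bar>jac x * (nrm x \<bullet> nrm a)\<bar> else 0)) \<in> borel_measurable borel" by simp
    moreover have "(\<lambda>x. ennreal (if x \<in> U then \<bar>jac x * (nrm x \<bullet> nrm a)\<bar> else 0)) = (\<lambda>x. ennreal \<bar>jac x * (nrm x \<bullet> nrm a)\<bar> * indicator U x)"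
      by (auto simp: fun_eq_iff indicator_def)
    ultimately show "(\<lambda>x. ennreal \<bar>jac x * (nrm x \<bullet> nrm a)\<bar> * indicator U x) \<in> borel_measurable borel" by simp
    fix E assume E: "E \<in> sets borel" "E \<subseteq> U"
    have "emeasure lborel (?\<psi> ` E) = (\<integral>\<^sup>+x. ennreal \<bar>det (matrix (\<lambda>v. tproj e1 e2 (D x v)))\<bar> * indicator E x \<partial>lborel)"
    proof (rule emeasure_lborel_injective_image)
      show "?\<psi> ` E \<in> sets borel" using op by (intro homeomorphism_image_borel[OF hom _ E]) auto
      show "bounded (?\<psi> ` E)" using E by (intro bounded_subset[OF bdd]) auto
      show "inj_on ?\<psi> E" using inj E(2) by (rule inj_on_subset)
      show "(?\<psi> has_derivative (\<lambda>v. tproj e1 e2 (D x v))) (at x)" if "x \<in> E" for x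
        using that E UV by (intro tcoord_deriv) auto
    qed fact
    also have "\<dots> = (\<integral>\<^sup>+x. ennreal \<bar>jac x * (nrm x \<bullet> nrm a)\<bar> * indicator E x \<partial>lborel)"
      using E UV det_tcoord[OF _ fr] by (intro nn_integral_cong) (auto simp: indicator_def)
    finally show "emeasure lborel (?\<psi> ` E) = (\<integral>\<^sup>+x. ennreal \<bar>jac x * (nrm x \<bullet> nrm a)\<bar> * indicator E x \<partial>lborel)" .
  qed (use U op in auto)
qed

end

definition gker :: "real \<Rightarrow> real^3 \<Rightarrow> real^3 \<Rightarrow> real" where
  "gker t p y = exp (- (dist p y)\<^sup>2 / (2 * t))"

lemma gker_pos: "0 < gker t p y"
  by (simp add: gker_def)

lemma gker_measurable [measurable]: "(\<lambda>p. gker t (fst p) (snd p)) \<in> borel_measurable borel"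
  "gker t p \<in> borel_measurable borel"
  unfolding gker_def divide_inverse by (intro borel_measurable_continuous_onI continuous_intros)+

context surface_patch
begin

text \<open>For unit vectors, one minus the cosine is half the squared chord.\<close>

lemma nrm_inner: "x \<in> V \<Longrightarrow> a \<in> V \<Longrightarrow> nrm x \<bullet> nrm a = 1 - (norm (nrm x - nrm a))\<^sup>2 / 2"
  using norm_nrm[of x] norm_nrm[of a]
  by (simp add: power2_norm_eq_inner norm_eq_1 inner_diff_left inner_diff_right inner_commute field_simps)

lemma gker_split:
  assumes "oframe e1 e2 (nrm a)"
  shows "gker t (\<phi> a) (\<phi> x) = exp (- (norm (tcoord e1 e2 a x))\<^sup>2 / (2 * t)) * exp (- ((\<phi> x - \<phi> a) \<bullet> nrm a)\<^sup>2 / (2 * t))"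
proof -
  have "(dist (\<phi> a) (\<phi> x))\<^sup>2 = (norm (tcoord e1 e2 a x))\<^sup>2 + ((\<phi> x - \<phi> a) \<bullet> nrm a)\<^sup>2"
    using norm_tproj[OF assms, of "\<phi> x - \<phi> a"] by (simp add: dist_norm norm_minus_commute tcoord_def)
  then show ?thesis by (simp add: gker_def exp_add[symmetric] diff_divide_distrib)
qed

text \<open>A disc containing a point of the image but not contained in it would meet the frontier
  of the image. Frontier points come from the bounding circle of the ball, which separation sends
  outside radius \<rho>/(2B).\<close>

lemma tcoord_image_contains_ball:
  assumes pb: "patch_bound K B" and K: "a \<in> K" "cball a \<rho> \<subseteq> K" and fr: "oframe e1 e2 (nrm a)"
    and \<rho>: "0 < \<rho>" "6 * B\<^sup>2 * \<rho> \<le> 1"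
  shows "inj_on (tcoord e1 e2 a) (ball a \<rho>)" and "ball 0 (\<rho> / (2 * B)) \<subseteq> tcoord e1 e2 a ` ball a \<rho>"
proof -
  let ?\<psi> = "tcoord e1 e2 a"
  have KV: "K \<subseteq> V" and B: "1 \<le> B" using pb by (auto simp: patch_bound_def)
  have sep: "norm (x - y) \<le> 2 * B * norm (?\<psi> x - ?\<psi> y)" if "x \<in> cball a \<rho>" "y \<in> cball a \<rho>" for x y
  proof (rule tcoord_separation[OF pb K(1) _ _ fr])
    have 1: "norm (y - a) \<le> \<rho>" "norm (x - a) \<le> \<rho>" using that by (auto simp: dist_norm norm_minus_commute)
    then have "norm (x - y) \<le> 2 * \<rho>" using norm_triangle_ineq4[of "x - a" "y - a"] by simp
    \<comment> \<open>The two distances add up to at most 3 \<rho>, the source of the constant 6 in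
      the hypothesis.\<close>
    then have "2 * B\<^sup>2 * (norm (x - y) + norm (y - a)) \<le> 2 * B\<^sup>2 * (3 * \<rho>)"
      using 1 by (intro mult_left_mono) auto
    also have "\<dots> \<le> 1" using \<rho>(2) by simp
    finally show "2 * B\<^sup>2 * (norm (x - y) + norm (y - a)) \<le> 1" .
  qed (use that K in auto)
  show inj: "inj_on ?\<psi> (ball a \<rho>)"
  proof (rule inj_onI)
    fix x y assume "x \<in> ball a \<rho>" "y \<in> ball a \<rho>" "?\<psi> x = ?\<psi> y"
    then have "norm (x - y) \<le> 0" using sep[of x y] by simp
    then show "x = y" by simp
  qed
  have cont: "continuous_on (cball a \<rho>) ?\<psi>" using continuous_on_tcoord K(2) KV by (meson continuous_on_subset)
  let ?T = "?\<psi> ` ball a \<rho>"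
  have op: "open ?T"
    by (rule invariance_of_domain[OF continuous_on_subset[OF cont ball_subset_cball] open_ball inj])
  have cl: "closure ?T \<subseteq> ?\<psi> ` cball a \<rho>"
    using compact_imp_closed[OF compact_continuous_image[OF cont compact_cball]] by (intro closure_minimal) auto
  show "ball 0 (\<rho> / (2 * B)) \<subseteq> ?T"
  proof (rule ccontr)
    assume "\<not> ?thesis"
    then have "ball 0 (\<rho> / (2 * B)) - ?T \<noteq> {}" by blast
    moreover have "0 \<in> ball 0 (\<rho> / (2 * B)) \<inter> ?T"
      using \<rho> B by (auto intro!: image_eqI[of _ _ a])
    ultimately have "ball 0 (\<rho> / (2 * B)) \<inter> frontier ?T \<noteq> {}"
      by (intro connected_Int_frontier convex_connected convex_ball) blast+
    then obtain z where z: "norm z < \<rho> / (2 * B)" "z \<in> frontier ?T" by auto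
    then have "z \<in> closure ?T" "z \<notin> ?T" using op by (auto simp: frontier_def interior_open)
    then obtain x where x: "x \<in> cball a \<rho>" "z = ?\<psi> x" "x \<notin> ball a \<rho>" using cl by blast
    then have "norm (x - a) = \<rho>" by (auto simp: dist_norm norm_minus_commute)
    then have "\<rho> \<le> 2 * B * norm z" using sep[of x a] x \<rho> by simp
    then show False using z(1) B by (simp add: field_simps)
  qed
qed

text \<open>In tangent coordinates the integrand is the planar Gaussian times
  exp(-height^2/(2t))/cos, bounded below by a polynomial model. C depends on the bounds for K and on
  \<rho>, so it is uniform in a, t and the frame.\<close>

lemma gaussian_area_lower:
  assumes pb: "patch_bound K B" and \<rho>: "0 < \<rho>" "6 * B\<^sup>2 * \<rho> \<le> 1"
  shows "\<exists>C\<ge>0. \<forall>a t e1 e2 S. a \<in> K \<longrightarrow> cball a \<rho> \<subseteq> K \<longrightarrow> 0 < t \<longrightarrow> oframe e1 e2 (nrm a) \<longrightarrow> shape_operator e1 e2 a S \<longrightarrow>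
     ennreal hausdorff2_const * ennreal (2 * pi * t * (1 + t / 8 * umbilic_defect S) - C * (t\<^sup>2 * sqrt t))
      \<le> (\<integral>\<^sup>+y. ennreal (gker t (\<phi> a) y) * indicator (\<phi> ` ball a \<rho>) y \<partial>hausdorff2)"
proof -
  have KV: "K \<subseteq> V" and B: "1 \<le> B" using pb by (auto simp: patch_bound_def)
  define r1 where "r1 = \<rho> / (2 * B)"
  have r1: "0 < r1" using \<rho> B by (simp add: r1_def)
  \<comment> \<open>Beyond radius r1 the term |u|^3 / r1^3 outweighs 1, and B^4 |u|^3 / (2 r1)
    outweighs |S u|^2 / 2. The model is then nonpositive off the disc covered by the patch, where
    \<open>ennreal\<close> sets it to 0, so it can be integrated over the whole plane.\<close>
  define C0 where "C0 = 1000 * B^18 + 1 / r1^3 + B^4 / (2 * r1)"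
  have C0: "0 \<le> C0" "1000 * B^18 \<le> C0" using r1 B by (auto simp: C0_def)
  have main: "ennreal hausdorff2_const * ennreal (2 * pi * t * (1 + t / 8 * umbilic_defect S) - (116 * pi * C0) * (t\<^sup>2 * sqrt t))
      \<le> (\<integral>\<^sup>+y. ennreal (gker t (\<phi> a) y) * indicator (\<phi> ` ball a \<rho>) y \<partial>hausdorff2)"
    if a: "a \<in> K" "cball a \<rho> \<subseteq> K" and t: "0 < t" and fr: "oframe e1 e2 (nrm a)" and sh: "shape_operator e1 e2 a S" for a t e1 e2 S
  proof -
    let ?\<psi> = "tcoord e1 e2 a" and ?U = "ball a \<rho>"
    let ?f = "\<lambda>u. exp (- (norm u)\<^sup>2 / (2 * t)) *
       (1 + (norm (S u))\<^sup>2 / 2 - (S u \<bullet> u)\<^sup>2 / (8 * t) - C0 * (norm u ^ 3 + norm u ^ 5 / t))"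
    have linS: "linear S" using sh by (simp add: shape_operator_def)
    have nS: "norm (S w) \<le> B\<^sup>2 * norm w" for w by (rule shape_operator_bound[OF pb a(1) fr sh])
    have bS: "bounded_linear S" using linS linear_conv_bounded_linear by blast
    have [measurable]: "S \<in> borel_measurable borel"
      by (intro borel_measurable_continuous_onI linear_continuous_on bS)
    have UV: "?U \<subseteq> V" using a(2) KV ball_subset_cball by blast
    have aV: "a \<in> V" using a KV by blast
    have pointwise: "ennreal \<bar>jac x * (nrm x \<bullet> nrm a)\<bar> * ennreal (?f (?\<psi> x)) \<le> ennreal (jac x) * ennreal (gker t (\<phi> a) (\<phi> x))"
      if x: "x \<in> ?U" for x
    proof -
      let ?u = "?\<psi> x" and ?s = "(norm (nrm x - nrm a))\<^sup>2" and ?g = "(\<phi> x - \<phi> a) \<bullet> nrm a"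
      have xK: "x \<in> K" "x \<in> V" using x a(2) UV by auto
      have "norm (x - a) \<le> \<rho>" using x by (simp add: dist_norm norm_minus_commute)
      then have "2 * B\<^sup>2 * norm (x - a) \<le> 2 * B\<^sup>2 * \<rho>" by (intro mult_left_mono) auto
      moreover have "0 \<le> B\<^sup>2 * \<rho>" using \<rho> by simp
      ultimately have small: "2 * B\<^sup>2 * norm (x - a) \<le> 1" using \<rho>(2) by linarith
      note ex = tcoord_expansion[OF pb a(1) xK(1) fr sh small]
      have s2: "?s < 2"
      proof -
        have "norm (nrm x - nrm a) \<le> B * norm (x - a)" using pb a xK unfolding patch_bound_def by blast
        also have "\<dots> \<le> B\<^sup>2 * norm (x - a)" using B by (intro mult_right_mono) (auto simp: power2_eq_square)
        also have "\<dots> \<le> 1" using small mult_nonneg_nonneg[OF zero_le_power2[of B] norm_ge_zero[of "x - a"]] by linarith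
        finally have "?s \<le> 1" by (simp add: power_le_one)
        then show ?thesis by simp
      qed
      have q: "\<bar>S ?u \<bullet> ?u\<bar> \<le> B\<^sup>2 * (norm ?u)\<^sup>2"
      proof -
        have "\<bar>S ?u \<bullet> ?u\<bar> \<le> norm (S ?u) * norm ?u" by (rule Cauchy_Schwarz_ineq2)
        also have "\<dots> \<le> B\<^sup>2 * norm ?u * norm ?u" by (intro mult_right_mono nS) auto
        finally show ?thesis by (simp add: power2_eq_square mult.assoc)
      qed
      have low: "1 + (norm (S ?u))\<^sup>2 / 2 - (S ?u \<bullet> ?u)\<^sup>2 / (8 * t) - 1000 * B^18 * (norm ?u ^ 3 + norm ?u ^ 5 / t)
          \<le> exp (- ?g\<^sup>2 / (2 * t)) / (1 - ?s / 2)"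
        by (rule exp_cos_lower[OF B _ ex(2) q ex(3) _ ex(4) s2 ex(5) t]) auto
      have "1000 * B^18 * (norm ?u ^ 3 + norm ?u ^ 5 / t) \<le> C0 * (norm ?u ^ 3 + norm ?u ^ 5 / t)"
        using C0 t by (intro mult_right_mono) auto
      with low have "1 + (norm (S ?u))\<^sup>2 / 2 - (S ?u \<bullet> ?u)\<^sup>2 / (8 * t) - C0 * (norm ?u ^ 3 + norm ?u ^ 5 / t)
          \<le> exp (- ?g\<^sup>2 / (2 * t)) / (1 - ?s / 2)" by linarith
      then have "?f ?u \<le> exp (- (norm ?u)\<^sup>2 / (2 * t)) * (exp (- ?g\<^sup>2 / (2 * t)) / (1 - ?s / 2))"
        by (intro mult_left_mono) auto
      also have "\<dots> = gker t (\<phi> a) (\<phi> x) / (nrm x \<bullet> nrm a)"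
        by (simp add: gker_split[OF fr] nrm_inner[OF xK(2) aV])
      finally have f: "?f ?u \<le> gker t (\<phi> a) (\<phi> x) / (nrm x \<bullet> nrm a)" .
      have cpos: "0 < nrm x \<bullet> nrm a" using s2 nrm_inner[OF xK(2) aV] by simp
      have jp: "0 < jac x" by (rule jac_pos[OF xK(2)])
      have "\<bar>jac x * (nrm x \<bullet> nrm a)\<bar> * ?f ?u \<le> \<bar>jac x * (nrm x \<bullet> nrm a)\<bar> * (gker t (\<phi> a) (\<phi> x) / (nrm x \<bullet> nrm a))"
        by (intro mult_left_mono f) auto
      also have "\<dots> = jac x * gker t (\<phi> a) (\<phi> x)" using cpos jp by (simp add: abs_mult)
      finally have "ennreal (\<bar>jac x * (nrm x \<bullet> nrm a)\<bar> * ?f ?u) \<le> ennreal (jac x * gker t (\<phi> a) (\<phi> x))"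
        by (rule ennreal_leI)
      then show ?thesis using jp gker_pos[of t] by (simp only: ennreal_mult'[OF abs_ge_zero] ennreal_mult'[OF less_imp_le[OF jp]])
    qed
    have neg: "?f u \<le> 0" if "u \<notin> ?\<psi> ` ?U" for u
    proof -
      have "u \<notin> ball 0 r1"
        using tcoord_image_contains_ball(2)[OF pb a fr \<rho>] that unfolding r1_def by blast
      then have "r1 \<le> norm u" by simp
      then have "r1 * 1 \<le> norm u" "r1 ^ 3 \<le> norm u ^ 3" using r1 by (auto intro: power_mono)
      have "1 \<le> norm u ^ 3 / r1 ^ 3" using \<open>r1 ^ 3 \<le> norm u ^ 3\<close> r1 by (simp add: le_divide_eq)
      moreover have "(norm (S u))\<^sup>2 / 2 \<le> B^4 / (2 * r1) * norm u ^ 3"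
      proof -
        have "(norm (S u))\<^sup>2 \<le> (B\<^sup>2 * norm u)\<^sup>2" using nS by (intro power_mono) auto
        also have "\<dots> = B^4 * (norm u)\<^sup>2" by (simp add: power_mult_distrib)
        finally have 1: "(norm (S u))\<^sup>2 \<le> B^4 * (norm u)\<^sup>2" .
        have "(norm u)\<^sup>2 * r1 \<le> (norm u)\<^sup>2 * norm u" using \<open>r1 \<le> norm u\<close> by (intro mult_left_mono) auto
        then have "(norm u)\<^sup>2 \<le> norm u ^ 3 / r1" using r1 by (simp add: le_divide_eq power3_eq_cube power2_eq_square)
        then have "B^4 * (norm u)\<^sup>2 \<le> B^4 * (norm u ^ 3 / r1)" using B by (intro mult_left_mono) auto
        with 1 show ?thesis by simp
      qed
      moreover have "C0 * norm u ^ 3 = 1000 * B^18 * norm u ^ 3 + norm u ^ 3 / r1 ^ 3 + B^4 / (2 * r1) * norm u ^ 3"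
        by (simp add: C0_def algebra_simps)
      moreover have "0 \<le> 1000 * B^18 * norm u ^ 3" "0 \<le> (S u \<bullet> u)\<^sup>2 / (8 * t)" "0 \<le> C0 * (norm u ^ 5 / t)"
        using B t C0 by auto
      ultimately have "1 + (norm (S u))\<^sup>2 / 2 - (S u \<bullet> u)\<^sup>2 / (8 * t) - C0 * (norm u ^ 3 + norm u ^ 5 / t) \<le> 0"
        by (simp only: distrib_left)
      then show ?thesis by (simp add: mult_nonneg_nonpos)
    qed
    have "ennreal (2 * pi * t * (1 + t / 8 * umbilic_defect S) - (116 * pi * C0) * (t\<^sup>2 * sqrt t)) \<le> (\<integral>\<^sup>+u. ennreal (?f u) \<partial>lborel)"
      by (rule gaussian_nn_integral_lower[OF linS t C0(1)])
    also have "\<dots> = (\<integral>\<^sup>+u. ennreal (?f u) * indicator (?\<psi> ` ?U) u \<partial>lborel)"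
      using neg by (intro nn_integral_cong) (auto simp: indicator_def ennreal_neg)
    also have "\<dots> = (\<integral>\<^sup>+x. ennreal \<bar>jac x * (nrm x \<bullet> nrm a)\<bar> * ennreal (?f (?\<psi> x)) * indicator ?U x \<partial>lborel)"
      by (rule tcoord_change_of_variables[OF open_ball _ ball_subset_cball fr tcoord_image_contains_ball(1)[OF pb a fr \<rho>]])
         (use a KV in auto)
    also have "\<dots> \<le> (\<integral>\<^sup>+x. ennreal (jac x) * ennreal (gker t (\<phi> a) (\<phi> x)) * indicator ?U x \<partial>lborel)"
      by (intro nn_integral_mono) (use pointwise in \<open>auto simp: indicator_def\<close>)
    finally have "ennreal hausdorff2_const * ennreal (2 * pi * t * (1 + t / 8 * umbilic_defect S) - (116 * pi * C0) * (t\<^sup>2 * sqrt t))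
      \<le> ennreal hausdorff2_const * (\<integral>\<^sup>+x. ennreal (jac x) * ennreal (gker t (\<phi> a) (\<phi> x)) * indicator ?U x \<partial>lborel)"
      by (rule mult_left_mono) simp
    also have "\<dots> = (\<integral>\<^sup>+y. ennreal (gker t (\<phi> a) y) * indicator (\<phi> ` ?U) y \<partial>hausdorff2)"
      by (rule nn_integral_hausdorff2_image[symmetric]) (use UV in auto)
    finally show ?thesis .
  qed
  show ?thesis
    by (rule exI[of _ "116 * pi * C0"]) (use main C0 in auto)
qed

text \<open>The height only diminishes the kernel, the factor 1/cos is at most 1 + e when the
  normals are close, and enlarging the domain to the whole plane only increases the
  integral.\<close>

lemma gaussian_area_upper:
  assumes pb: "patch_bound (cball a0 R) B" and R: "0 < R" and e: "0 < e"
  shows "\<exists>\<rho>>0. \<rho> < R \<and> (\<forall>a\<in>ball a0 \<rho>. \<forall>t>0.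
     (\<integral>\<^sup>+y. ennreal (gker t (\<phi> a) y) * indicator (\<phi> ` ball a0 \<rho>) y \<partial>hausdorff2)
      \<le> ennreal hausdorff2_const * ennreal ((1 + e) * (2 * pi * t)))"
proof -
  have KV: "cball a0 R \<subseteq> V" and B: "1 \<le> B" using pb by (auto simp: patch_bound_def)
  \<comment> \<open>Points of the ball are within 2 \<rho>. The bound 1/(8 B^2) makes tangent
    coordinates injective for every base point a, and the last one keeps normals within min 1 e / 2
    of each other.\<close>
  define \<rho> where "\<rho> = min (R / 2) (min (1 / (8 * B\<^sup>2)) (min 1 e / (4 * B\<^sup>2)))"
  have \<rho>: "0 < \<rho>" "\<rho> < R" "\<rho> \<le> 1 / (8 * B\<^sup>2)" "\<rho> \<le> min 1 e / (4 * B\<^sup>2)" using R B e by (auto simp: \<rho>_def)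
  have \<rho>8: "8 * B\<^sup>2 * \<rho> \<le> 1" using \<rho>(3) B by (simp add: field_simps)
  have \<rho>e: "4 * B\<^sup>2 * \<rho> \<le> min 1 e" using \<rho>(4) B by (simp add: field_simps)
  have "(\<integral>\<^sup>+y. ennreal (gker t (\<phi> a) y) * indicator (\<phi> ` ball a0 \<rho>) y \<partial>hausdorff2)
      \<le> ennreal hausdorff2_const * ennreal ((1 + e) * (2 * pi * t))" if a: "a \<in> ball a0 \<rho>" and t: "0 < t" for a t
  proof -
    let ?U = "ball a0 \<rho>" and ?K = "cball a0 R"
    have UK: "?U \<subseteq> ?K" using \<rho> by auto
    have UV: "?U \<subseteq> V" using UK KV by blast
    have aV: "a \<in> V" using a UV by blast
    obtain e1 e2 where fr: "oframe e1 e2 (nrm a)" using oframe_exists norm_nrm[OF aV] by blast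
    let ?\<psi> = "tcoord e1 e2 a"
    have d: "norm (x - y) \<le> 2 * \<rho>" if "x \<in> ?U" "y \<in> ?U" for x y
    proof -
      have "norm (x - y) \<le> norm (x - a0) + norm (y - a0)" using norm_triangle_ineq4[of "x - a0" "y - a0"] by simp
      then show ?thesis using that by (auto simp: dist_norm norm_minus_commute)
    qed
    have inj: "inj_on ?\<psi> ?U"
    proof (rule inj_onI)
      fix x y assume xy: "x \<in> ?U" "y \<in> ?U" "?\<psi> x = ?\<psi> y"
      have "2 * B\<^sup>2 * (norm (x - y) + norm (y - a)) \<le> 2 * B\<^sup>2 * (2 * \<rho> + 2 * \<rho>)"
        using d xy a by (intro mult_left_mono add_mono) auto
      then have "2 * B\<^sup>2 * (norm (x - y) + norm (y - a)) \<le> 1" using \<rho>8 by (simp add: algebra_simps)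
      then have "norm (x - y) \<le> 2 * B * norm (?\<psi> x - ?\<psi> y)"
        using xy a UK by (intro tcoord_separation[OF pb _ _ _ fr]) auto
      then show "x = y" using xy by simp
    qed
    have pointwise: "ennreal (jac x) * ennreal (gker t (\<phi> a) (\<phi> x))
        \<le> ennreal \<bar>jac x * (nrm x \<bullet> nrm a)\<bar> * ennreal ((1 + e) * exp (- (norm (?\<psi> x))\<^sup>2 / (2 * t)))" if x: "x \<in> ?U" for x
    proof -
      have xV: "x \<in> V" using x UV by blast
      have "norm (nrm x - nrm a) \<le> B * norm (x - a)" using pb a x UK unfolding patch_bound_def by blast
      also have "\<dots> \<le> B * (2 * \<rho>)" using B d[OF x a] by (intro mult_left_mono) auto
      also have "\<dots> \<le> B\<^sup>2 * (2 * \<rho>)" using B \<rho> by (intro mult_right_mono) (auto simp: power2_eq_square)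
      finally have w: "norm (nrm x - nrm a) \<le> min 1 e / 2" using \<rho>e by linarith
      then have "(norm (nrm x - nrm a))\<^sup>2 \<le> (min 1 e / 2)\<^sup>2" by (intro power_mono) auto
      also have "\<dots> \<le> min 1 e / 2"
        using e by (simp add: power2_eq_square min_def)
      finally have c: "1 - min 1 e / 4 \<le> nrm x \<bullet> nrm a" using nrm_inner[OF xV aV] by simp
      have c0: "0 < nrm x \<bullet> nrm a" using c e by (simp add: min_def split: if_splits)
      have "1 \<le> (1 + e) * (1 - min 1 e / 4)"
        using e by (simp add: min_def field_simps)
      also have "\<dots> \<le> (1 + e) * (nrm x \<bullet> nrm a)" using c e by (intro mult_left_mono) auto
      finally have c1: "1 \<le> (1 + e) * (nrm x \<bullet> nrm a)" .
      have jp: "0 < jac x" by (rule jac_pos[OF xV])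
      have g1: "gker t (\<phi> a) (\<phi> x) \<le> exp (- (norm (?\<psi> x))\<^sup>2 / (2 * t))"
        unfolding gker_split[OF fr] using t by (simp add: mult_left_le)
      have "jac x * gker t (\<phi> a) (\<phi> x) \<le> jac x * (((1 + e) * (nrm x \<bullet> nrm a)) * exp (- (norm (?\<psi> x))\<^sup>2 / (2 * t)))"
      proof (intro mult_left_mono)
        have "1 * gker t (\<phi> a) (\<phi> x) \<le> ((1 + e) * (nrm x \<bullet> nrm a)) * exp (- (norm (?\<psi> x))\<^sup>2 / (2 * t))"
          using c1 g1 by (intro mult_mono) (auto simp: less_imp_le[OF gker_pos])
        then show "gker t (\<phi> a) (\<phi> x) \<le> ((1 + e) * (nrm x \<bullet> nrm a)) * exp (- (norm (?\<psi> x))\<^sup>2 / (2 * t))" by simp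
      qed (use jp in auto)
      also have "\<dots> = \<bar>jac x * (nrm x \<bullet> nrm a)\<bar> * ((1 + e) * exp (- (norm (?\<psi> x))\<^sup>2 / (2 * t)))"
        using jp c0 by (simp add: abs_mult)
      finally show ?thesis
        using jp by (simp only: ennreal_mult'[symmetric] abs_ge_zero less_imp_le) (rule ennreal_leI)
    qed
    have "(\<integral>\<^sup>+y. ennreal (gker t (\<phi> a) y) * indicator (\<phi> ` ?U) y \<partial>hausdorff2)
      = ennreal hausdorff2_const * (\<integral>\<^sup>+x. ennreal (jac x) * ennreal (gker t (\<phi> a) (\<phi> x)) * indicator ?U x \<partial>lborel)"
      by (rule nn_integral_hausdorff2_image) (use UV in auto)
    also have "\<dots> \<le> ennreal hausdorff2_const * (\<integral>\<^sup>+x. ennreal \<bar>jac x * (nrm x \<bullet> nrm a)\<bar> * ennreal ((1 + e) * exp (- (norm (?\<psi> x))\<^sup>2 / (2 * t))) * indicator ?U x \<partial>lborel)"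
      by (intro mult_left_mono nn_integral_mono) (use pointwise in \<open>auto simp: indicator_def\<close>)
    also have "(\<integral>\<^sup>+x. ennreal \<bar>jac x * (nrm x \<bullet> nrm a)\<bar> * ennreal ((1 + e) * exp (- (norm (?\<psi> x))\<^sup>2 / (2 * t))) * indicator ?U x \<partial>lborel)
      = (\<integral>\<^sup>+u. ennreal ((1 + e) * exp (- (norm u)\<^sup>2 / (2 * t))) * indicator (?\<psi> ` ?U) u \<partial>lborel)"
      by (rule tcoord_change_of_variables[OF open_ball KV _ fr inj, symmetric]) (use UK in auto)
    also have "\<dots> \<le> (\<integral>\<^sup>+u. ennreal (1 + e) * ennreal (exp (- (norm u)\<^sup>2 / (2 * t))) \<partial>(lborel :: (real^2) measure))"
      using e by (intro nn_integral_mono) (auto simp: indicator_def ennreal_mult)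
    also have "\<dots> = ennreal ((1 + e) * (2 * pi * t))"
      using gaussian_nn_integral[OF t] e t by (simp add: nn_integral_cmult ennreal_mult)
    finally show ?thesis by (simp add: mult_left_mono)
  qed
  with \<rho> show ?thesis by blast
qed

end

section \<open>The unit sphere\<close>

lemma distr_hausdorff2_orthogonal:
  fixes f :: "real^3 \<Rightarrow> real^3"
  assumes "orthogonal_transformation f"
  shows "distr hausdorff2 borel f = hausdorff2"
proof (rule measure_eqI)
  have iso: "dist (f x) (f y) = dist x y" for x y
    using assms by (simp add: orthogonal_transformation_isometry)
  have lin: "linear f" using assms by (rule orthogonal_transformation_linear)
  have [measurable]: "f \<in> borel_measurable borel"
    using lin by (intro borel_measurable_continuous_onI linear_continuous_on) (simp add: linear_conv_bounded_linear)
  fix A assume "A \<in> sets (distr hausdorff2 borel f)"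
  then have A [measurable]: "A \<in> sets borel" by simp
  have [measurable]: "f -` A \<in> sets borel" using measurable_sets_borel[of f borel A] by simp
  have "f ` (f -` A) = A"
    using orthogonal_transformation_surj[OF assms] by (simp add: surj_image_vimage_eq)
  then have "hausdorff2_outer (f -` A) = hausdorff2_outer A"
    using hausdorff2_outer_isometry[of "f -` A" f] iso by simp
  then show "emeasure (distr hausdorff2 borel f) A = emeasure hausdorff2 A"
    by (subst emeasure_distr) (auto simp: emeasure_hausdorff2)
qed simp

text \<open>Lets the pole omitted by the Lambert chart be ignored.\<close>

lemma hausdorff2_singleton: "emeasure hausdorff2 {p} = 0"
proof -
  have "hausdorff2_outer {p} \<le> 0"
  proof (rule hausdorff2_outer_leI)
    fix \<delta> :: real assume "0 < \<delta>"
    have "hausdorff2_delta \<delta> {p} \<le> (\<Sum>n::nat. ennreal (pi / 4 * (diameter {p})\<^sup>2))"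
      using \<open>0 < \<delta>\<close> by (intro hausdorff2_delta_le) auto
    then show "hausdorff2_delta \<delta> {p} \<le> 0" by simp
  qed
  then show ?thesis by (simp add: emeasure_hausdorff2)
qed

text \<open>The Lambert azimuthal equal-area chart centred at the north pole: it has Jacobian one, and
  the chordal distance to the pole equals the norm of the parameter.\<close>
definition lambert :: "real^2 \<Rightarrow> real^3" where
  "lambert u = vector [sqrt (1 - (norm u)\<^sup>2 / 4) * u$1, sqrt (1 - (norm u)\<^sup>2 / 4) * u$2, 1 - (norm u)\<^sup>2 / 2]"

definition lambert_deriv :: "real^2 \<Rightarrow> real^2 \<Rightarrow> real^3" where
  "lambert_deriv u v = (let s = sqrt (1 - (norm u)\<^sup>2 / 4) in
     vector [s * v$1 - (u \<bullet> v) / (4 * s) * u$1, s * v$2 - (u \<bullet> v) / (4 * s) * u$2, - (u \<bullet> v)])"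

lemma vector3_expand: "vector [a, b, c] = a *\<^sub>R axis 1 1 + b *\<^sub>R axis 2 1 + c *\<^sub>R (axis 3 1 :: real^3)"
  by (simp add: vec_eq_iff forall_3 axis_def)

lemma norm_real2_sq: "(norm u)\<^sup>2 = (u$1)\<^sup>2 + (u$2)\<^sup>2" for u :: "real^2"
  by (simp add: norm_vec_def L2_set_def sum_2)

lemma norm_real3_sq: "(norm u)\<^sup>2 = (u$1)\<^sup>2 + (u$2)\<^sup>2 + (u$3)\<^sup>2" for u :: "real^3"
  by (simp add: norm_vec_def L2_set_def sum_3)

lemma disc2: "u \<in> ball 0 2 \<longleftrightarrow> 0 < 1 - (norm u)\<^sup>2 / 4" for u :: "real^2"
proof -
  have "norm u < 2 \<longleftrightarrow> (norm u)\<^sup>2 < 2\<^sup>2"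
    by (meson norm_ge_zero power2_less_imp_less power_strict_mono zero_le_numeral zero_less_numeral)
  then show ?thesis by simp
qed

lemma lambert_has_derivative:
  assumes "u \<in> ball 0 2"
  shows "(lambert has_derivative lambert_deriv u) (at u)"
proof -
  have p: "0 < 1 - (norm u)\<^sup>2 / 4" using assms disc2 by blast
  define s where "s = sqrt (1 - (norm u)\<^sup>2 / 4)"
  have s0: "0 < s" using p by (simp add: s_def)
  have "((\<lambda>u. 1 - (u \<bullet> u) / 4) has_derivative (\<lambda>v. - (u \<bullet> v) / 2)) (at u)"
    by (auto intro!: derivative_eq_intros simp: inner_commute)
  then have ds: "((\<lambda>u. sqrt (1 - (u \<bullet> u) / 4)) has_derivative (\<lambda>v. - (u \<bullet> v) / (4 * s))) (at u)"
    using p s0 by (auto intro!: derivative_eq_intros simp: s_def power2_norm_eq_inner fun_eq_iff field_simps inner_commute)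
  have "((\<lambda>u. vector [sqrt (1 - (u \<bullet> u) / 4) * u$1, sqrt (1 - (u \<bullet> u) / 4) * u$2, 1 - (u \<bullet> u) / 2] :: real^3)
     has_derivative (\<lambda>v. (s * v$1 - (u \<bullet> v) / (4 * s) * u$1) *\<^sub>R axis 1 1 + (s * v$2 - (u \<bullet> v) / (4 * s) * u$2) *\<^sub>R axis 2 1 + (- (u \<bullet> v)) *\<^sub>R axis 3 1)) (at u)"
    unfolding vector3_expand
  proof (intro has_derivative_add has_derivative_scaleR_left)
    have c: "((\<lambda>u. u $ i) has_derivative (\<lambda>v. v $ i)) (at u)" for i :: 2
      by (rule bounded_linear_imp_has_derivative[OF bounded_linear_vec_nth])
    have su: "sqrt (1 - (u \<bullet> u) / 4) = s" by (simp add: s_def power2_norm_eq_inner)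
    have m: "((\<lambda>u. sqrt (1 - (u \<bullet> u) / 4) * u $ i) has_derivative (\<lambda>v. s * v $ i - (u \<bullet> v) / (4 * s) * u $ i)) (at u)" for i :: 2
      using has_derivative_mult[OF ds c[of i]] by (simp add: su)
    show "((\<lambda>u. sqrt (1 - (u \<bullet> u) / 4) * u $ 1) has_derivative (\<lambda>v. s * v $ 1 - (u \<bullet> v) / (4 * s) * u $ 1)) (at u)"
      "((\<lambda>u. sqrt (1 - (u \<bullet> u) / 4) * u $ 2) has_derivative (\<lambda>v. s * v $ 2 - (u \<bullet> v) / (4 * s) * u $ 2)) (at u)"
      by (rule m)+
    show "((\<lambda>u. 1 - (u \<bullet> u) / 2) has_derivative (\<lambda>v. - (u \<bullet> v))) (at u)"
      by (auto intro!: derivative_eq_intros simp: inner_commute)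
  qed
  then show ?thesis
    unfolding lambert_def[abs_def] lambert_deriv_def[abs_def] Let_def s_def[symmetric] vector3_expand[symmetric]
    unfolding power2_norm_eq_inner .
qed

text \<open>On the sphere 1 - |u|^2/4 = (1 + y3)/2, so this factor undoes the square root in
  \<open>lambert\<close>.\<close>

definition lambert_inv :: "real^3 \<Rightarrow> real^2" where
  "lambert_inv y = vector [sqrt (2 / (1 + y$3)) * y$1, sqrt (2 / (1 + y$3)) * y$2]"

lemma norm_lambert:
  assumes "u \<in> ball 0 2"
  shows "norm (lambert u) = 1"
proof -
  have p: "0 < 1 - (norm u)\<^sup>2 / 4" using assms disc2 by blast
  have "(norm (lambert u))\<^sup>2 = (1 - (norm u)\<^sup>2 / 4) * (norm u)\<^sup>2 + (1 - (norm u)\<^sup>2 / 2)\<^sup>2"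
    using p unfolding norm_real3_sq by (simp add: lambert_def power_mult_distrib norm_real2_sq[symmetric] distrib_left[symmetric])
  also have "\<dots> = 1" by (simp add: power2_eq_square field_simps)
  finally show ?thesis by (metis norm_ge_zero power2_eq_1_iff neg_le_0_iff_le not_one_le_zero real_sqrt_abs real_sqrt_one abs_norm_cancel)
qed

lemma dist_lambert:
  assumes "u \<in> ball 0 2"
  shows "dist (axis 3 1) (lambert u) = norm u"
proof -
  have "(dist (axis 3 1) (lambert u))\<^sup>2 = (norm (lambert u))\<^sup>2 + 1 - 2 * (lambert u $ 3)"
    unfolding dist_norm norm_minus_commute[of "axis 3 1"] norm_real3_sq[of "lambert u - axis 3 1"] norm_real3_sq[of "lambert u"]
    by (simp add: axis_def power2_eq_square algebra_simps)
  also have "\<dots> = (norm u)\<^sup>2" unfolding norm_lambert[OF assms] by (simp add: lambert_def)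
  finally show ?thesis by (simp add: power2_eq_imp_eq)
qed

text \<open>Only the south pole is missed, where the scale factor 2/(1 + y3) of the inverse blows
  up.\<close>

lemma lambert_image: "lambert ` ball 0 2 = sphere 0 1 - {- axis 3 1}"
  and homeomorphism_lambert: "homeomorphism (ball 0 2) (lambert ` ball 0 2) lambert lambert_inv"
proof -
  have inv1: "lambert_inv (lambert u) = u" if u: "u \<in> ball 0 2" for u
  proof -
    have p: "0 < 1 - (norm u)\<^sup>2 / 4" using u disc2 by blast
    have "2 / (1 + lambert u $ 3) = 1 / (1 - (norm u)\<^sup>2 / 4)" using p by (simp add: lambert_def field_simps)
    then have "sqrt (2 / (1 + lambert u $ 3)) * sqrt (1 - (norm u)\<^sup>2 / 4) = 1"
      using p by (simp add: real_sqrt_divide)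
    then show ?thesis
      by (simp add: lambert_inv_def vec_eq_iff forall_2) (simp add: lambert_def mult.assoc[symmetric])
  qed
  have sp: "-1 < y$3" if "y \<in> sphere 0 1 - {- axis 3 1}" for y :: "real^3"
  proof -
    have 1: "(y$1)\<^sup>2 + (y$2)\<^sup>2 + (y$3)\<^sup>2 = 1" using that norm_real3_sq[of y] by simp
    have "\<bar>y$3\<bar> \<le> 1" using that component_le_norm_cart[of y 3] by simp
    moreover have "y$3 \<noteq> -1"
    proof
      assume "y$3 = -1"
      then have "(y$1)\<^sup>2 + (y$2)\<^sup>2 = 0" using 1 by simp
      then have "y = - axis 3 1" using \<open>y$3 = -1\<close> by (simp add: vec_eq_iff forall_3 axis_def sum_power2_eq_zero_iff)
      then show False using that by simp
    qed
    ultimately show ?thesis by linarith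
  qed
  have inv2: "lambert_inv y \<in> ball 0 2 \<and> lambert (lambert_inv y) = y" if y: "y \<in> sphere 0 1 - {- axis 3 1}" for y
  proof -
    have p: "0 < 1 + y$3" using sp[OF y] by simp
    have 1: "(y$1)\<^sup>2 + (y$2)\<^sup>2 = (1 + y$3) * (1 - y$3)" using y norm_real3_sq[of y] by (simp add: power2_eq_square algebra_simps)
    have n: "(norm (lambert_inv y))\<^sup>2 = 2 * (1 - y$3)"
    proof -
      have "(norm (lambert_inv y))\<^sup>2 = (2 / (1 + y$3)) * ((y$1)\<^sup>2 + (y$2)\<^sup>2)"
        using p unfolding norm_real2_sq by (simp add: lambert_inv_def power_mult_distrib distrib_left)
      also have "\<dots> = 2 * (1 - y$3)" unfolding 1 using p by simp
      finally show ?thesis .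
    qed
    have h: "1 - (norm (lambert_inv y))\<^sup>2 / 4 = (1 + y$3) / 2" unfolding n by (simp add: field_simps)
    have "lambert_inv y \<in> ball 0 2" unfolding disc2 h using p by simp
    moreover have "sqrt ((1 + y$3) / 2) * sqrt (2 / (1 + y$3)) = 1" using p by (simp add: real_sqrt_mult[symmetric])
    then have "lambert (lambert_inv y) = y"
      unfolding lambert_def h unfolding n by (simp add: vec_eq_iff forall_3 lambert_inv_def mult.assoc[symmetric] diff_divide_distrib)
    ultimately show ?thesis by blast
  qed
  have sub: "lambert u \<in> sphere 0 1 - {- axis 3 1}" if u: "u \<in> ball 0 2" for u
  proof -
    have "lambert u $ 3 \<noteq> -1" using u disc2[of u] by (simp add: lambert_def field_simps)
    moreover have "(- axis 3 1 :: real^3) $ 3 = -1" by (simp add: axis_def)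
    ultimately have "lambert u \<noteq> - axis 3 1" by metis
    then show ?thesis using norm_lambert[OF u] by simp
  qed
  show im: "lambert ` ball 0 2 = sphere 0 1 - {- axis 3 1}"
    using sub inv2 by (metis (no_types, lifting) equalityI image_eqI image_subsetI subsetI)
  have c1: "continuous_on (ball 0 2) lambert"
    by (rule continuous_at_imp_continuous_on) (auto intro: has_derivative_continuous[OF lambert_has_derivative])
  have c2: "continuous_on (sphere 0 1 - {- axis 3 1}) lambert_inv"
  proof -
    have eq: "lambert_inv = (\<lambda>y. (sqrt (2 / (1 + y$3)) * y$1) *\<^sub>R axis 1 1 + (sqrt (2 / (1 + y$3)) * y$2) *\<^sub>R axis 2 1)"
      by (simp add: fun_eq_iff lambert_inv_def vec_eq_iff forall_2 axis_def)
    show ?thesis unfolding eq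
      using sp by (intro continuous_intros) force+
  qed
  show "homeomorphism (ball 0 2) (lambert ` ball 0 2) lambert lambert_inv"
    unfolding im
  proof (rule homeomorphismI[OF c1 c2])
    show "lambert ` ball 0 2 \<subseteq> sphere 0 1 - {- axis 3 1}" using im by simp
    show "lambert_inv ` (sphere 0 1 - {- axis 3 1}) \<subseteq> ball 0 2"
      by (rule image_subsetI) (use inv2 in blast)
  qed (use inv1 inv2 in blast)+
qed

text \<open>The equal-area property: the cross product of the partial derivatives is the position
  vector, which has length 1.\<close>

lemma cross_lambert:
  assumes "u \<in> ball 0 2"
  shows "cross3 (lambert_deriv u (axis 1 1)) (lambert_deriv u (axis 2 1)) = lambert u"
proof -
  have p: "0 < 1 - (norm u)\<^sup>2 / 4" using assms disc2 by blast
  define s where "s = sqrt (1 - (norm u)\<^sup>2 / 4)"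
  have s0: "s \<noteq> 0" and s2: "s * s = 1 - ((u$1)\<^sup>2 + (u$2)\<^sup>2) / 4" using p by (auto simp: s_def norm_real2_sq)
  have i: "u \<bullet> axis 1 1 = u$1" "u \<bullet> axis 2 1 = u$2" by (simp_all add: inner_axis)
  have c3: "(s - u$1 / (4 * s) * u$1) * (s - u$2 / (4 * s) * u$2) - (- (u$1 / (4 * s) * u$2)) * (- (u$2 / (4 * s) * u$1)) = 1 - (norm u)\<^sup>2 / 2"
  proof -
    have "(s - u$1 / (4 * s) * u$1) * (s - u$2 / (4 * s) * u$2) - (- (u$1 / (4 * s) * u$2)) * (- (u$2 / (4 * s) * u$1)) = s * s - ((u$1)\<^sup>2 + (u$2)\<^sup>2) / 4"
      using s0 by (simp add: field_simps power2_eq_square)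
    then show ?thesis unfolding s2 norm_real2_sq by simp
  qed
  show ?thesis
    unfolding lambert_deriv_def Let_def i s_def[symmetric] lambert_def
    using s0 c3 by (simp add: cross3_def vec_eq_iff forall_3 axis_def field_simps)
qed

interpretation lambert: immersion "ball 0 2" lambert lambert_deriv lambert_inv
proof
  show "(lambert has_derivative lambert_deriv u) (at u)" if "u \<in> ball 0 2" for u
    using that by (rule lambert_has_derivative)
  show "continuous_on (ball 0 2) (\<lambda>u. lambert_deriv u v)" for v
    unfolding lambert_deriv_def Let_def vector3_expand
    using disc2 by (intro continuous_intros) force+
  show "inj (lambert_deriv u)" if u: "u \<in> ball 0 2" for u
  proof -
    have lin: "linear (lambert_deriv u)" using lambert_has_derivative[OF u] by (rule has_derivative_linear)
    let ?p = "lambert_deriv u (axis 1 1)" and ?q = "lambert_deriv u (axis 2 1)"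
    have c: "cross3 ?p ?q \<noteq> 0" using cross_lambert[OF u] norm_lambert[OF u] by auto
    have "v = 0" if "lambert_deriv u v = 0" for v
    proof -
      have v: "v$1 *\<^sub>R ?p + v$2 *\<^sub>R ?q = 0" using linear_real2[OF lin, of v] that by simp
      have "v$1 *\<^sub>R cross3 ?p ?q = cross3 (v$1 *\<^sub>R ?p + v$2 *\<^sub>R ?q) ?q"
        by (simp add: cross_add_left cross_mult_left)
      moreover have "v$2 *\<^sub>R cross3 ?p ?q = cross3 ?p (v$1 *\<^sub>R ?p + v$2 *\<^sub>R ?q)"
        by (simp add: cross_add_right cross_mult_right)
      ultimately have "v$1 = 0" "v$2 = 0" using c unfolding v by auto
      then show ?thesis by (simp add: vec_eq_iff forall_2)
    qed
    then show ?thesis using linear_injective_0[OF lin] by blast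
  qed
  show "homeomorphism (ball 0 2) (lambert ` ball 0 2) lambert lambert_inv" by (rule homeomorphism_lambert)
  show "lambert ` ball 0 2 \<in> sets borel" unfolding lambert_image by simp
qed simp

lemma lambert_jac: "u \<in> ball 0 2 \<Longrightarrow> lambert.jac u = 1"
  by (simp add: lambert.jac_def lambert.cr_def cross_lambert norm_lambert del: mem_ball_0)

lemma nn_integral_sphere_pole:
  assumes [measurable]: "F \<in> borel_measurable borel"
  shows "(\<integral>\<^sup>+y. F y * indicator (sphere 0 1) y \<partial>hausdorff2)
     = ennreal hausdorff2_const * (\<integral>\<^sup>+u. F (lambert u) * indicator (ball 0 2) u \<partial>lborel)"
proof -
  have "AE y in hausdorff2. y \<noteq> - axis 3 1"
    by (rule AE_I[where N = "{- axis 3 1}"]) (auto simp: hausdorff2_singleton)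
  then have "(\<integral>\<^sup>+y. F y * indicator (sphere 0 1) y \<partial>hausdorff2) = (\<integral>\<^sup>+y. F y * indicator (lambert ` ball 0 2) y \<partial>hausdorff2)"
    unfolding lambert_image by (intro nn_integral_cong_AE) (auto simp: indicator_def)
  also have "\<dots> = ennreal hausdorff2_const * (\<integral>\<^sup>+u. ennreal (lambert.jac u) * F (lambert u) * indicator (ball 0 2) u \<partial>lborel)"
    by (rule lambert.nn_integral_hausdorff2_image) auto
  also have "(\<integral>\<^sup>+u. ennreal (lambert.jac u) * F (lambert u) * indicator (ball 0 2) u \<partial>lborel) = (\<integral>\<^sup>+u. F (lambert u) * indicator (ball 0 2) u \<partial>lborel)"
    by (intro nn_integral_cong) (auto simp: indicator_def lambert_jac simp del: mem_ball_0)
  finally show ?thesis .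
qed

lemma hausdorff2_sphere: "emeasure hausdorff2 (sphere 0 1) = ennreal (hausdorff2_const * (4 * pi))"
proof -
  have "emeasure hausdorff2 (sphere 0 1) = (\<integral>\<^sup>+y. 1 * indicator (sphere 0 1) y \<partial>hausdorff2)" by simp
  also have "\<dots> = ennreal hausdorff2_const * (\<integral>\<^sup>+u. 1 * indicator (ball (0::real^2) 2) u \<partial>lborel)"
    by (rule nn_integral_sphere_pole) simp
  also have "(\<integral>\<^sup>+u. 1 * indicator (ball (0::real^2) 2) u \<partial>lborel) = ennreal (4 * pi)"
    by (simp add: emeasure_ball unit_ball_vol_2 power2_eq_square)
  finally show ?thesis using hausdorff2_const_pos by (simp add: ennreal_mult)
qed

text \<open>Chordal distance to the pole is |u|, so the kernel becomes exactly the planar Gaussian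
  on the disc of radius 2. Extending to the plane gives the upper bound; for the lower one the
  indicator of the disc is bounded below by 1 - |u|^2/4.\<close>

lemma sphere_gaussian_pole:
  assumes t: "0 < t"
  shows "(\<integral>\<^sup>+y. ennreal (gker t (axis 3 1) y) * indicator (sphere 0 1) y \<partial>hausdorff2) \<le> ennreal (hausdorff2_const * (2 * pi * t))"
    and "ennreal (hausdorff2_const * (2 * pi * t * (1 - t / 2))) \<le> (\<integral>\<^sup>+y. ennreal (gker t (axis 3 1) y) * indicator (sphere 0 1) y \<partial>hausdorff2)"
proof -
  let ?E = "\<lambda>u::real^2. exp (- (norm u)\<^sup>2 / (2 * t))"
  have eq: "(\<integral>\<^sup>+y. ennreal (gker t (axis 3 1) y) * indicator (sphere 0 1) y \<partial>hausdorff2)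
    = ennreal hausdorff2_const * (\<integral>\<^sup>+u. ennreal (?E u) * indicator (ball 0 2) u \<partial>lborel)"
  proof (subst nn_integral_sphere_pole)
    have "(\<integral>\<^sup>+u. ennreal (gker t (axis 3 1) (lambert u)) * indicator (ball 0 2) u \<partial>lborel) = (\<integral>\<^sup>+u. ennreal (?E u) * indicator (ball 0 2) u \<partial>lborel)"
      by (intro nn_integral_cong) (auto simp: indicator_def gker_def dist_lambert simp del: mem_ball_0)
    then show "ennreal hausdorff2_const * (\<integral>\<^sup>+u. ennreal (gker t (axis 3 1) (lambert u)) * indicator (ball 0 2) u \<partial>lborel)
        = ennreal hausdorff2_const * (\<integral>\<^sup>+u. ennreal (?E u) * indicator (ball 0 2) u \<partial>lborel)" by simp
  qed simp
  have "(\<integral>\<^sup>+u. ennreal (?E u) * indicator (ball 0 2) u \<partial>lborel) \<le> (\<integral>\<^sup>+u. ennreal (?E u) \<partial>lborel)"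
    by (intro nn_integral_mono) (auto simp: indicator_def)
  then have "(\<integral>\<^sup>+u. ennreal (?E u) * indicator (ball 0 2) u \<partial>lborel) \<le> ennreal (2 * pi * t)"
    using gaussian_nn_integral[OF t] by simp
  then show "(\<integral>\<^sup>+y. ennreal (gker t (axis 3 1) y) * indicator (sphere 0 1) y \<partial>hausdorff2) \<le> ennreal (hausdorff2_const * (2 * pi * t))"
    unfolding eq using hausdorff2_const_pos t by (simp add: ennreal_mult mult_left_mono)
  \<comment> \<open>The Gaussian integral of 1 - |u|^2/4 after u = sqrt t w; since E |w|^2 = 2, the
    correction is t/2.\<close>
  have hb: "has_bochner_integral lborel (\<lambda>w. gmon 0 0 w + (- t / 4) * (gmon 2 0 w + gmon 0 2 w))
     (2 * pi * nmom 0 * nmom 0 + (- t / 4) * (2 * pi * nmom 2 * nmom 0 + 2 * pi * nmom 0 * nmom 2))"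
    by (intro has_bochner_integral_add has_bochner_integral_mult_right has_bochner_integral_gmon)
  have val: "2 * pi * nmom 0 * nmom 0 + (- t / 4) * (2 * pi * nmom 2 * nmom 0 + 2 * pi * nmom 0 * nmom 2) = 2 * pi * (1 - t / 2)"
    by (simp add: nmom_simps algebra_simps)
  have "ennreal (2 * pi * (1 - t / 2)) \<le> (\<integral>\<^sup>+w. ennreal (gmon 0 0 w + (- t / 4) * (gmon 2 0 w + gmon 0 2 w)) \<partial>lborel)"
    using ennreal_integral_le_nn_integral[of lborel "\<lambda>w. gmon 0 0 w + (- t / 4) * (gmon 2 0 w + gmon 0 2 w)"] hb val
    by (simp add: has_bochner_integral_iff)
  also have "\<dots> \<le> (\<integral>\<^sup>+w. ennreal (?E (sqrt t *\<^sub>R w)) * indicator (ball 0 2) (sqrt t *\<^sub>R w) \<partial>lborel)"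
  proof (intro nn_integral_mono)
    fix w :: "real^2"
    have n: "(norm (sqrt t *\<^sub>R w))\<^sup>2 = t * (norm w)\<^sup>2" using t by (simp add: power_mult_distrib)
    have "gmon 0 0 w + (- t / 4) * (gmon 2 0 w + gmon 0 2 w) = exp (- (norm w)\<^sup>2 / 2) * (1 - t * (norm w)\<^sup>2 / 4)"
      unfolding norm_real2_sq[of w] gmon_def by (simp add: norm_real2_sq algebra_simps)
    also have "\<dots> \<le> (if sqrt t *\<^sub>R w \<in> ball 0 2 then ?E (sqrt t *\<^sub>R w) else 0)"
      unfolding disc2 n using t by (auto simp: mult_left_le mult_le_0_iff)
    finally show "ennreal (gmon 0 0 w + (- t / 4) * (gmon 2 0 w + gmon 0 2 w)) \<le> ennreal (?E (sqrt t *\<^sub>R w)) * indicator (ball 0 2) (sqrt t *\<^sub>R w)"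
      by (auto simp: indicator_def ennreal_neg intro: ennreal_leI split: if_splits simp del: mem_ball_0)
  qed
  finally have "ennreal t * ennreal (2 * pi * (1 - t / 2)) \<le> ennreal t * (\<integral>\<^sup>+w. ennreal (?E (sqrt t *\<^sub>R w)) * indicator (ball 0 2) (sqrt t *\<^sub>R w) \<partial>lborel)"
    by (rule mult_left_mono) simp
  also have "\<dots> = (\<integral>\<^sup>+u. ennreal (?E u) * indicator (ball 0 2) u \<partial>lborel)"
    by (rule nn_integral_real2_scale[OF _ t, symmetric]) simp
  finally have "ennreal hausdorff2_const * (ennreal t * ennreal (2 * pi * (1 - t / 2))) \<le> ennreal hausdorff2_const * (\<integral>\<^sup>+u. ennreal (?E u) * indicator (ball 0 2) u \<partial>lborel)"
    by (rule mult_left_mono) simp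
  then show "ennreal (hausdorff2_const * (2 * pi * t * (1 - t / 2))) \<le> (\<integral>\<^sup>+y. ennreal (gker t (axis 3 1) y) * indicator (sphere 0 1) y \<partial>hausdorff2)"
    unfolding eq using hausdorff2_const_pos t by (simp add: ennreal_mult'[symmetric] mult_ac)
qed

text \<open>A rotation taking the pole to p preserves the sphere, distances and Hausdorff
  measure.\<close>

lemma sphere_gaussian_eq_pole:
  assumes "p \<in> sphere 0 1"
  shows "(\<integral>\<^sup>+y. ennreal (gker t p y) * indicator (sphere 0 1) y \<partial>hausdorff2)
    = (\<integral>\<^sup>+y. ennreal (gker t (axis 3 1) y) * indicator (sphere 0 1) y \<partial>hausdorff2)"
proof -
  obtain f :: "real^3 \<Rightarrow> real^3" where f: "orthogonal_transformation f" "f (axis 3 1) = p"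
    using orthogonal_transformation_exists[of "axis 3 1 :: real^3" p] assms by auto
  have [measurable]: "sphere (0::real^3) 1 \<in> sets borel" by (rule borel_closed) simp
  have nf: "norm (f y) = norm y" for y using f(1) by (simp add: orthogonal_transformation_norm)
  have df: "dist p (f y) = dist (axis 3 1) y" for y
    using f by (metis orthogonal_transformation_isometry)
  have [measurable]: "f \<in> borel_measurable borel"
    using orthogonal_transformation_linear[OF f(1)]
    by (intro borel_measurable_continuous_onI linear_continuous_on) (simp add: linear_conv_bounded_linear)
  have "(\<integral>\<^sup>+y. ennreal (gker t p y) * indicator (sphere 0 1) y \<partial>hausdorff2)
      = (\<integral>\<^sup>+y. ennreal (gker t p y) * indicator (sphere 0 1) y \<partial>distr hausdorff2 borel f)"
    by (simp add: distr_hausdorff2_orthogonal[OF f(1)])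
  also have "\<dots> = (\<integral>\<^sup>+y. ennreal (gker t p (f y)) * indicator (sphere 0 1) (f y) \<partial>hausdorff2)"
    by (subst nn_integral_distr) auto
  also have "\<dots> = (\<integral>\<^sup>+y. ennreal (gker t (axis 3 1) y) * indicator (sphere 0 1) y \<partial>hausdorff2)"
    by (simp add: gker_def df indicator_def nf)
  finally show ?thesis .
qed

section \<open>Gaussian averages and the distance distribution\<close>

locale mm_set =
  fixes M :: "(real^3) set"
  assumes borel_M [measurable]: "M \<in> sets borel"
    and pos: "emeasure hausdorff2 M \<noteq> 0" and fin: "emeasure hausdorff2 M \<noteq> \<top>"
begin

lemma space_mm [simp]: "space (mm_measure M) = M"
  by (simp add: mm_measure_def space_restrict_space)

lemma sets_mm: "sets (mm_measure M) = sets (restrict_space borel M)"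
  by (simp add: mm_measure_def sets_restrict_space)

lemma measurable_mm: "f \<in> borel_measurable borel \<Longrightarrow> f \<in> borel_measurable (mm_measure M)"
  using measurable_restrict_space1[of f borel] measurable_cong_sets[OF sets_mm refl] by blast

lemma nn_integral_mm:
  assumes [measurable]: "f \<in> borel_measurable borel"
  shows "(\<integral>\<^sup>+x. f x \<partial>mm_measure M) = (\<integral>\<^sup>+x. f x * indicator M x \<partial>hausdorff2) / emeasure hausdorff2 M"
proof -
  have [measurable]: "f \<in> borel_measurable (restrict_space hausdorff2 M)"
    by (rule measurable_restrict_space1) simp
  have "(\<integral>\<^sup>+x. f x \<partial>mm_measure M) = (\<integral>\<^sup>+x. (1 / emeasure hausdorff2 M) * f x \<partial>restrict_space hausdorff2 M)"
    unfolding mm_measure_def by (subst nn_integral_density) auto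
  also have "\<dots> = (1 / emeasure hausdorff2 M) * (\<integral>\<^sup>+x. f x \<partial>restrict_space hausdorff2 M)"
    by (rule nn_integral_cmult) simp
  also have "(\<integral>\<^sup>+x. f x \<partial>restrict_space hausdorff2 M) = (\<integral>\<^sup>+x. f x * indicator M x \<partial>hausdorff2)"
    by (subst nn_integral_restrict_space) auto
  finally show ?thesis by (simp add: ennreal_divide_times mult.commute)
qed

lemma prob_space_mm: "prob_space (mm_measure M)"
proof
  have "emeasure (mm_measure M) (space (mm_measure M)) = (\<integral>\<^sup>+x. 1 \<partial>mm_measure M)" by simp
  also have "\<dots> = 1" using pos fin by (subst nn_integral_mm) (auto simp: less_top)
  finally show "emeasure (mm_measure M) (space (mm_measure M)) = 1" .
qed

lemma dist_measurable_mm: "(\<lambda>z. dist (fst z) (snd z)) \<in> borel_measurable (mm_measure M \<Otimes>\<^sub>M mm_measure M)"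
  by (intro borel_measurable_dist measurable_compose[OF measurable_fst measurable_mm] measurable_compose[OF measurable_snd measurable_mm]) auto

text \<open>The law of the distance of two independent random points;
  \<open>global_dist_distr\<close> is its distribution function on r \<ge> 0.\<close>

definition dist_law :: "real measure" where
  "dist_law = distr (mm_measure M \<Otimes>\<^sub>M mm_measure M) borel (\<lambda>z. dist (fst z) (snd z))"

lemma real_distribution_dist_law: "real_distribution dist_law"
proof -
  interpret mm: prob_space "mm_measure M" by (rule prob_space_mm)
  interpret P: pair_prob_space "mm_measure M" "mm_measure M" ..
  show ?thesis unfolding dist_law_def by (rule P.real_distribution_distr[OF dist_measurable_mm])
qed

lemma cdf_dist_law: "cdf dist_law r = (if r < 0 then 0 else global_dist_distr M r)"
proof -
  have "cdf dist_law r = measure (mm_measure M \<Otimes>\<^sub>M mm_measure M) ((\<lambda>z. dist (fst z) (snd z)) -` {..r} \<inter> space (mm_measure M \<Otimes>\<^sub>M mm_measure M))"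
    unfolding cdf_def dist_law_def by (rule measure_distr[OF dist_measurable_mm]) simp
  also have "(\<lambda>z. dist (fst z) (snd z)) -` {..r} \<inter> space (mm_measure M \<Otimes>\<^sub>M mm_measure M) = {p \<in> M \<times> M. dist (fst p) (snd p) \<le> r}"
    by (auto simp: space_pair_measure)
  finally have "cdf dist_law r = global_dist_distr M r" by (simp add: global_dist_distr_def)
  moreover have "global_dist_distr M r = 0" if "r < 0"
  proof -
    have "{p \<in> M \<times> M. dist (fst p) (snd p) \<le> r} = {}"
      using that zero_le_dist by (auto simp: not_le intro: less_le_trans)
    then show ?thesis by (simp only: global_dist_distr_def measure_empty)
  qed
  ultimately show ?thesis by simp
qed

definition gauss_avg :: "real \<Rightarrow> ennreal" where
  "gauss_avg t = (\<integral>\<^sup>+p. (\<integral>\<^sup>+y. ennreal (gker t p y) \<partial>mm_measure M) \<partial>mm_measure M)"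

text \<open>Tonelli and the image measure: the average depends on the set only through the law of
  the distance.\<close>

lemma gauss_avg_dist_law: "gauss_avg t = (\<integral>\<^sup>+s. ennreal (exp (- s\<^sup>2 / (2 * t))) \<partial>dist_law)"
proof -
  interpret mm: prob_space "mm_measure M" by (rule prob_space_mm)
  interpret P: pair_prob_space "mm_measure M" "mm_measure M" ..
  have me: "(\<lambda>s::real. ennreal (exp (- s\<^sup>2 / (2 * t)))) \<in> borel_measurable borel" by simp
  have m: "(\<lambda>z. ennreal (exp (- (dist (fst z) (snd z))\<^sup>2 / (2 * t)))) \<in> borel_measurable (mm_measure M \<Otimes>\<^sub>M mm_measure M)"
    using measurable_compose[OF dist_measurable_mm me] .
  have "(\<integral>\<^sup>+s. ennreal (exp (- s\<^sup>2 / (2 * t))) \<partial>dist_law) = (\<integral>\<^sup>+z. ennreal (exp (- (dist (fst z) (snd z))\<^sup>2 / (2 * t))) \<partial>(mm_measure M \<Otimes>\<^sub>M mm_measure M))"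
    unfolding dist_law_def by (rule nn_integral_distr[OF dist_measurable_mm]) simp
  also have "\<dots> = gauss_avg t"
    using mm.nn_integral_fst[OF m] by (simp add: gauss_avg_def gker_def)
  finally show ?thesis by simp
qed

end

text \<open>Agreement for r \<ge> 0 gives agreement everywhere, since both distribution functions
  vanish for r < 0, and a law on the line is determined by its distribution function.\<close>

lemma gauss_avg_cong:
  assumes "mm_set M" "mm_set N" "\<forall>r\<ge>0. global_dist_distr M r = global_dist_distr N r"
  shows "mm_set.gauss_avg M t = mm_set.gauss_avg N t"
proof -
  interpret M: mm_set M by fact
  interpret N: mm_set N by fact
  have "cdf M.dist_law = cdf N.dist_law" using assms(3) by (auto simp: fun_eq_iff M.cdf_dist_law N.cdf_dist_law)
  then have "M.dist_law = N.dist_law"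
    using M.real_distribution_dist_law N.real_distribution_dist_law cdf_unique by blast
  then show ?thesis by (simp add: M.gauss_avg_dist_law N.gauss_avg_dist_law)
qed

lemma mm_set_sphere: "mm_set (sphere 0 1)"
proof
  show "sphere 0 1 \<in> sets (borel :: (real^3) measure)" by (rule borel_closed) simp
qed (use hausdorff2_const_pos in \<open>auto simp: hausdorff2_sphere\<close>)

text \<open>By symmetry the inner integral does not depend on the centre, so the average is the
  value at the pole divided by the area, and the Hausdorff constant cancels. For t > 2 the lower
  bound is truncated to 0.\<close>

lemma gauss_avg_sphere:
  assumes t: "0 < t"
  shows "mm_set.gauss_avg (sphere 0 1) t \<le> ennreal (t / 2)" "ennreal (t / 2 * (1 - t / 2)) \<le> mm_set.gauss_avg (sphere 0 1) t"
proof -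
  interpret S: mm_set "sphere 0 1" by (rule mm_set_sphere)
  interpret mm: prob_space "mm_measure (sphere 0 1)" by (rule S.prob_space_mm)
  let ?c = "hausdorff2_const"
  let ?I = "\<integral>\<^sup>+y. ennreal (gker t (axis 3 1) y) * indicator (sphere 0 1) y \<partial>hausdorff2"
  have inner: "(\<integral>\<^sup>+y. ennreal (gker t p y) \<partial>mm_measure (sphere 0 1)) = ?I / ennreal (?c * (4 * pi))" if "p \<in> sphere 0 1" for p
    using sphere_gaussian_eq_pole[OF that, of t] by (subst S.nn_integral_mm) (auto simp: hausdorff2_sphere)
  have "S.gauss_avg t = (\<integral>\<^sup>+p. ?I / ennreal (?c * (4 * pi)) \<partial>mm_measure (sphere 0 1))"
    unfolding S.gauss_avg_def by (intro nn_integral_cong inner) simp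
  also have "\<dots> = ?I / ennreal (?c * (4 * pi))" using mm.emeasure_space_1 by simp
  finally have eq: "S.gauss_avg t = ?I / ennreal (?c * (4 * pi))" .
  have "?I / ennreal (?c * (4 * pi)) \<le> ennreal (?c * (2 * pi * t)) / ennreal (?c * (4 * pi))"
    by (rule divide_right_mono_ennreal[OF sphere_gaussian_pole(1)[OF t]])
  also have "\<dots> = ennreal (t / 2)" using hausdorff2_const_pos t by (simp add: divide_ennreal)
  finally show "S.gauss_avg t \<le> ennreal (t / 2)" unfolding eq .
  show "ennreal (t / 2 * (1 - t / 2)) \<le> S.gauss_avg t"
  proof (cases "t \<le> 2")
    case True
    have "ennreal (t / 2 * (1 - t / 2)) = ennreal (?c * (2 * pi * t * (1 - t / 2))) / ennreal (?c * (4 * pi))"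
      using hausdorff2_const_pos t True by (subst divide_ennreal) auto
    also have "\<dots> \<le> ?I / ennreal (?c * (4 * pi))"
      by (rule divide_right_mono_ennreal[OF sphere_gaussian_pole(2)[OF t]])
    finally show ?thesis unfolding eq .
  next
    case False
    then show ?thesis using t by (simp add: ennreal_neg mult_nonneg_nonpos)
  qed
qed

section \<open>Closed surfaces\<close>

definition gauss_area :: "(real^3) set \<Rightarrow> real \<Rightarrow> real^3 \<Rightarrow> ennreal" where
  "gauss_area M t q = (\<integral>\<^sup>+y. ennreal (gker t q y) * indicator M y \<partial>hausdorff2)"

locale embedded_patch = surface_patch +
  fixes M W :: "(real^3) set"
  assumes open_W: "open W" and image: "\<phi> ` V = M \<inter> W" and borel_M [measurable]: "M \<in> sets borel"
begin

text \<open>The image of V is relatively open in M, so small pieces of the chart are traces of open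
  sets of space.\<close>

lemma open_image:
  assumes "open U" "U \<subseteq> V"
  shows "\<exists>N. open N \<and> \<phi> ` U = M \<inter> N"
proof -
  have "openin (top_of_set (\<phi> ` V)) (\<phi> ` U)"
    using homeomorphism_imp_open_map[OF homeo, of U] assms open_V
    by (simp add: open_openin_trans subset_openin_subtopology openin_open_eq)
  then obtain N where "open N" "\<phi> ` U = \<phi> ` V \<inter> N" unfolding openin_open by blast
  then show ?thesis using image open_W by (intro exI[of _ "W \<inter> N"]) auto
qed

lemma image_sub: "U \<subseteq> V \<Longrightarrow> \<phi> ` U \<subseteq> M"
  using image by blast

text \<open>Formulated with the derivatives of the chart and the normal, so it does not refer to a
  frame.\<close>

definition umb :: "real^2 \<Rightarrow> bool" where
  "umb a \<longleftrightarrow> (\<exists>k. \<forall>v. DN a v = k *\<^sub>R D a v)"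

text \<open>If S is k times the identity, DN a v + k D a v has no tangential part, and no normal
  part since both summands are tangent.\<close>

lemma umb_if_defect_0:
  assumes a: "a \<in> V" and fr: "oframe e1 e2 (nrm a)" and sh: "shape_operator e1 e2 a S" and "umbilic_defect S = 0"
  shows "umb a"
proof -
  have S: "linear S" "\<And>v. S (tproj e1 e2 (D a v)) = - tproj e1 e2 (DN a v)"
    using sh by (auto simp: shape_operator_def)
  obtain k where k: "\<And>w. S w = k *\<^sub>R w" using umbilic_defect_eq_0[OF S(1) assms(4)] by blast
  have "DN a v = (- k) *\<^sub>R D a v" for v
  proof -
    let ?w = "DN a v + k *\<^sub>R D a v"
    have "tproj e1 e2 ?w = 0"
      using S(2)[of v] k by (simp add: linear_add[OF linear_tproj] linear_scale[OF linear_tproj])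
    moreover have "?w \<bullet> nrm a = 0"
      using nrm_D[OF a, of v] nrm_DN[OF a, of v] by (simp add: inner_commute[of _ "nrm a"] inner_add_right)
    ultimately have "(norm ?w)\<^sup>2 = 0" using norm_tproj[OF fr, of ?w] by simp
    then show ?thesis by (simp add: add_eq_0_iff)
  qed
  then show ?thesis unfolding umb_def by blast
qed

lemma gauss_area_ge:
  "U \<in> sets borel \<Longrightarrow> U \<subseteq> V \<Longrightarrow> (\<integral>\<^sup>+y. ennreal (gker t q y) * indicator (\<phi> ` U) y \<partial>hausdorff2) \<le> gauss_area M t q"
  unfolding gauss_area_def using image_sub
  by (intro nn_integral_mono) (auto simp: indicator_def)

text \<open>The first bound drops the nonnegative curvature term and is uniform near a0. The second
  keeps it at a nonumbilic point, as a gain of order t^2 whose constants may depend on the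
  point.\<close>

lemma local_lower:
  assumes a0: "a0 \<in> V"
  shows "\<exists>N C. open N \<and> \<phi> a0 \<in> N \<and> 0 \<le> C \<and>
    (\<forall>q\<in>M \<inter> N. \<forall>t>0. ennreal hausdorff2_const * ennreal (2 * pi * t - C * (t\<^sup>2 * sqrt t)) \<le> gauss_area M t q)"
    and "\<not> umb a0 \<Longrightarrow> \<exists>\<kappa> C. 0 < \<kappa> \<and> 0 \<le> C \<and>
      (\<forall>t>0. ennreal hausdorff2_const * ennreal (2 * pi * t * (1 + t * \<kappa>) - C * (t\<^sup>2 * sqrt t)) \<le> gauss_area M t (\<phi> a0))"
proof -
  obtain R0 where R0: "0 < R0" "cball a0 R0 \<subseteq> V" using open_V a0 open_contains_cball by blast
  \<comment> \<open>Halving leaves room: balls of radius at most R around points of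
    \<open>ball a0 R\<close> stay within radius 2 R.\<close>
  define R where "R = R0 / 2"
  have R: "0 < R" "cball a0 (2 * R) \<subseteq> V" using R0 by (auto simp: R_def)
  obtain B where pb: "patch_bound (cball a0 (2 * R)) B" using patch_bound_exists[of "cball a0 (2 * R)"] R by auto
  have B: "1 \<le> B" using pb by (simp add: patch_bound_def)
  define \<rho> where "\<rho> = min R (1 / (6 * B\<^sup>2))"
  have "\<rho> \<le> 1 / (6 * B\<^sup>2)" by (simp add: \<rho>_def)
  then have "6 * B\<^sup>2 * \<rho> \<le> 1" using B by (simp add: field_simps)
  then have \<rho>: "0 < \<rho>" "6 * B\<^sup>2 * \<rho> \<le> 1" "\<rho> \<le> R" using R B by (auto simp: \<rho>_def)
  obtain C where C: "0 \<le> C" and low: "\<And>a t e1 e2 S. a \<in> cball a0 (2 * R) \<Longrightarrow> cball a \<rho> \<subseteq> cball a0 (2 * R) \<Longrightarrow> 0 < t \<Longrightarrow>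
      oframe e1 e2 (nrm a) \<Longrightarrow> shape_operator e1 e2 a S \<Longrightarrow>
     ennreal hausdorff2_const * ennreal (2 * pi * t * (1 + t / 8 * umbilic_defect S) - C * (t\<^sup>2 * sqrt t))
      \<le> (\<integral>\<^sup>+y. ennreal (gker t (\<phi> a) y) * indicator (\<phi> ` ball a \<rho>) y \<partial>hausdorff2)"
    using gaussian_area_lower[OF pb \<rho>(1,2)] by blast
  have sub: "cball a \<rho> \<subseteq> cball a0 (2 * R)" if "a \<in> ball a0 R" for a
  proof
    fix x assume "x \<in> cball a \<rho>"
    then show "x \<in> cball a0 (2 * R)" using that \<rho>(3) dist_triangle[of a0 x a] by auto
  qed
  have low': "ennreal hausdorff2_const * ennreal (2 * pi * t * (1 + t / 8 * umbilic_defect S) - C * (t\<^sup>2 * sqrt t)) \<le> gauss_area M t (\<phi> a)"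
    if a: "a \<in> ball a0 R" and "0 < t" "oframe e1 e2 (nrm a)" "shape_operator e1 e2 a S" for a t e1 e2 S
  proof -
    have "ball a \<rho> \<subseteq> V" using sub[OF a] R(2) ball_subset_cball by blast
    then show ?thesis using order_trans[OF low[OF _ sub[OF a] that(2-4)] gauss_area_ge] a R by auto
  qed
  obtain N where N: "open N" "\<phi> ` ball a0 R = M \<inter> N"
    using open_image[of "ball a0 R"] R by force
  have "ennreal hausdorff2_const * ennreal (2 * pi * t - C * (t\<^sup>2 * sqrt t)) \<le> gauss_area M t q" if q: "q \<in> M \<inter> N" and t: "0 < t" for q t
  proof -
    obtain a where a: "a \<in> ball a0 R" "q = \<phi> a" using q N by blast
    have aV: "a \<in> V" using a(1) R by force
    obtain e1 e2 where fr: "oframe e1 e2 (nrm a)" using oframe_exists norm_nrm[OF aV] by blast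
    obtain S where S: "shape_operator e1 e2 a S" using shape_operator_exists[OF aV fr] by blast
    have "2 * pi * t - C * (t\<^sup>2 * sqrt t) \<le> 2 * pi * t * (1 + t / 8 * umbilic_defect S) - C * (t\<^sup>2 * sqrt t)"
      using t umbilic_defect_nonneg[of S] by simp
    then have "ennreal hausdorff2_const * ennreal (2 * pi * t - C * (t\<^sup>2 * sqrt t))
       \<le> ennreal hausdorff2_const * ennreal (2 * pi * t * (1 + t / 8 * umbilic_defect S) - C * (t\<^sup>2 * sqrt t))"
      by (intro mult_left_mono ennreal_leI) auto
    also have "\<dots> \<le> gauss_area M t q" unfolding a(2) by (rule low'[OF a(1) t fr S])
    finally show ?thesis .
  qed
  moreover have "\<phi> a0 \<in> N" using N R by force
  ultimately show "\<exists>N C. open N \<and> \<phi> a0 \<in> N \<and> 0 \<le> C \<and>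
    (\<forall>q\<in>M \<inter> N. \<forall>t>0. ennreal hausdorff2_const * ennreal (2 * pi * t - C * (t\<^sup>2 * sqrt t)) \<le> gauss_area M t q)"
    using N(1) C by blast
  assume nu: "\<not> umb a0"
  obtain e1 e2 where fr: "oframe e1 e2 (nrm a0)" using oframe_exists norm_nrm[OF a0] by blast
  obtain S where S: "shape_operator e1 e2 a0 S" using shape_operator_exists[OF a0 fr] by blast
  have "umbilic_defect S \<noteq> 0" using nu umb_if_defect_0[OF a0 fr S] by blast
  then have "0 < umbilic_defect S / 8" using umbilic_defect_nonneg[of S] by simp
  moreover have "ennreal hausdorff2_const * ennreal (2 * pi * t * (1 + t * (umbilic_defect S / 8)) - C * (t\<^sup>2 * sqrt t)) \<le> gauss_area M t (\<phi> a0)" if "0 < t" for t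
    using low'[OF _ that fr S] R by simp
  ultimately show "\<exists>\<kappa> C. 0 < \<kappa> \<and> 0 \<le> C \<and>
      (\<forall>t>0. ennreal hausdorff2_const * ennreal (2 * pi * t * (1 + t * \<kappa>) - C * (t\<^sup>2 * sqrt t)) \<le> gauss_area M t (\<phi> a0))"
    using C by blast
qed

text \<open>The integral over a small patch has its leading-order bound; on the rest of M the kernel
  is at most exp(-\<delta>^2/(2t)).\<close>

lemma local_upper:
  assumes a0: "a0 \<in> V" and e: "0 < e"
  shows "\<exists>N \<delta>. open N \<and> \<phi> a0 \<in> N \<and> 0 < \<delta> \<and> (\<forall>q\<in>M \<inter> N. \<forall>t>0.
     gauss_area M t q \<le> ennreal hausdorff2_const * ennreal ((1 + e) * (2 * pi * t)) + ennreal (exp (- \<delta>\<^sup>2 / (2 * t))) * emeasure hausdorff2 M)"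
proof -
  obtain R where R: "0 < R" "cball a0 R \<subseteq> V" using open_V a0 open_contains_cball by blast
  obtain B where pb: "patch_bound (cball a0 R) B" using patch_bound_exists[of "cball a0 R"] R by auto
  obtain \<rho> where \<rho>: "0 < \<rho>" "\<rho> < R" and up: "\<And>a t. a \<in> ball a0 \<rho> \<Longrightarrow> 0 < t \<Longrightarrow>
     (\<integral>\<^sup>+y. ennreal (gker t (\<phi> a) y) * indicator (\<phi> ` ball a0 \<rho>) y \<partial>hausdorff2) \<le> ennreal hausdorff2_const * ennreal ((1 + e) * (2 * pi * t))"
    using gaussian_area_upper[OF pb R(1) e] by blast
  have UV: "ball a0 \<rho> \<subseteq> V" using R \<rho> by force
  obtain N where N: "open N" "\<phi> ` ball a0 \<rho> = M \<inter> N" using open_image[OF open_ball UV] by blast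
  have "\<phi> a0 \<in> N" using N \<rho> by force
  \<comment> \<open>Centres are taken within \<delta> of \<phi> a0, while points of M off the patch
    are at least 2 \<delta> from it.\<close>
  then obtain \<delta> where \<delta>: "0 < \<delta>" "ball (\<phi> a0) (2 * \<delta>) \<subseteq> N"
    using N(1) openE by (metis field_sum_of_halves half_gt_zero mult_2)
  have [measurable]: "\<phi> ` ball a0 \<rho> \<in> sets borel" using UV by (intro phi_image_borel) auto
  have "gauss_area M t q \<le> ennreal hausdorff2_const * ennreal ((1 + e) * (2 * pi * t)) + ennreal (exp (- \<delta>\<^sup>2 / (2 * t))) * emeasure hausdorff2 M"
    if q: "q \<in> M \<inter> ball (\<phi> a0) \<delta>" and t: "0 < t" for q t
  proof -
    have "q \<in> M \<inter> N" using q \<delta> by auto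
    then obtain a where a: "a \<in> ball a0 \<rho>" "q = \<phi> a" using N by blast
    have "gauss_area M t q \<le> (\<integral>\<^sup>+y. ennreal (gker t q y) * indicator (\<phi> ` ball a0 \<rho>) y + ennreal (exp (- \<delta>\<^sup>2 / (2 * t))) * indicator M y \<partial>hausdorff2)"
      unfolding gauss_area_def
    proof (intro nn_integral_mono)
      fix y
      show "ennreal (gker t q y) * indicator M y \<le> ennreal (gker t q y) * indicator (\<phi> ` ball a0 \<rho>) y + ennreal (exp (- \<delta>\<^sup>2 / (2 * t))) * indicator M y"
      proof (cases "y \<in> M \<and> y \<notin> \<phi> ` ball a0 \<rho>")
        case True
        then have "y \<notin> ball (\<phi> a0) (2 * \<delta>)" using N(2) \<delta>(2) by blast
        then have "\<delta> \<le> dist q y" using q dist_triangle[of "\<phi> a0" y q] by auto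
        then have "\<delta>\<^sup>2 \<le> (dist q y)\<^sup>2" using \<delta>(1) by (intro power_mono) auto
        then have "gker t q y \<le> exp (- \<delta>\<^sup>2 / (2 * t))" using t by (simp add: gker_def divide_right_mono)
        then show ?thesis using True by (simp add: ennreal_leI)
      qed (auto simp: indicator_def)
    qed
    also have "\<dots> = (\<integral>\<^sup>+y. ennreal (gker t q y) * indicator (\<phi> ` ball a0 \<rho>) y \<partial>hausdorff2) + ennreal (exp (- \<delta>\<^sup>2 / (2 * t))) * emeasure hausdorff2 M"
      by (subst nn_integral_add) (auto simp: nn_integral_cmult)
    also have "\<dots> \<le> ennreal hausdorff2_const * ennreal ((1 + e) * (2 * pi * t)) + ennreal (exp (- \<delta>\<^sup>2 / (2 * t))) * emeasure hausdorff2 M"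
      unfolding a(2) by (intro add_right_mono up a(1) t)
    finally show ?thesis .
  qed
  then show ?thesis using \<delta>(1) by (intro exI[of _ "ball (\<phi> a0) \<delta>"] exI[of _ \<delta>]) auto
qed

lemma local_finite:
  assumes a0: "a0 \<in> V"
  shows "\<exists>N. open N \<and> \<phi> a0 \<in> N \<and> emeasure hausdorff2 (M \<inter> N) < \<top>"
proof -
  obtain R where R: "0 < R" "cball a0 R \<subseteq> V" using open_V a0 open_contains_cball by blast
  have UV: "ball a0 R \<subseteq> V" using R by force
  obtain N where N: "open N" "\<phi> ` ball a0 R = M \<inter> N" using open_image[OF open_ball UV] by blast
  obtain j where j: "\<And>x. x \<in> cball a0 R \<Longrightarrow> jac x \<le> j" "0 \<le> j"
  proof -
    have "bounded (jac ` cball a0 R)"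
      using R by (intro compact_imp_bounded compact_continuous_image continuous_on_subset[OF continuous_on_jac]) auto
    then obtain j where "\<And>z. z \<in> jac ` cball a0 R \<Longrightarrow> norm z \<le> j" unfolding bounded_iff by blast
    then have "\<And>x. x \<in> cball a0 R \<Longrightarrow> jac x \<le> j" by (force dest: imageI)
    then show ?thesis by (intro that[of "max 0 j"]) (auto simp: le_max_iff_disj)
  qed
  have "emeasure hausdorff2 (M \<inter> N) = ennreal hausdorff2_const * (\<integral>\<^sup>+x. ennreal (jac x) * indicator (ball a0 R) x \<partial>lborel)"
    unfolding N(2)[symmetric] by (rule hausdorff2_area_formula) (use UV in auto)
  also have "\<dots> \<le> ennreal hausdorff2_const * (\<integral>\<^sup>+x. ennreal j * indicator (ball a0 R) x \<partial>lborel)"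
    using j by (intro mult_left_mono nn_integral_mono) (auto simp: indicator_def intro!: ennreal_leI)
  also have "\<dots> = ennreal hausdorff2_const * (ennreal j * emeasure lborel (ball a0 R))" by (subst nn_integral_cmult_indicator) auto
  also have "\<dots> < \<top>"
    using emeasure_lborel_ball_finite[of a0 R] by (simp add: ennreal_mult_less_top)
  finally show ?thesis using N R by (intro exI[of _ N]) force
qed

text \<open>The area element is positive, and a nonempty open set of the plane has positive Lebesgue
  measure.\<close>

lemma image_positive:
  assumes U: "open U" "U \<subseteq> V" "U \<noteq> {}"
  shows "emeasure hausdorff2 (\<phi> ` U) \<noteq> 0"
proof
  assume "emeasure hausdorff2 (\<phi> ` U) = 0"
  then have "(\<integral>\<^sup>+x. ennreal (jac x) * indicator U x \<partial>lborel) = 0"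
    using hausdorff2_area_formula[of U] U hausdorff2_const_pos by (auto simp: ennreal_eq_0_iff)
  moreover have "(\<lambda>x. ennreal (jac x) * indicator U x) \<in> borel_measurable lborel"
  proof -
    have [measurable]: "U \<in> sets borel" using U by simp
    have "(\<lambda>x. ennreal (jac x) * indicator V x * indicator U x) \<in> borel_measurable lborel" by measurable
    moreover have "(\<lambda>x. ennreal (jac x) * indicator V x * indicator U x) = (\<lambda>x. ennreal (jac x) * indicator U x)"
      using U by (auto simp: fun_eq_iff indicator_def)
    ultimately show ?thesis by simp
  qed
  ultimately have "AE x in lborel. ennreal (jac x) * indicator U x = 0" by (simp add: nn_integral_0_iff_AE)
  then have "AE x in lborel. x \<notin> U"
  proof eventually_elim
    case (elim x)
    show ?case
    proof
      assume "x \<in> U"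
      then have "0 < jac x" using jac_pos U by blast
      then show False using elim \<open>x \<in> U\<close> by (simp add: ennreal_eq_0_iff)
    qed
  qed
  then have "emeasure lborel U = 0" using U by (intro AE_iff_measurable[THEN iffD1, of U lborel "\<lambda>x. x \<notin> U"]) auto
  then show False using open_not_negligible[OF U(1,3)] negligible_iff_null_sets null_sets_completionI by (metis U(1) borel_open null_setsI sets_lborel)
qed

text \<open>At an umbilic point the factor can only be the quotient \<open>kf\<close>. The
  continuous function F measures how far DN is from \<open>kf\<close> times D on the two axes and
  vanishes exactly at umbilic points.\<close>

lemma open_nonumbilic: "open {a \<in> V. \<not> umb a}"
proof -
  let ?e = "\<lambda>i::2. axis i 1 :: real^2"
  have cDN: "continuous_on V (\<lambda>x. DN x v)" for v
    using Ck_nrm[of "Suc 0"] Ck_on_Suc_iff[OF open_V nrm_deriv, of 0] by simp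
  have nz: "D a (?e 1) \<noteq> 0" if "a \<in> V" for a
    using cr_nonzero[OF that] by (auto simp: cr_def)
  define kf where "kf = (\<lambda>a. (DN a (?e 1) \<bullet> D a (?e 1)) / (D a (?e 1) \<bullet> D a (?e 1)))"
  define F where "F = (\<lambda>a. norm (DN a (?e 1) - kf a *\<^sub>R D a (?e 1)) + norm (DN a (?e 2) - kf a *\<^sub>R D a (?e 2)))"
  have "continuous_on V F"
    unfolding F_def kf_def using nz by (intro continuous_intros cDN cont_D) auto
  then have "open {a \<in> V. F a \<in> - {0}}"
    using continuous_open_preimage[OF _ open_V, of F "- {0}"] open_Compl[OF closed_singleton[of "0::real"]]
    by (simp add: vimage_def Int_def conj_commute)
  moreover have "umb a \<longleftrightarrow> F a = 0" if a: "a \<in> V" for a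
  proof
    assume "umb a"
    then obtain k where k: "\<And>v. DN a v = k *\<^sub>R D a v" unfolding umb_def by blast
    then have "kf a = k" using nz[OF a] by (simp add: kf_def)
    then show "F a = 0" using k by (simp add: F_def)
  next
    assume "F a = 0"
    then have "norm (DN a (?e 1) - kf a *\<^sub>R D a (?e 1)) = 0" "norm (DN a (?e 2) - kf a *\<^sub>R D a (?e 2)) = 0"
      unfolding F_def using norm_ge_zero by (smt (verit))+
    then have "DN a (?e 1) = kf a *\<^sub>R D a (?e 1)" "DN a (?e 2) = kf a *\<^sub>R D a (?e 2)" by auto
    then have "DN a v = kf a *\<^sub>R D a v" for v
      using linear_real2[OF linear_DN[OF a], of v] D_expand[OF a, of v] by (simp add: scaleR_add_right mult.commute)
    then show "umb a" unfolding umb_def by blast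
  qed
  ultimately show ?thesis by (simp cong: conj_cong)
qed

end

text \<open>A local bound with a parameter that may be increased becomes global on a compact set;
  the sum over a finite subcover of the absolute values serves as a common upper bound.\<close>

lemma compact_uniform_bound:
  fixes Q :: "real \<Rightarrow> 'a::metric_space \<Rightarrow> bool"
  assumes "compact M" and loc: "\<And>p. p \<in> M \<Longrightarrow> \<exists>N c. open N \<and> p \<in> N \<and> (\<forall>q\<in>M \<inter> N. Q c q)"
    and mono: "\<And>c c' q. q \<in> M \<Longrightarrow> Q c q \<Longrightarrow> c \<le> c' \<Longrightarrow> Q c' q"
  shows "\<exists>c. \<forall>q\<in>M. Q c q"
proof -
  have "\<forall>p\<in>M. \<exists>Nc. open (fst Nc) \<and> p \<in> fst Nc \<and> (\<forall>q\<in>M \<inter> fst Nc. Q (snd Nc) q)" using loc by fastforce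
  from bchoice[OF this] obtain f where f: "\<And>p. p \<in> M \<Longrightarrow> open (fst (f p))" "\<And>p. p \<in> M \<Longrightarrow> p \<in> fst (f p)"
    "\<And>p q. p \<in> M \<Longrightarrow> q \<in> M \<inter> fst (f p) \<Longrightarrow> Q (snd (f p)) q" by blast
  obtain F where F: "F \<subseteq> M" "finite F" "M \<subseteq> (\<Union>p\<in>F. fst (f p))"
    using compactE_image[OF assms(1), of M "\<lambda>p. fst (f p)"] f by blast
  define c where "c = (\<Sum>p\<in>F. \<bar>snd (f p)\<bar>)"
  have "Q c q" if q: "q \<in> M" for q
  proof -
    obtain p where p: "p \<in> F" "q \<in> fst (f p)" using F q by blast
    have "snd (f p) \<le> \<bar>snd (f p)\<bar>" by simp
    also have "\<dots> \<le> c" unfolding c_def using F(2) p(1) by (intro member_le_sum) auto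
    finally show ?thesis using mono[OF q f(3)] p F(1) q by blast
  qed
  then show ?thesis by blast
qed

section \<open>Charts, finite area and uniform bounds on a closed surface\<close>

locale closed_surface =
  fixes M :: "(real^3) set"
  assumes compact_M: "compact M" and nonempty: "M \<noteq> {}" and surface: "smooth_embedded_surface M"
begin

lemma M_borel [measurable]: "M \<in> sets borel"
  using compact_M by (intro borel_closed compact_imp_closed)

lemma chart_at:
  assumes "p \<in> M"
  obtains V \<phi> D \<xi> W a where "embedded_patch V \<phi> D \<xi> M W" "a \<in> V" "\<phi> a = p"
proof -
  obtain V W and \<phi> :: "real^2 \<Rightarrow> real^3" and \<xi> where c: "open V" "open W" "p \<in> W" "smooth_on V \<phi>" "homeomorphism V (M \<inter> W) \<phi> \<xi>"
    "\<forall>x\<in>V. \<exists>D. (\<phi> has_derivative D) (at x) \<and> inj D"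
    using surface assms unfolding smooth_embedded_surface_def by meson
  define D where "D = (\<lambda>x. frechet_derivative \<phi> (at x))"
  have im: "\<phi> ` V = M \<inter> W" using c(5) by (simp add: homeomorphism_def)
  have d: "(\<phi> has_derivative D x) (at x)" if "x \<in> V" for x
    unfolding D_def using c(6) that by (intro frechet_derivative_works[THEN iffD1]) (auto simp: differentiable_def)
  have "embedded_patch V \<phi> D \<xi> M W"
  proof
    show "continuous_on V (\<lambda>x. D x v)" for v
    proof -
      have "Ck_on (Suc 0) V \<phi>" using c(4) unfolding smooth_on_def by blast
      then show ?thesis using Ck_on_Suc_iff[OF c(1) d, of 0] by simp
    qed
    show "inj (D x)" if "x \<in> V" for x
      using c(6) that has_derivative_unique[OF d[OF that]] by metis
    show "\<phi> ` V \<in> sets borel" unfolding im using c(2) by simp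
  qed (use c im d in auto)
  moreover obtain a where "a \<in> V" "\<phi> a = p" using im assms c(3) by (metis IntI imageE)
  ultimately show ?thesis by (rule that)
qed

lemma finite_area: "emeasure hausdorff2 M \<noteq> \<top>"
proof -
  have "\<forall>p\<in>M. \<exists>N. open N \<and> p \<in> N \<and> emeasure hausdorff2 (M \<inter> N) < \<top>"
  proof
    fix p assume "p \<in> M"
    then obtain V \<phi> D \<xi> W a where "embedded_patch V \<phi> D \<xi> M W" "a \<in> V" "\<phi> a = p" by (rule chart_at)
    then show "\<exists>N. open N \<and> p \<in> N \<and> emeasure hausdorff2 (M \<inter> N) < \<top>"
      using embedded_patch.local_finite by metis
  qed
  from bchoice[OF this] obtain N where N: "\<And>p. p \<in> M \<Longrightarrow> open (N p)" "\<And>p. p \<in> M \<Longrightarrow> p \<in> N p"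
    "\<And>p. p \<in> M \<Longrightarrow> emeasure hausdorff2 (M \<inter> N p) < \<top>" by blast
  obtain F where F: "F \<subseteq> M" "finite F" "M \<subseteq> (\<Union>p\<in>F. N p)"
    using compactE_image[OF compact_M, of M N] N by blast
  have sets: "M \<inter> N p \<in> sets hausdorff2" if "p \<in> F" for p using N(1) F(1) that by auto
  have "emeasure hausdorff2 M \<le> emeasure hausdorff2 (\<Union>p\<in>F. M \<inter> N p)"
    using F sets.finite_UN[OF F(2) sets] by (intro emeasure_mono) auto
  also have "\<dots> \<le> (\<Sum>p\<in>F. emeasure hausdorff2 (M \<inter> N p))"
    using F sets by (intro emeasure_subadditive_finite) auto
  also have "\<dots> < \<top>" using F N(3) by (auto simp: less_top[symmetric] intro!: sum_Pinfty)
  finally show ?thesis by simp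
qed

lemma positive_area: "emeasure hausdorff2 M \<noteq> 0"
proof -
  obtain p where "p \<in> M" using nonempty by blast
  then obtain V \<phi> D \<xi> W a where c: "embedded_patch V \<phi> D \<xi> M W" "a \<in> V" "\<phi> a = p" by (rule chart_at)
  interpret embedded_patch V \<phi> D \<xi> M W by fact
  have "emeasure hausdorff2 (\<phi> ` V) \<le> emeasure hausdorff2 M"
    by (intro emeasure_mono image_sub) auto
  moreover have "emeasure hausdorff2 (\<phi> ` V) \<noteq> 0" using image_positive[OF open_V] c(2) by blast
  ultimately show ?thesis by auto
qed

end

sublocale closed_surface \<subseteq> mm_set M
  by unfold_locales (rule M_borel positive_area finite_area)+

context closed_surface
begin

definition area :: real where "area = enn2real (emeasure hausdorff2 M)"

lemma emeasure_area: "emeasure hausdorff2 M = ennreal area"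
  unfolding area_def using finite_area by (simp add: less_top)

lemma area_pos: "0 < area"
  unfolding area_def using finite_area positive_area by (simp add: enn2real_positive_iff less_top zero_less_iff_neq_zero)

lemma lower_uniform: "\<exists>C. \<forall>q\<in>M. \<forall>t>0. ennreal hausdorff2_const * ennreal (2 * pi * t - C * (t\<^sup>2 * sqrt t)) \<le> gauss_area M t q"
proof (rule compact_uniform_bound[OF compact_M])
  fix p assume "p \<in> M"
  then obtain V \<phi> D \<xi> W a where "embedded_patch V \<phi> D \<xi> M W" "a \<in> V" "\<phi> a = p" by (rule chart_at)
  from embedded_patch.local_lower(1)[OF this(1,2)] this(3)
  show "\<exists>N C. open N \<and> p \<in> N \<and> (\<forall>q\<in>M \<inter> N. \<forall>t>0. ennreal hausdorff2_const * ennreal (2 * pi * t - C * (t\<^sup>2 * sqrt t)) \<le> gauss_area M t q)"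
    by blast
next
  fix c c' q
  assume h: "\<forall>t>0. ennreal hausdorff2_const * ennreal (2 * pi * t - c * (t\<^sup>2 * sqrt t)) \<le> gauss_area M t q" and "c \<le> c'"
  show "\<forall>t>0. ennreal hausdorff2_const * ennreal (2 * pi * t - c' * (t\<^sup>2 * sqrt t)) \<le> gauss_area M t q"
  proof (intro allI impI)
    fix t :: real assume "0 < t"
    then have "2 * pi * t - c' * (t\<^sup>2 * sqrt t) \<le> 2 * pi * t - c * (t\<^sup>2 * sqrt t)"
      using \<open>c \<le> c'\<close> by (simp add: mult_right_mono)
    then have "ennreal hausdorff2_const * ennreal (2 * pi * t - c' * (t\<^sup>2 * sqrt t)) \<le> ennreal hausdorff2_const * ennreal (2 * pi * t - c * (t\<^sup>2 * sqrt t))"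
      by (intro mult_left_mono ennreal_leI) auto
    then show "ennreal hausdorff2_const * ennreal (2 * pi * t - c' * (t\<^sup>2 * sqrt t)) \<le> gauss_area M t q"
      using h \<open>0 < t\<close> by (meson order_trans)
  qed
qed

text \<open>The parameter of the compactness argument is c = 1/\<delta>, because the bound weakens
  as \<delta> decreases.\<close>

lemma upper_uniform:
  assumes e: "0 < e"
  shows "\<exists>\<delta>>0. \<forall>q\<in>M. \<forall>t>0. gauss_area M t q \<le> ennreal (hausdorff2_const * ((1 + e) * (2 * pi * t)) + exp (- \<delta>\<^sup>2 / (2 * t)) * area)"
proof -
  have "\<exists>c. \<forall>q\<in>M. 0 < c \<and> (\<forall>t>0. gauss_area M t q \<le> ennreal (hausdorff2_const * ((1 + e) * (2 * pi * t)) + exp (- (1 / c)\<^sup>2 / (2 * t)) * area))"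
  proof (rule compact_uniform_bound[OF compact_M])
    fix p assume "p \<in> M"
    then obtain V \<phi> D \<xi> W a where "embedded_patch V \<phi> D \<xi> M W" "a \<in> V" "\<phi> a = p" by (rule chart_at)
    from embedded_patch.local_upper[OF this(1,2) e] this(3)
    obtain N \<delta> where N: "open N" "p \<in> N" "0 < \<delta>" "\<And>q t. q \<in> M \<inter> N \<Longrightarrow> 0 < t \<Longrightarrow>
       gauss_area M t q \<le> ennreal hausdorff2_const * ennreal ((1 + e) * (2 * pi * t)) + ennreal (exp (- \<delta>\<^sup>2 / (2 * t))) * emeasure hausdorff2 M"
      by blast
    have "gauss_area M t q \<le> ennreal (hausdorff2_const * ((1 + e) * (2 * pi * t)) + exp (- (1 / (1 / \<delta>))\<^sup>2 / (2 * t)) * area)"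
      if "q \<in> M \<inter> N" "0 < t" for q t
    proof -
      let ?A = "(1 + e) * (2 * pi * t)" and ?x = "exp (- \<delta>\<^sup>2 / (2 * t))"
      have "ennreal (hausdorff2_const * ?A + ?x * area) = ennreal (hausdorff2_const * ?A) + ennreal (?x * area)"
        using e that(2) hausdorff2_const_pos area_pos by (intro ennreal_plus) auto
      also have "ennreal (hausdorff2_const * ?A) = ennreal hausdorff2_const * ennreal ?A"
        using hausdorff2_const_pos by (intro ennreal_mult') simp
      also have "ennreal (?x * area) = ennreal ?x * ennreal area" by (intro ennreal_mult') simp
      finally show ?thesis using N(4)[OF that] by (simp add: emeasure_area)
    qed
    then show "\<exists>N c. open N \<and> p \<in> N \<and> (\<forall>q\<in>M \<inter> N. 0 < c \<and> (\<forall>t>0. gauss_area M t q \<le> ennreal (hausdorff2_const * ((1 + e) * (2 * pi * t)) + exp (- (1 / c)\<^sup>2 / (2 * t)) * area)))"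
      using N by (intro exI[of _ N] exI[of _ "1 / \<delta>"]) auto
  next
    fix c c' q
    assume h: "0 < c \<and> (\<forall>t>0. gauss_area M t q \<le> ennreal (hausdorff2_const * ((1 + e) * (2 * pi * t)) + exp (- (1 / c)\<^sup>2 / (2 * t)) * area))" and cc: "c \<le> c'"
    have "gauss_area M t q \<le> ennreal (hausdorff2_const * ((1 + e) * (2 * pi * t)) + exp (- (1 / c')\<^sup>2 / (2 * t)) * area)" if t: "0 < t" for t
    proof -
      have "1 / c' \<le> 1 / c" using h cc by (intro divide_left_mono) auto
      then have "(1 / c')\<^sup>2 \<le> (1 / c)\<^sup>2" using h cc by (intro power_mono) auto
      then have "exp (- (1 / c)\<^sup>2 / (2 * t)) \<le> exp (- (1 / c')\<^sup>2 / (2 * t))" using t by (simp add: divide_right_mono)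
      then have "exp (- (1 / c)\<^sup>2 / (2 * t)) * area \<le> exp (- (1 / c')\<^sup>2 / (2 * t)) * area" using area_pos by (intro mult_right_mono) auto
      then have "ennreal (hausdorff2_const * ((1 + e) * (2 * pi * t)) + exp (- (1 / c)\<^sup>2 / (2 * t)) * area)
        \<le> ennreal (hausdorff2_const * ((1 + e) * (2 * pi * t)) + exp (- (1 / c')\<^sup>2 / (2 * t)) * area)"
        by (intro ennreal_leI) simp
      then show ?thesis using h t by (meson order_trans)
    qed
    then show "0 < c' \<and> (\<forall>t>0. gauss_area M t q \<le> ennreal (hausdorff2_const * ((1 + e) * (2 * pi * t)) + exp (- (1 / c')\<^sup>2 / (2 * t)) * area))"
      using h cc by auto
  qed
  then obtain c where "\<forall>q\<in>M. 0 < c \<and> (\<forall>t>0. gauss_area M t q \<le> ennreal (hausdorff2_const * ((1 + e) * (2 * pi * t)) + exp (- (1 / c)\<^sup>2 / (2 * t)) * area))" by blast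
  then show ?thesis using nonempty by (intro exI[of _ "1 / c"]) auto
qed

lemma nn_integral_gker_mm: "(\<integral>\<^sup>+y. ennreal (gker t q y) \<partial>mm_measure M) = gauss_area M t q / ennreal area"
  by (subst nn_integral_mm) (auto simp: gauss_area_def emeasure_area)

text \<open>Measurability of partial integrals is taken from the probability measure
  \<open>mm_measure M\<close>, as Hausdorff measure on the whole space is not sigma-finite;
  multiplying by the area undoes the normalisation.\<close>

lemma measurable_gauss_area [measurable]: "gauss_area M t \<in> borel_measurable borel"
proof -
  interpret mm: prob_space "mm_measure M" by (rule prob_space_mm)
  have "(\<lambda>z. (fst z, snd z)) \<in> (borel :: (real^3) measure) \<Otimes>\<^sub>M mm_measure M \<rightarrow>\<^sub>M borel \<Otimes>\<^sub>M borel"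
    by (intro measurable_Pair measurable_fst measurable_compose[OF measurable_snd measurable_mm]) simp
  then have "(\<lambda>z. z) \<in> borel \<Otimes>\<^sub>M mm_measure M \<rightarrow>\<^sub>M (borel :: ((real^3) \<times> (real^3)) measure)"
    by (simp add: borel_prod)
  from measurable_compose[OF this gker_measurable(1)[of t]]
  have "(\<lambda>z. ennreal (gker t (fst z) (snd z))) \<in> borel_measurable (borel \<Otimes>\<^sub>M mm_measure M)" by simp
  from mm.borel_measurable_nn_integral_fst[OF this]
  have "(\<lambda>q. \<integral>\<^sup>+y. ennreal (gker t q y) \<partial>mm_measure M) \<in> borel_measurable borel" by simp
  then have "(\<lambda>q. ennreal area * (gauss_area M t q / ennreal area)) \<in> borel_measurable borel"
    unfolding nn_integral_gker_mm by measurable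
  moreover have "ennreal area * (gauss_area M t q / ennreal area) = gauss_area M t q" for q
    using area_pos by (simp add: ennreal_times_divide mult.commute[of "ennreal area"] ennreal_mult_divide_eq)
  ultimately show ?thesis by simp
qed

lemma gauss_avg_gauss_area: "ennreal area * gauss_avg t = (\<integral>\<^sup>+q. gauss_area M t q \<partial>mm_measure M)"
proof -
  have m: "gauss_area M t \<in> borel_measurable (mm_measure M)" by (intro measurable_mm measurable_gauss_area)
  have "gauss_avg t = (\<integral>\<^sup>+q. gauss_area M t q \<partial>mm_measure M) / ennreal area"
    unfolding gauss_avg_def nn_integral_gker_mm by (rule nn_integral_divide[OF m])
  then show ?thesis
    using area_pos by (simp add: ennreal_times_divide mult.commute[of "ennreal area"] ennreal_mult_divide_eq)
qed

lemma emeasure_mm_le: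
  assumes A [measurable]: "A \<in> sets borel" "A \<subseteq> M"
  shows "(\<integral>\<^sup>+q. indicator A q \<partial>mm_measure M) = emeasure hausdorff2 A / ennreal area"
proof -
  have "(\<integral>\<^sup>+q. indicator A q \<partial>mm_measure M) = (\<integral>\<^sup>+q. indicator A q * indicator M q \<partial>hausdorff2) / ennreal area"
    unfolding emeasure_area[symmetric] by (rule nn_integral_mm) simp
  also have "(\<integral>\<^sup>+q. indicator A q * indicator M q \<partial>hausdorff2) = (\<integral>\<^sup>+q. indicator A q \<partial>hausdorff2)"
    using A(2) by (intro nn_integral_cong) (auto simp: indicator_def)
  finally show ?thesis by simp
qed

end

text \<open>The limit t to 0 of an inequality with linear error.\<close>

lemma le_if_le_add_linear:
  fixes a b L :: real
  assumes "\<And>t. 0 < t \<Longrightarrow> t < 1 \<Longrightarrow> a \<le> L + b * t"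
  shows "a \<le> L"
proof (rule field_le_epsilon)
  fix e :: real assume "0 < e"
  define t where "t = min (1/2) (e / (\<bar>b\<bar> + 1))"
  have t: "0 < t" "t < 1" using \<open>0 < e\<close> by (auto simp: t_def)
  have "b * t \<le> (\<bar>b\<bar> + 1) * t" using t by (intro mult_right_mono) auto
  also have "\<dots> \<le> (\<bar>b\<bar> + 1) * (e / (\<bar>b\<bar> + 1))" by (intro mult_left_mono) (auto simp: t_def)
  also have "\<dots> = e" using abs_ge_zero[of b] by (simp add: add_nonneg_eq_0_iff)
  finally show "a \<le> L + e" using assms[OF t] by linarith
qed

section \<open>Comparing the averages: area and umbilicity\<close>

context closed_surface
begin

text \<open>The lower bound for the sphere's average meets the leading-order upper bound on M. After
  division by t, first t and then e tend to 0.\<close>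

lemma area_le:
  assumes low: "\<And>t. 0 < t \<Longrightarrow> ennreal (t / 2 * (1 - t / 2)) \<le> gauss_avg t"
  shows "area \<le> 4 * pi * hausdorff2_const"
proof -
  interpret mm: prob_space "mm_measure M" by (rule prob_space_mm)
  have eps: "1 / 2 * area \<le> 2 * pi * hausdorff2_const * (1 + e)" if e: "0 < e" for e
  proof -
    obtain \<delta> where \<delta>: "0 < \<delta>" and up: "\<And>q t. q \<in> M \<Longrightarrow> 0 < t \<Longrightarrow>
        gauss_area M t q \<le> ennreal (hausdorff2_const * ((1 + e) * (2 * pi * t)) + exp (- \<delta>\<^sup>2 / (2 * t)) * area)"
      using upper_uniform[OF e] by blast
    have "1 / 2 * area \<le> 2 * pi * hausdorff2_const * (1 + e) + (area / 4 + 8 * area / \<delta>^4) * t" if t: "0 < t" "t < 1" for t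
    proof -
      let ?A = "hausdorff2_const * ((1 + e) * (2 * pi * t)) + exp (- \<delta>\<^sup>2 / (2 * t)) * area"
      have A0: "0 \<le> ?A" using hausdorff2_const_pos e t area_pos by simp
      have "ennreal area * ennreal (t / 2 * (1 - t / 2)) \<le> ennreal area * gauss_avg t"
        by (intro mult_left_mono low t) simp
      also have "\<dots> = (\<integral>\<^sup>+q. gauss_area M t q \<partial>mm_measure M)" by (rule gauss_avg_gauss_area)
      also have "\<dots> \<le> (\<integral>\<^sup>+q. ennreal ?A \<partial>mm_measure M)"
        by (intro nn_integral_mono up t) simp
      also have "\<dots> = ennreal ?A" using mm.emeasure_space_1 by simp
      finally have "area * (t / 2 * (1 - t / 2)) \<le> ?A"
        using A0 area_pos t by (simp add: ennreal_mult'[symmetric])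
      \<comment> \<open>From exp x \<ge> x^2/2: the contribution of distant points is of order t^2
        and vanishes after division by t.\<close>
      moreover have "exp (- \<delta>\<^sup>2 / (2 * t)) \<le> 8 * t\<^sup>2 / \<delta>^4"
      proof -
        define x where "x = \<delta>\<^sup>2 / (2 * t)"
        have x: "0 < x" using \<delta> t by (simp add: x_def)
        have "x\<^sup>2 / 2 \<le> exp x" using exp_lower_Taylor_quadratic[of x] x by simp
        then have "exp (- x) \<le> 2 / x\<^sup>2" using x by (simp add: exp_minus field_simps)
        also have "\<dots> = 8 * t\<^sup>2 / \<delta>^4" using t \<delta> by (simp add: x_def power_divide field_simps)
        finally show ?thesis by (simp add: x_def)
      qed
      then have "exp (- \<delta>\<^sup>2 / (2 * t)) * area \<le> 8 * t\<^sup>2 / \<delta>^4 * area" using area_pos by (intro mult_right_mono) auto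
      ultimately have "area * (t / 2 * (1 - t / 2)) \<le> hausdorff2_const * ((1 + e) * (2 * pi * t)) + 8 * t\<^sup>2 / \<delta>^4 * area" by linarith
      then have "t * (1 / 2 * area) \<le> t * (2 * pi * hausdorff2_const * (1 + e) + (area / 4 + 8 * area / \<delta>^4) * t)"
        by (simp add: algebra_simps power2_eq_square)
      then show ?thesis using t by simp
    qed
    then show ?thesis by (rule le_if_le_add_linear)
  qed
  have "1 / 2 * area \<le> 2 * pi * hausdorff2_const + (2 * pi * hausdorff2_const) * e" if "0 < e" "e < 1" for e
    using eps[OF that(1)] by (simp add: algebra_simps)
  then have "1 / 2 * area \<le> 2 * pi * hausdorff2_const" by (rule le_if_le_add_linear)
  then show ?thesis by simp
qed

lemma area_ge:
  assumes up: "\<And>t. 0 < t \<Longrightarrow> gauss_avg t \<le> ennreal (t / 2)"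
  shows "4 * pi * hausdorff2_const \<le> area"
proof -
  interpret mm: prob_space "mm_measure M" by (rule prob_space_mm)
  obtain C where C: "\<And>q t. q \<in> M \<Longrightarrow> 0 < t \<Longrightarrow> ennreal hausdorff2_const * ennreal (2 * pi * t - C * (t\<^sup>2 * sqrt t)) \<le> gauss_area M t q"
    using lower_uniform by blast
  have "2 * pi * hausdorff2_const \<le> 1 / 2 * area + (hausdorff2_const * \<bar>C\<bar>) * t" if t: "0 < t" "t < 1" for t
  proof -
    let ?L = "2 * pi * t - C * (t\<^sup>2 * sqrt t)"
    have "ennreal hausdorff2_const * ennreal ?L = (\<integral>\<^sup>+q. ennreal hausdorff2_const * ennreal ?L \<partial>mm_measure M)"
      using mm.emeasure_space_1 by simp
    also have "\<dots> \<le> (\<integral>\<^sup>+q. gauss_area M t q \<partial>mm_measure M)" by (intro nn_integral_mono C t) simp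
    also have "\<dots> = ennreal area * gauss_avg t" by (rule gauss_avg_gauss_area[symmetric])
    also have "\<dots> \<le> ennreal area * ennreal (t / 2)" by (intro mult_left_mono up t) simp
    finally have "ennreal (hausdorff2_const * ?L) \<le> ennreal (area * (t / 2))"
      unfolding ennreal_mult'[OF less_imp_le[OF hausdorff2_const_pos]] ennreal_mult'[OF less_imp_le[OF area_pos]] .
    then have 1: "hausdorff2_const * ?L \<le> area * (t / 2)" using area_pos t by (simp add: ennreal_le_iff)
    have "C * (t\<^sup>2 * sqrt t) \<le> \<bar>C\<bar> * (t\<^sup>2 * 1)"
      using t by (intro mult_mono) auto
    then have "hausdorff2_const * (2 * pi * t - \<bar>C\<bar> * t\<^sup>2) \<le> hausdorff2_const * ?L"
      using hausdorff2_const_pos by (intro mult_left_mono) auto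
    with 1 have "hausdorff2_const * (2 * pi * t - \<bar>C\<bar> * t\<^sup>2) \<le> area * (t / 2)" by linarith
    then have "t * (2 * pi * hausdorff2_const) \<le> t * (1 / 2 * area + (hausdorff2_const * \<bar>C\<bar>) * t)"
      by (simp add: algebra_simps power2_eq_square)
    then show ?thesis using t by simp
  qed
  then have "2 * pi * hausdorff2_const \<le> 1 / 2 * area" by (rule le_if_le_add_linear)
  then show ?thesis by simp
qed

text \<open>One nonumbilic point yields an open set of them. Its image is covered by countably many
  sets \<open>A k\<close> on which the gain over 2 pi t is uniform, so some \<open>A k\<close> has
  positive area. Integrating, the gain of order t^2 on it must not exceed the loss C t^(5/2) on M,
  which fails for small t.\<close>

lemma all_umbilic:
  assumes up: "\<And>t. 0 < t \<Longrightarrow> gauss_avg t \<le> ennreal (t / 2)" and ar: "area = 4 * pi * hausdorff2_const"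
    and patch: "embedded_patch V \<phi> D \<xi> M W" and a0: "a0 \<in> V"
  shows "embedded_patch.umb D a0"
proof (rule ccontr)
  interpret embedded_patch V \<phi> D \<xi> M W by fact
  interpret mm: prob_space "mm_measure M" by (rule prob_space_mm)
  assume "\<not> umb a0"
  define U where "U = {a \<in> V. \<not> umb a}"
  have U: "open U" "U \<subseteq> V" "U \<noteq> {}" using open_nonumbilic a0 \<open>\<not> umb a0\<close> by (auto simp: U_def)
  let ?c = "hausdorff2_const"
  \<comment> \<open>A sequence of scales makes \<open>A k\<close> a countable intersection, hence
    Borel. The sets are described by \<open>gauss_area\<close> because its measurability is at
    hand.\<close>
  define T where "T = (\<lambda>n::nat. 1 / (real n + 1))"
  have T: "0 < T n" "T n \<le> 1" for n by (auto simp: T_def)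
  define A where "A = (\<lambda>k::nat. M \<inter> {q. \<forall>n\<ge>k. ennreal ?c * ennreal (2 * pi * T n * (1 + T n / (real k + 1))) \<le> gauss_area M (T n) q})"
  have Ab [measurable]: "A k \<in> sets borel" for k
  proof -
    have "Measurable.pred borel (\<lambda>q. \<forall>n\<ge>k. ennreal ?c * ennreal (2 * pi * T n * (1 + T n / (real k + 1))) \<le> gauss_area M (T n) q)"
      by measurable
    then have "{q. \<forall>n\<ge>k. ennreal ?c * ennreal (2 * pi * T n * (1 + T n / (real k + 1))) \<le> gauss_area M (T n) q} \<in> sets borel"
      by (simp add: pred_def)
    then show ?thesis unfolding A_def by (intro sets.Int M_borel)
  qed
  have AM: "A k \<subseteq> M" for k unfolding A_def by (rule Int_lower1)
  have cover: "\<phi> ` U \<subseteq> (\<Union>k. A k)"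
  proof clarify
    fix a assume a: "a \<in> U"
    then obtain \<kappa> C where \<kappa>: "0 < \<kappa>" "0 \<le> C" and low: "\<And>t. 0 < t \<Longrightarrow>
        ennreal ?c * ennreal (2 * pi * t * (1 + t * \<kappa>) - C * (t\<^sup>2 * sqrt t)) \<le> gauss_area M t (\<phi> a)"
      using local_lower(2)[of a] by (auto simp: U_def)
    \<comment> \<open>Half of the gain 2 pi \<kappa> t^2 pays for the error once sqrt t \<le> pi
      \<kappa> / C; the other half exceeds 2 pi t^2 / (k + 1) once k \<ge> 2/\<kappa>.\<close>
    obtain k :: nat where k: "max (2 / \<kappa>) ((C / (pi * \<kappa>))\<^sup>2) \<le> real k" using real_arch_simple by blast
    have "\<phi> a \<in> A k"
      unfolding A_def
    proof (intro IntI CollectI allI impI)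
      show "\<phi> a \<in> M" using a image_sub[OF U(2)] by blast
      fix n assume n: "k \<le> n"
      have "C * sqrt (T n) \<le> pi * \<kappa>"
      proof -
        have "(C / (pi * \<kappa>))\<^sup>2 \<le> real n + 1" using k n by simp
        then have "\<bar>C / (pi * \<kappa>)\<bar> \<le> sqrt (real n + 1)" using real_le_rsqrt abs_le_square_iff
          by (metis power2_abs real_le_rsqrt)
        then have "C \<le> pi * \<kappa> * sqrt (real n + 1)" using \<kappa> by (simp add: divide_le_eq mult.commute)
        then show ?thesis by (simp add: T_def real_sqrt_divide divide_le_eq)
      qed
      moreover have "2 * pi / (real k + 1) \<le> pi * \<kappa>"
      proof -
        have "2 \<le> \<kappa> * real k" using k \<kappa> by (simp add: divide_le_eq mult.commute)
        then have "2 \<le> \<kappa> * (real k + 1)" using \<kappa> by (simp add: algebra_simps)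
        then have "pi * 2 \<le> pi * (\<kappa> * (real k + 1))" by (intro mult_left_mono) auto
        then show ?thesis by (simp add: divide_le_eq algebra_simps)
      qed
      ultimately have "C * sqrt (T n) + 2 * pi / (real k + 1) \<le> 2 * pi * \<kappa>" by linarith
      then have "(T n)\<^sup>2 * (C * sqrt (T n) + 2 * pi / (real k + 1)) \<le> (T n)\<^sup>2 * (2 * pi * \<kappa>)" by (intro mult_left_mono) auto
      then have "2 * pi * T n * (1 + T n / (real k + 1)) \<le> 2 * pi * T n * (1 + T n * \<kappa>) - C * ((T n)\<^sup>2 * sqrt (T n))"
        by (simp add: algebra_simps power2_eq_square)
      then have "ennreal ?c * ennreal (2 * pi * T n * (1 + T n / (real k + 1))) \<le> ennreal ?c * ennreal (2 * pi * T n * (1 + T n * \<kappa>) - C * ((T n)\<^sup>2 * sqrt (T n)))"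
        by (intro mult_left_mono ennreal_leI) auto
      also have "\<dots> \<le> gauss_area M (T n) (\<phi> a)" by (rule low[OF T(1)])
      finally show "ennreal ?c * ennreal (2 * pi * T n * (1 + T n / (real k + 1))) \<le> gauss_area M (T n) (\<phi> a)" .
    qed
    then show "\<phi> a \<in> (\<Union>k. A k)" by blast
  qed
  have "\<exists>k. emeasure hausdorff2 (A k) \<noteq> 0"
  proof (rule ccontr)
    assume "\<not> ?thesis"
    then have "A k \<in> null_sets hausdorff2" for k by (auto simp: null_sets_def)
    then have "(\<Union>k. A k) \<in> null_sets hausdorff2" by (rule null_sets_UN)
    then have "\<phi> ` U \<in> null_sets hausdorff2"
      by (rule null_sets_subset[OF _ _ cover]) (use phi_image_borel[OF _ U(2)] U(1) in simp)
    then show False using image_positive[OF U] by (simp add: null_sets_def)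
  qed
  then obtain k where k: "emeasure hausdorff2 (A k) \<noteq> 0" by blast
  define m where "m = enn2real (emeasure hausdorff2 (A k) / ennreal area)"
  have "emeasure hausdorff2 (A k) \<le> emeasure hausdorff2 M" by (intro emeasure_mono AM) simp
  then have "emeasure hausdorff2 (A k) \<noteq> \<top>" using finite_area by (auto simp: top_unique)
  then have mt: "emeasure hausdorff2 (A k) / ennreal area \<noteq> \<top>" "emeasure hausdorff2 (A k) / ennreal area \<noteq> 0"
    using k area_pos by (auto simp: ennreal_divide_eq_top_iff)
  have m: "0 < m" "ennreal m = emeasure hausdorff2 (A k) / ennreal area"
    unfolding m_def using mt by (auto simp: enn2real_positive_iff less_top zero_less_iff_neq_zero)
  have im: "(\<integral>\<^sup>+q. indicator (A k) q \<partial>mm_measure M) = ennreal m"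
    unfolding m(2) by (rule emeasure_mm_le[OF Ab AM])
  obtain C0 where C0: "\<And>q t. q \<in> M \<Longrightarrow> 0 < t \<Longrightarrow> ennreal ?c * ennreal (2 * pi * t - C0 * (t\<^sup>2 * sqrt t)) \<le> gauss_area M t q"
    using lower_uniform by blast
  define C where "C = max 1 C0"
  have C: "ennreal ?c * ennreal (2 * pi * t - C * (t\<^sup>2 * sqrt t)) \<le> gauss_area M t q" if "q \<in> M" "0 < t" for q t
  proof -
    have "2 * pi * t - C * (t\<^sup>2 * sqrt t) \<le> 2 * pi * t - C0 * (t\<^sup>2 * sqrt t)"
      using that by (simp add: C_def mult_right_mono)
    then have "ennreal ?c * ennreal (2 * pi * t - C * (t\<^sup>2 * sqrt t)) \<le> ennreal ?c * ennreal (2 * pi * t - C0 * (t\<^sup>2 * sqrt t))"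
      by (intro mult_left_mono ennreal_leI) auto
    then show ?thesis using C0[OF that] by (rule order_trans)
  qed
  have key: "2 * pi * m / (real k + 1) \<le> C * sqrt (T n)" if n: "k \<le> n" "C \<le> real n" for n
  proof -
    let ?t = "T n"
    let ?L = "2 * pi * ?t - C * (?t\<^sup>2 * sqrt ?t)" and ?G = "2 * pi * ?t\<^sup>2 / (real k + 1)"
    \<comment> \<open>For n \<ge> C the quantity ?L is nonnegative, so \<open>ennreal\<close> does
      not truncate it and sums can be formed.\<close>
    have "C * ?t \<le> 1" using n by (simp add: T_def divide_le_eq)
    then have "C * ?t * (?t * sqrt ?t) \<le> 1 * (?t * 1)" using T[of n] by (intro mult_mono) (auto simp: C_def)
    also have "\<dots> \<le> 2 * pi * ?t" using T[of n] pi_gt3 mult_right_mono[of 1 "2 * pi" "T n"] by simp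
    finally have L0: "0 \<le> ?L" by (simp add: power2_eq_square mult_ac)
    have G0: "0 \<le> ?G" by simp
    have point: "ennreal (?c * ?L) + ennreal (?c * ?G) * indicator (A k) q \<le> gauss_area M ?t q" if q: "q \<in> M" for q
    proof (cases "q \<in> A k")
      case True
      have "?L + ?G \<le> 2 * pi * ?t * (1 + ?t / (real k + 1))"
        using T[of n] by (simp add: C_def algebra_simps power2_eq_square)
      then have "?c * (?L + ?G) \<le> ?c * (2 * pi * ?t * (1 + ?t / (real k + 1)))" using hausdorff2_const_pos by (intro mult_left_mono) auto
      have "ennreal (?c * ?L) + ennreal (?c * ?G) = ennreal (?c * (?L + ?G))"
        using L0 G0 hausdorff2_const_pos by (subst ennreal_plus[symmetric]) (auto simp: distrib_left)
      also have "\<dots> \<le> ennreal (?c * (2 * pi * ?t * (1 + ?t / (real k + 1))))" by (rule ennreal_leI) fact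
      also have "\<dots> = ennreal ?c * ennreal (2 * pi * ?t * (1 + ?t / (real k + 1)))"
        using hausdorff2_const_pos by (intro ennreal_mult') simp
      also have "\<dots> \<le> gauss_area M ?t q" using True n(1) by (auto simp: A_def)
      finally show ?thesis using True by simp
    next
      case False
      have "ennreal (?c * ?L) = ennreal ?c * ennreal ?L" using hausdorff2_const_pos by (intro ennreal_mult') simp
      then show ?thesis using False C[OF q T(1)] by simp
    qed
    have "ennreal (?c * ?L) + ennreal (?c * ?G) * ennreal m = (\<integral>\<^sup>+q. ennreal (?c * ?L) + ennreal (?c * ?G) * indicator (A k) q \<partial>mm_measure M)"
    proof -
      have mi: "(\<lambda>q. indicator (A k) q :: ennreal) \<in> borel_measurable (mm_measure M)" by (intro measurable_mm) simp
      have "(\<integral>\<^sup>+q. ennreal (?c * ?L) + ennreal (?c * ?G) * indicator (A k) q \<partial>mm_measure M)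
        = (\<integral>\<^sup>+q. ennreal (?c * ?L) \<partial>mm_measure M) + (\<integral>\<^sup>+q. ennreal (?c * ?G) * indicator (A k) q \<partial>mm_measure M)"
        using mi by (intro nn_integral_add) auto
      also have "(\<integral>\<^sup>+q. ennreal (?c * ?G) * indicator (A k) q \<partial>mm_measure M) = ennreal (?c * ?G) * ennreal m"
        unfolding im[symmetric] by (rule nn_integral_cmult[OF mi])
      finally show ?thesis using mm.emeasure_space_1 by simp
    qed
    also have "\<dots> \<le> (\<integral>\<^sup>+q. gauss_area M ?t q \<partial>mm_measure M)" by (intro nn_integral_mono point) simp
    also have "\<dots> = ennreal area * gauss_avg ?t" by (rule gauss_avg_gauss_area[symmetric])
    also have "\<dots> \<le> ennreal area * ennreal (?t / 2)" by (intro mult_left_mono up T) simp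
    also have "\<dots> = ennreal (area * (?t / 2))" using area_pos by (intro ennreal_mult'[symmetric]) simp
    also have "ennreal (?c * ?L) + ennreal (?c * ?G) * ennreal m = ennreal (?c * ?L + ?c * ?G * m)"
    proof -
      have "ennreal (?c * ?L + ?c * ?G * m) = ennreal (?c * ?L) + ennreal (?c * ?G * m)"
        using L0 G0 hausdorff2_const_pos m(1) by (intro ennreal_plus mult_nonneg_nonneg) auto
      also have "ennreal (?c * ?G * m) = ennreal (?c * ?G) * ennreal m"
        using G0 hausdorff2_const_pos by (intro ennreal_mult' mult_nonneg_nonneg) auto
      finally show ?thesis by simp
    qed
    finally have "?c * ?L + ?c * ?G * m \<le> area * (?t / 2)"
      using area_pos T[of n] by (simp add: ennreal_le_iff)
    then have "?c * (?L + ?G * m) \<le> ?c * (2 * pi * ?t)" unfolding ar by (simp add: algebra_simps)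
    then have "?L + ?G * m \<le> 2 * pi * ?t" using hausdorff2_const_pos by simp
    then have "?t\<^sup>2 * (2 * pi * m / (real k + 1)) \<le> ?t\<^sup>2 * (C * sqrt ?t)" by (simp add: algebra_simps)
    then show ?thesis by (rule mult_left_le_imp_le) (use T(1)[of n] in simp)
  qed
  define x where "x = 2 * pi * m / (real k + 1)"
  have x: "0 < x" using m(1) by (simp add: x_def)
  \<comment> \<open>From n \<ge> (C/x)^2 follows C sqrt (T n) < x, against the bound of
    \<open>key\<close>.\<close>
  obtain n :: nat where n: "max (max (real k) C) ((C / x)\<^sup>2) \<le> real n" using real_arch_simple by blast
  have "x \<le> C * sqrt (T n)" unfolding x_def using n by (intro key) auto
  then have "x\<^sup>2 \<le> (C * sqrt (T n))\<^sup>2" using x by (intro power_mono) auto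
  then have "x\<^sup>2 \<le> C\<^sup>2 * T n" using T[of n] by (simp add: power_mult_distrib)
  then have "x\<^sup>2 * (real n + 1) \<le> C\<^sup>2" by (simp add: T_def field_simps)
  moreover have "C\<^sup>2 \<le> x\<^sup>2 * real n" using n x by (simp add: power_divide divide_le_eq mult.commute)
  ultimately have "x\<^sup>2 * (real n + 1) \<le> x\<^sup>2 * real n" by linarith
  then have "x\<^sup>2 \<le> 0" by (simp add: algebra_simps)
  then show False using x by simp
qed

end

section \<open>Totally umbilic surfaces\<close>

text \<open>The mean value inequality, applied along u to the increment in direction v minus its
  expected value. Only differentiability at a of the directional derivative along u enters.\<close>

lemma second_difference_bound:
  fixes f :: "'a::real_normed_vector \<Rightarrow> 'b::real_normed_vector"
  assumes "open V" "a \<in> V" and d: "\<And>x. x \<in> V \<Longrightarrow> (f has_derivative f' x) (at x)"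
    and F: "((\<lambda>x. f' x u) has_derivative F) (at a)" and e: "0 < e"
  shows "\<exists>s0>0. \<forall>s. 0 < s \<and> s < s0 \<longrightarrow>
     norm (f (a + s *\<^sub>R u + s *\<^sub>R v) - f (a + s *\<^sub>R u) - f (a + s *\<^sub>R v) + f a - s\<^sup>2 *\<^sub>R F v) \<le> e * s\<^sup>2"
proof -
  let ?m = "norm u + norm v + 1"
  have m0: "0 < ?m" by (simp add: add_nonneg_pos)
  \<comment> \<open>Half of e for each of the two edges of the parallelogram, whose points are
    within s ?m of a.\<close>
  define \<epsilon> where "\<epsilon> = e / (2 * ?m)"
  have \<epsilon>: "0 < \<epsilon>" using e m0 by (simp add: \<epsilon>_def)
  obtain d1 where d1: "0 < d1" "\<And>y. norm (y - a) < d1 \<Longrightarrow> norm (f' y u - f' a u - F (y - a)) \<le> \<epsilon> * norm (y - a)"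
    using F \<epsilon> unfolding has_derivative_at_alt by blast
  obtain d2 where d2: "0 < d2" "ball a d2 \<subseteq> V" using \<open>open V\<close> \<open>a \<in> V\<close> openE by blast
  define s0 where "s0 = min d1 d2 / ?m"
  have linF: "linear F" using F has_derivative_linear by blast
  have "norm (f (a + s *\<^sub>R u + s *\<^sub>R v) - f (a + s *\<^sub>R u) - f (a + s *\<^sub>R v) + f a - s\<^sup>2 *\<^sub>R F v) \<le> e * s\<^sup>2"
    if s: "0 < s" "s < s0" for s
  proof -
    have sm: "s * ?m < d1" "s * ?m < d2" using s m0 by (auto simp: s0_def field_simps)
    have near: "norm (\<tau> *\<^sub>R u + \<sigma> *\<^sub>R v) \<le> s * ?m" if "\<tau> \<in> {0..s}" "\<sigma> \<in> {0..s}" for \<tau> \<sigma>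
    proof -
      have "norm (\<tau> *\<^sub>R u + \<sigma> *\<^sub>R v) \<le> \<tau> * norm u + \<sigma> * norm v" using that norm_triangle_ineq[of "\<tau> *\<^sub>R u" "\<sigma> *\<^sub>R v"] by simp
      also have "\<dots> \<le> s * norm u + s * norm v" using that by (intro add_mono mult_right_mono) auto
      also have "\<dots> \<le> s * ?m" using s by (simp add: algebra_simps)
      finally show ?thesis .
    qed
    have inV: "a + (\<tau> *\<^sub>R u + \<sigma> *\<^sub>R v) \<in> V" if "\<tau> \<in> {0..s}" "\<sigma> \<in> {0..s}" for \<tau> \<sigma>
    proof -
      have "dist a (a + (\<tau> *\<^sub>R u + \<sigma> *\<^sub>R v)) = norm (\<tau> *\<^sub>R u + \<sigma> *\<^sub>R v)"
        by (metis add_diff_cancel_left' dist_commute dist_norm)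
      then show ?thesis using near[OF that] sm by (intro subsetD[OF d2(2)]) (simp only: mem_ball)
    qed
    let ?h = "\<lambda>\<tau>. f (a + (\<tau> *\<^sub>R u + s *\<^sub>R v)) - f (a + (\<tau> *\<^sub>R u + 0 *\<^sub>R v)) - (\<tau> * s) *\<^sub>R F v"
    let ?h' = "\<lambda>\<tau>. f' (a + (\<tau> *\<^sub>R u + s *\<^sub>R v)) u - f' (a + (\<tau> *\<^sub>R u + 0 *\<^sub>R v)) u - s *\<^sub>R F v"
    have "norm (?h s - ?h 0) \<le> (e * s) * norm (s - 0)"
    proof (rule differentiable_bound[where S = "{0..s}"])
      fix \<tau> assume \<tau>: "\<tau> \<in> {0..s}"
      have line: "((\<lambda>\<tau>. f (a + (\<tau> *\<^sub>R u + \<sigma> *\<^sub>R v))) has_derivative (\<lambda>k. k *\<^sub>R f' (a + (\<tau> *\<^sub>R u + \<sigma> *\<^sub>R v)) u)) (at \<tau>)" if "\<sigma> \<in> {0..s}" for \<sigma>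
      proof -
        have dd: "(f has_derivative f' (a + (\<tau> *\<^sub>R u + \<sigma> *\<^sub>R v))) (at (a + (\<tau> *\<^sub>R u + \<sigma> *\<^sub>R v)))" by (rule d[OF inV[OF \<tau> that]])
        have "((\<lambda>\<tau>. f (a + (\<tau> *\<^sub>R u + \<sigma> *\<^sub>R v))) has_derivative (\<lambda>k. f' (a + (\<tau> *\<^sub>R u + \<sigma> *\<^sub>R v)) (k *\<^sub>R u))) (at \<tau>)"
          by (rule has_derivative_compose[where f = "\<lambda>\<tau>. a + (\<tau> *\<^sub>R u + \<sigma> *\<^sub>R v)" and g = f, OF _ dd])
             (auto intro!: derivative_eq_intros)
        then show ?thesis by (simp add: linear_scale[OF has_derivative_linear[OF dd]])
      qed
      have "((\<lambda>\<tau>. (\<tau> * s) *\<^sub>R F v) has_derivative (\<lambda>k. (k * s) *\<^sub>R F v)) (at \<tau>)"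
        by (auto intro!: derivative_eq_intros)
      from has_derivative_diff[OF has_derivative_diff[OF line[of s] line[of 0]] this]
      have "(?h has_derivative (\<lambda>k. k *\<^sub>R ?h' \<tau>)) (at \<tau>)"
        using s by (simp add: scaleR_diff_right)
      then show "(?h has_derivative (\<lambda>k. k *\<^sub>R ?h' \<tau>)) (at \<tau> within {0..s})" by (rule has_derivative_at_withinI)
      have b: "norm (f' (a + (\<tau> *\<^sub>R u + \<sigma> *\<^sub>R v)) u - f' a u - F (\<tau> *\<^sub>R u + \<sigma> *\<^sub>R v)) \<le> \<epsilon> * (s * ?m)" if "\<sigma> \<in> {0..s}" for \<sigma>
      proof -
        have n: "norm (\<tau> *\<^sub>R u + \<sigma> *\<^sub>R v) \<le> s * ?m" by (rule near[OF \<tau> that])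
        have "norm (f' (a + (\<tau> *\<^sub>R u + \<sigma> *\<^sub>R v)) u - f' a u - F (\<tau> *\<^sub>R u + \<sigma> *\<^sub>R v)) \<le> \<epsilon> * norm (\<tau> *\<^sub>R u + \<sigma> *\<^sub>R v)"
          using d1(2)[of "a + (\<tau> *\<^sub>R u + \<sigma> *\<^sub>R v)"] n sm by simp
        also have "\<dots> \<le> \<epsilon> * (s * ?m)" using n \<epsilon> by (intro mult_left_mono) auto
        finally show ?thesis .
      qed
      have "?h' \<tau> = (f' (a + (\<tau> *\<^sub>R u + s *\<^sub>R v)) u - f' a u - F (\<tau> *\<^sub>R u + s *\<^sub>R v)) - (f' (a + (\<tau> *\<^sub>R u + 0 *\<^sub>R v)) u - f' a u - F (\<tau> *\<^sub>R u + 0 *\<^sub>R v))"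
        by (simp add: linear_add[OF linF] linear_scale[OF linF] linear_0[OF linF])
      moreover have "s \<in> {0..s}" "0 \<in> {0..s}" using s by auto
      ultimately have "norm (?h' \<tau>) \<le> \<epsilon> * (s * ?m) + \<epsilon> * (s * ?m)"
        using norm_triangle_le_diff[OF add_mono[OF b[of s] b[of 0]]] by (simp only:)
      also have "\<dots> = s * (2 * (\<epsilon> * ?m))" by (simp add: algebra_simps)
      also have "2 * (\<epsilon> * ?m) = e"
      proof -
        have "2 * (e / (2 * m) * m) = e" if "0 < m" for m using that by simp
        then show ?thesis unfolding \<epsilon>_def using m0 by blast
      qed
      also have "s * e = e * s" by simp
      finally have "norm (?h' \<tau>) \<le> e * s" .
      then show "onorm (\<lambda>k. k *\<^sub>R ?h' \<tau>) \<le> e * s"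
        using e s by (intro onorm_bound) (auto simp: mult.commute intro!: mult_left_mono)
    qed (use s in auto)
    then show ?thesis using s by (simp add: power2_eq_square algebra_simps)
  qed
  moreover have "0 < s0" using d1 d2 m0 by (simp add: s0_def)
  ultimately show ?thesis by blast
qed

text \<open>The second difference is symmetric in u and v, so F v and G u approximate the same
  quantity.\<close>

lemma second_derivative_symmetric:
  fixes f :: "'a::real_normed_vector \<Rightarrow> 'b::real_normed_vector"
  assumes V: "open V" "a \<in> V" and d: "\<And>x. x \<in> V \<Longrightarrow> (f has_derivative f' x) (at x)"
    and F: "((\<lambda>x. f' x u) has_derivative F) (at a)" and G: "((\<lambda>x. f' x v) has_derivative G) (at a)"
  shows "F v = G u"
proof -
  have "norm (F v - G u) \<le> 0 + e" if e: "0 < e" for e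
  proof -
    obtain s1 where s1: "0 < s1" "\<And>s. 0 < s \<Longrightarrow> s < s1 \<Longrightarrow>
       norm (f (a + s *\<^sub>R u + s *\<^sub>R v) - f (a + s *\<^sub>R u) - f (a + s *\<^sub>R v) + f a - s\<^sup>2 *\<^sub>R F v) \<le> e / 2 * s\<^sup>2"
      using second_difference_bound[OF V d F, of "e / 2" v] e by auto
    obtain s2 where s2: "0 < s2" "\<And>s. 0 < s \<Longrightarrow> s < s2 \<Longrightarrow>
       norm (f (a + s *\<^sub>R v + s *\<^sub>R u) - f (a + s *\<^sub>R v) - f (a + s *\<^sub>R u) + f a - s\<^sup>2 *\<^sub>R G u) \<le> e / 2 * s\<^sup>2"
      using second_difference_bound[OF V d G, of "e / 2" u] e by auto
    define s where "s = min s1 s2 / 2"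
    have s: "0 < s" "s < s1" "s < s2" using s1 s2 by (auto simp: s_def)
    let ?\<Delta> = "f (a + s *\<^sub>R u + s *\<^sub>R v) - f (a + s *\<^sub>R u) - f (a + s *\<^sub>R v) + f a"
    have 1: "norm (?\<Delta> - s\<^sup>2 *\<^sub>R F v) \<le> e / 2 * s\<^sup>2" by (rule s1(2)[OF s(1,2)])
    have 2: "norm (?\<Delta> - s\<^sup>2 *\<^sub>R G u) \<le> e / 2 * s\<^sup>2" using s2(2)[OF s(1,3)] by (simp add: algebra_simps)
    have "s\<^sup>2 *\<^sub>R (F v - G u) = (?\<Delta> - s\<^sup>2 *\<^sub>R G u) - (?\<Delta> - s\<^sup>2 *\<^sub>R F v)" by (simp add: scaleR_diff_right)
    then have "norm (s\<^sup>2 *\<^sub>R (F v - G u)) \<le> e / 2 * s\<^sup>2 + e / 2 * s\<^sup>2"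
      using norm_triangle_le_diff[OF add_mono[OF 2 1]] by simp
    moreover have "norm (s\<^sup>2 *\<^sub>R (F v - G u)) = s\<^sup>2 * norm (F v - G u)" by simp
    ultimately have "s\<^sup>2 * norm (F v - G u) \<le> s\<^sup>2 * e" by (simp only:) (simp add: mult.commute)
    then show ?thesis using s(1) by simp
  qed
  then have "norm (F v - G u) \<le> 0" by (rule field_le_epsilon)
  then show ?thesis by simp
qed

context embedded_patch
begin

text \<open>The classical argument: differentiating DN = kf D and using symmetry of the second
  derivatives of the normal and of \<phi> relates the two partial derivatives of \<open>kf\<close>.
  By linear independence of the tangent vectors both vanish, so \<open>kf\<close> is
  constant.\<close>

lemma umbilic_patch:
  assumes umb: "\<And>x. x \<in> V \<Longrightarrow> umb x" and U: "open U" "convex U" "U \<subseteq> V"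
  shows "\<exists>k. \<forall>x\<in>U. \<forall>v. DN x v = k *\<^sub>R D x v"
proof (cases "U = {}")
  case False
  let ?e1 = "axis 1 1 :: real^2" and ?e2 = "axis 2 1 :: real^2"
  have nz: "D a ?e1 \<noteq> 0" if "a \<in> V" for a using cr_nonzero[OF that] by (auto simp: cr_def)
  define kf where "kf = (\<lambda>a. (DN a ?e1 \<bullet> D a ?e1) / (D a ?e1 \<bullet> D a ?e1))"
  have DNk: "DN x v = kf x *\<^sub>R D x v" if x: "x \<in> V" for x v
  proof -
    obtain k where k: "\<And>v. DN x v = k *\<^sub>R D x v" using umb[OF x] unfolding umb_def by blast
    then have "kf x = k" using nz[OF x] by (simp add: kf_def)
    then show ?thesis using k by simp
  qed
  have CDN: "Ck_on 1 V (\<lambda>x. DN x v)" for v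
    using Ck_nrm[of 2] Ck_on_Suc_iff[OF open_V nrm_deriv, of 1] by (simp add: numeral_2_eq_2)
  have ex: "\<exists>F. (g has_derivative F) (at a)" if "Ck_on 1 V g" "a \<in> V" for g :: "real^2 \<Rightarrow> real^3" and a
    using that by auto
  have K0: "(kf has_derivative (\<lambda>v. 0)) (at a)" if a: "a \<in> V" for a
  proof -
    obtain F1 where F1: "((\<lambda>x. DN x ?e1) has_derivative F1) (at a)" using ex[OF CDN a] by blast
    obtain F2 where F2: "((\<lambda>x. DN x ?e2) has_derivative F2) (at a)" using ex[OF CDN a] by blast
    obtain G1 where G1: "((\<lambda>x. D x ?e1) has_derivative G1) (at a)" using ex[OF Ck_D a] by blast
    obtain G2 where G2: "((\<lambda>x. D x ?e2) has_derivative G2) (at a)" using ex[OF Ck_D a] by blast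
    have "kf differentiable (at a)"
      unfolding kf_def using F1 G1 nz[OF a]
      by (intro differentiable_divide differentiable_inner) (auto simp: differentiable_def)
    then obtain K where K: "(kf has_derivative K) (at a)" unfolding differentiable_def by blast
    have eqF: "Fi v = kf a *\<^sub>R Gi v + K v *\<^sub>R D a w"
      if "((\<lambda>x. DN x w) has_derivative Fi) (at a)" "((\<lambda>x. D x w) has_derivative Gi) (at a)" for Fi Gi w v
    proof -
      have "((\<lambda>x. kf x *\<^sub>R D x w) has_derivative (\<lambda>v. kf a *\<^sub>R Gi v + K v *\<^sub>R D a w)) (at a)"
        by (rule has_derivative_scaleR[OF K that(2)])
      then have "((\<lambda>x. DN x w) has_derivative (\<lambda>v. kf a *\<^sub>R Gi v + K v *\<^sub>R D a w)) (at a)"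
        by (rule has_derivative_transform_within_open[OF _ open_V a]) (simp add: DNk)
      from has_derivative_unique[OF that(1) this] show ?thesis by simp
    qed
    have "F1 ?e2 = F2 ?e1" by (rule second_derivative_symmetric[OF open_V a nrm_deriv F1 F2])
    moreover have "G1 ?e2 = G2 ?e1" by (rule second_derivative_symmetric[OF open_V a deriv G1 G2])
    \<comment> \<open>The terms with second derivatives of \<phi> cancel; crossing what remains with
      either tangent vector isolates a coefficient.\<close>
    ultimately have eq: "K ?e2 *\<^sub>R D a ?e1 = K ?e1 *\<^sub>R D a ?e2"
      using eqF[OF F1 G1, of ?e2] eqF[OF F2 G2, of ?e1] by simp
    have "K ?e2 *\<^sub>R cr a = cross3 (K ?e2 *\<^sub>R D a ?e1) (D a ?e2)" by (simp add: cr_def cross_mult_left)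
    then have K2: "K ?e2 = 0" using cr_nonzero[OF a] unfolding eq by (simp add: cross_mult_left)
    have "K ?e1 *\<^sub>R cr a = cross3 (D a ?e1) (K ?e1 *\<^sub>R D a ?e2)" by (simp add: cr_def cross_mult_right)
    then have K1: "K ?e1 = 0" using cr_nonzero[OF a] unfolding eq[symmetric] by (simp add: cross_mult_right)
    have "K = (\<lambda>v. 0)"
      using linear_real2[OF has_derivative_linear[OF K]] K1 K2 by auto
    then show ?thesis using K by simp
  qed
  obtain k where k: "\<And>x. x \<in> U \<Longrightarrow> kf x = k"
    using has_derivative_zero_constant[OF U(2), of kf] has_derivative_at_withinI[OF K0] U(3) by blast
  then show ?thesis using DNk U(3) by (intro exI[of _ k]) auto
qed auto

lemma zero_derivative_const:
  fixes g :: "real^2 \<Rightarrow> real^3"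
  assumes "convex U" "U \<subseteq> V" "\<And>x. x \<in> U \<Longrightarrow> (g has_derivative (\<lambda>v. 0)) (at x)" "x \<in> U" "y \<in> U"
  shows "g x = g y"
proof -
  have "(g has_derivative (\<lambda>v. 0)) (at x within U)" if "x \<in> U" for x
    using assms(3)[OF that] by (rule has_derivative_at_withinI)
  from has_derivative_zero_constant[OF assms(1) this] show ?thesis using assms(4,5) by metis
qed

text \<open>With DN = k D the derivative of \<phi> - nrm/k vanishes. This point is the centre of the
  sphere, of radius 1/|k|.\<close>

lemma umbilic_center:
  assumes k: "\<And>x v. x \<in> U \<Longrightarrow> DN x v = k *\<^sub>R D x v" and "k \<noteq> 0" and U: "convex U" "U \<subseteq> V" and xy: "x \<in> U" "y \<in> U"
  shows "\<phi> x - (1 / k) *\<^sub>R nrm x = \<phi> y - (1 / k) *\<^sub>R nrm y"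
proof (rule zero_derivative_const[OF U _ xy])
  fix x assume x: "x \<in> U"
  then have xV: "x \<in> V" using U by blast
  have "((\<lambda>x. \<phi> x - (1 / k) *\<^sub>R nrm x) has_derivative (\<lambda>v. D x v - (1 / k) *\<^sub>R DN x v)) (at x)"
    by (intro has_derivative_diff deriv[OF xV] has_derivative_scaleR_right nrm_deriv[OF xV])
  then show "((\<lambda>x. \<phi> x - (1 / k) *\<^sub>R nrm x) has_derivative (\<lambda>v. 0)) (at x)"
    using k[OF x] \<open>k \<noteq> 0\<close> by simp
qed

text \<open>The tangential part of y is the image of some v under D x and is orthogonal to all such
  images, hence 0.\<close>

lemma normal_if_orthogonal:
  assumes x: "x \<in> V" and orth: "\<And>v. y \<bullet> D x v = 0"
  shows "y = (y \<bullet> nrm x) *\<^sub>R nrm x"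
proof -
  obtain e1 e2 where fr: "oframe e1 e2 (nrm x)" using oframe_exists norm_nrm[OF x] by blast
  let ?w = "y - (y \<bullet> nrm x) *\<^sub>R nrm x"
  have nn: "nrm x \<bullet> nrm x = 1" using norm_nrm[OF x] by (simp add: norm_eq_1)
  have wn: "?w \<bullet> nrm x = 0" by (simp add: inner_diff_left nn)
  have "surj (\<lambda>v. tproj e1 e2 (D x v))"
    by (rule linear_injective_imp_surjective[OF linear_tproj_D[OF x] inj_tproj_D[OF x fr]]) simp
  then obtain v where v: "tproj e1 e2 ?w = tproj e1 e2 (D x v)" by (metis surjD)
  have "?w \<bullet> D x v = 0" using orth[of v] nrm_D[OF x, of v] by (simp add: inner_diff_left)
  then have "tproj e1 e2 ?w \<bullet> tproj e1 e2 ?w = 0" using inner_tproj[OF fr, of ?w "D x v"] wn v by simp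
  then have "norm ?w = 0" using norm_tproj[OF fr, of ?w] wn by (simp add: power2_norm_eq_inner)
  then show ?thesis by simp
qed

lemma tangent_to_sphere:
  assumes U: "open U" "U \<subseteq> V" and sph: "\<And>x. x \<in> U \<Longrightarrow> norm (\<phi> x - c) = \<rho>" and x: "x \<in> U"
  shows "\<phi> x - c = ((\<phi> x - c) \<bullet> nrm x) *\<^sub>R nrm x"
proof -
  have xV: "x \<in> V" using U x by blast
  have "((\<lambda>x. (\<phi> x - c) \<bullet> (\<phi> x - c)) has_derivative (\<lambda>v. (\<phi> x - c) \<bullet> D x v + D x v \<bullet> (\<phi> x - c))) (at x)"
    using deriv[OF xV] by (auto intro!: derivative_eq_intros)
  moreover have "((\<lambda>x. (\<phi> x - c) \<bullet> (\<phi> x - c)) has_derivative (\<lambda>v. 0)) (at x)"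
  proof (rule has_derivative_transform_within_open[OF _ U(1) x])
    show "((\<lambda>x. \<rho>\<^sup>2) has_derivative (\<lambda>v. 0)) (at x)" by simp
    show "\<rho>\<^sup>2 = (\<phi> y - c) \<bullet> (\<phi> y - c)" if "y \<in> U" for y
      using sph[OF that] by (simp add: power2_norm_eq_inner[symmetric])
  qed
  ultimately have "(\<lambda>v. (\<phi> x - c) \<bullet> D x v + D x v \<bullet> (\<phi> x - c)) = (\<lambda>v. 0)" by (rule has_derivative_unique)
  then have orth: "(\<phi> x - c) \<bullet> D x v = 0" for v by (metis inner_commute mult_2 mult_eq_0_iff zero_neq_numeral)
  show ?thesis by (rule normal_if_orthogonal[OF xV orth])
qed

end

context embedded_patch
begin

text \<open>If the patch lies in the sphere near one point, comparing derivatives there identifies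
  1/k with the signed radius and the constant centre \<phi> - nrm/k with c, so all of U lies in the
  same sphere.\<close>

lemma sphere_propagates:
  assumes U: "open U" "convex U" "U \<subseteq> V" and k: "\<And>x v. x \<in> U \<Longrightarrow> DN x v = k *\<^sub>R D x v"
    and a: "a \<in> U" and N: "open N" "\<phi> a \<in> N" "M \<inter> N \<subseteq> sphere c \<rho>" and x: "x \<in> U"
  shows "\<phi> x \<in> sphere c \<rho>"
proof -
  have aV: "a \<in> V" and xV: "x \<in> V" using a x U by auto
  define U1 where "U1 = U \<inter> \<phi> -` N"
  have U1: "open U1" "U1 \<subseteq> V" "a \<in> U1"
    using continuous_open_preimage[OF continuous_on_subset[OF continuous_on_phi U(3)] U(1) N(1)] U a N by (auto simp: U1_def)
  have sph: "norm (\<phi> y - c) = \<rho>" if "y \<in> U1" for y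
  proof -
    have "\<phi> y \<in> M \<inter> N" using that image_sub[OF U1(2)] by (auto simp: U1_def)
    then show ?thesis using N(3) by (auto simp: dist_norm norm_minus_commute subset_iff)
  qed
  define s where "s = (\<lambda>y. (\<phi> y - c) \<bullet> nrm y)"
  have eq: "\<phi> y - c = s y *\<^sub>R nrm y" if "y \<in> U1" for y
    unfolding s_def by (rule tangent_to_sphere[OF U1(1,2) sph that])
  have ds: "(s has_derivative (\<lambda>v. (\<phi> a - c) \<bullet> DN a v + D a v \<bullet> nrm a)) (at a)"
    unfolding s_def using deriv[OF aV] nrm_deriv[OF aV] by (auto intro!: derivative_eq_intros)
  let ?ds = "\<lambda>v. (\<phi> a - c) \<bullet> DN a v + D a v \<bullet> nrm a"
  have "((\<lambda>y. s y *\<^sub>R nrm y) has_derivative (\<lambda>v. s a *\<^sub>R DN a v + ?ds v *\<^sub>R nrm a)) (at a)"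
    by (rule has_derivative_scaleR[OF ds nrm_deriv[OF aV]])
  then have "((\<lambda>y. \<phi> y - c) has_derivative (\<lambda>v. s a *\<^sub>R DN a v + ?ds v *\<^sub>R nrm a)) (at a)"
    by (rule has_derivative_transform_within_open[OF _ U1(1) U1(3)]) (simp add: eq)
  moreover have "((\<lambda>y. \<phi> y - c) has_derivative D a) (at a)"
    using has_derivative_diff[OF deriv[OF aV] has_derivative_const[of c]] by simp
  ultimately have "(\<lambda>v. s a *\<^sub>R DN a v + ?ds v *\<^sub>R nrm a) = D a" by (rule has_derivative_unique)
  then have De: "D a v = s a *\<^sub>R DN a v + ?ds v *\<^sub>R nrm a" for v by (rule fun_cong[OF sym])
  \<comment> \<open>Pairing with D a v removes the normal component and leaves s a * k = 1.\<close>
  have Dv: "D a v \<bullet> D a v = s a * k * (D a v \<bullet> D a v)" for v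
  proof -
    have "D a v \<bullet> D a v = (s a *\<^sub>R DN a v + ?ds v *\<^sub>R nrm a) \<bullet> D a v"
      by (rule arg_cong[OF De, where f = "\<lambda>z. z \<bullet> D a v"])
    also have "\<dots> = s a * (DN a v \<bullet> D a v)" using nrm_D[OF aV, of v] by (simp add: inner_add_left)
    finally show ?thesis unfolding k[OF a] by simp
  qed
  have "D a (axis 1 1) \<noteq> 0" using cr_nonzero[OF aV] by (auto simp: cr_def)
  then have sk: "s a * k = 1" using Dv[of "axis 1 1"] by simp
  then have k0: "k \<noteq> 0" by auto
  then have ks: "1 / k = s a" using sk by (simp add: divide_eq_eq)
  have "\<phi> x - (1 / k) *\<^sub>R nrm x = \<phi> a - (1 / k) *\<^sub>R nrm a"
    by (rule umbilic_center[OF k k0 U(2,3) x a])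
  also have "\<dots> = c" unfolding ks using eq[OF U1(3)] by (simp add: algebra_simps)
  finally have "\<phi> x - c = s a *\<^sub>R nrm x" unfolding ks by (simp add: algebra_simps)
  then have "norm (\<phi> x - c) = \<bar>s a\<bar>" using norm_nrm[OF xV] by simp
  also have "\<dots> = norm (\<phi> a - c)" using eq[OF U1(3)] norm_nrm[OF aV] by simp
  also have "\<dots> = \<rho>" by (rule sph[OF U1(3)])
  finally show ?thesis by (simp add: dist_norm norm_minus_commute)
qed

text \<open>For k = 0 the patch is planar. At a point farthest from the origin the position vector
  is normal to that plane, so the point is also the nearest one of the plane; the patch would reduce
  to it, contrary to injectivity.\<close>

lemma farthest_point_not_flat:
  assumes U: "open U" "convex U" "U \<subseteq> V" and k: "\<And>x v. x \<in> U \<Longrightarrow> DN x v = k *\<^sub>R D x v"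
    and a: "a \<in> U" and far: "\<And>x. x \<in> U \<Longrightarrow> norm (\<phi> x) \<le> norm (\<phi> a)"
  shows "k \<noteq> 0"
proof
  assume k0: "k = 0"
  have aV: "a \<in> V" using a U by blast
  let ?b = "nrm a"
  have nb: "nrm x = ?b" if x: "x \<in> U" for x
  proof (rule zero_derivative_const[OF U(2,3) _ x a])
    fix y assume y: "y \<in> U"
    then have "(nrm has_derivative DN y) (at y)" using nrm_deriv U by blast
    moreover have "DN y = (\<lambda>v. 0)" using k[OF y] k0 by auto
    ultimately show "(nrm has_derivative (\<lambda>v. 0)) (at y)" by simp
  qed
  have pb: "\<phi> x \<bullet> ?b = \<phi> a \<bullet> ?b" if x: "x \<in> U" for x
  proof -
    have "(\<phi> x \<bullet> ?b) *\<^sub>R ?b = (\<phi> a \<bullet> ?b) *\<^sub>R ?b"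
    proof (rule zero_derivative_const[OF U(2,3) _ x a])
      fix y assume y: "y \<in> U"
      then have yV: "y \<in> V" using U by blast
      have "((\<lambda>x. \<phi> x \<bullet> ?b) has_derivative (\<lambda>v. D y v \<bullet> ?b)) (at y)"
        using deriv[OF yV] by (auto intro!: derivative_eq_intros)
      moreover have "D y v \<bullet> ?b = 0" for v using nrm_D[OF yV, of v] nb[OF y] by (simp add: inner_commute)
      ultimately have "((\<lambda>x. \<phi> x \<bullet> ?b) has_derivative (\<lambda>v. 0)) (at y)" by simp
      from has_derivative_scaleR_left[OF this, of ?b]
      show "((\<lambda>x. (\<phi> x \<bullet> ?b) *\<^sub>R ?b) has_derivative (\<lambda>v. 0)) (at y)" by simp
    qed
    then show ?thesis using norm_nrm[OF aV] by (metis norm_zero scaleR_cancel_right zero_neq_one)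
  qed
  have da: "((\<lambda>x. \<phi> x \<bullet> \<phi> x) has_derivative (\<lambda>v. \<phi> a \<bullet> D a v + D a v \<bullet> \<phi> a)) (at a)"
    using deriv[OF aV] by (auto intro!: derivative_eq_intros)
  have "(\<lambda>v. \<phi> a \<bullet> D a v + D a v \<bullet> \<phi> a) = (\<lambda>v. 0)"
  proof (rule differential_zero_maxmin[OF a U(1) da], rule disjI1, rule ballI)
    fix y assume "y \<in> U"
    from far[OF this] show "\<phi> y \<bullet> \<phi> y \<le> \<phi> a \<bullet> \<phi> a"
      by (simp add: power2_norm_eq_inner[symmetric] power_mono)
  qed
  then have orth: "\<phi> a \<bullet> D a v = 0" for v by (metis inner_commute mult_2 mult_eq_0_iff zero_neq_numeral)
  have pa: "\<phi> a = (\<phi> a \<bullet> ?b) *\<^sub>R ?b" by (rule normal_if_orthogonal[OF aV orth])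
  then have na: "norm (\<phi> a) = \<bar>\<phi> a \<bullet> ?b\<bar>" using norm_nrm[OF aV] by (metis mult.right_neutral norm_scaleR)
  \<comment> \<open>The common component along ?b bounds |\<phi> x| below by |\<phi> a|, and
    maximality bounds it above.\<close>
  have sph: "norm (\<phi> x - 0) = norm (\<phi> a)" if x: "x \<in> U" for x
  proof -
    have "\<bar>\<phi> x \<bullet> ?b\<bar> \<le> norm (\<phi> x)" using Cauchy_Schwarz_ineq2[of "\<phi> x" ?b] norm_nrm[OF aV] by simp
    then show ?thesis using far[OF x] pb[OF x] na by simp
  qed
  have const: "\<phi> x = \<phi> a" if x: "x \<in> U" for x
    using tangent_to_sphere[OF U(1,3) sph x] nb[OF x] pb[OF x] pa by simp
  obtain r where r: "0 < r" "ball a r \<subseteq> U" using U(1) a openE by blast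
  have "a + (r / 2) *\<^sub>R axis 1 1 \<in> U" using r by (intro subsetD[OF r(2)]) (simp add: dist_norm)
  then have "a + (r / 2) *\<^sub>R axis 1 1 = a"
    using const inj_on_phi aV U(3) by (meson inj_onD subsetD)
  then show False using r by (simp add: axis_eq_0_iff)
qed

end

text \<open>The Lipschitz bound for the scaling and for its inverse gives both inequalities.\<close>

lemma emeasure_hausdorff2_sphere:
  assumes "0 < \<rho>"
  shows "emeasure hausdorff2 (sphere c \<rho>) = ennreal (\<rho>\<^sup>2 * (4 * pi * hausdorff2_const))"
proof -
  have im: "(\<lambda>y. c + \<rho> *\<^sub>R y) ` sphere 0 1 = sphere c \<rho>"
  proof (intro equalityI subsetI)
    fix y assume "y \<in> sphere c \<rho>"
    then have n: "norm (y - c) = \<rho>" by (simp add: dist_norm norm_minus_commute)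
    have "y = c + \<rho> *\<^sub>R ((1 / \<rho>) *\<^sub>R (y - c))" using assms by simp
    moreover have "(1 / \<rho>) *\<^sub>R (y - c) \<in> sphere 0 1" using n assms by simp
    ultimately show "y \<in> (\<lambda>y. c + \<rho> *\<^sub>R y) ` sphere 0 1" by blast
  qed (use assms in \<open>auto simp: dist_norm\<close>)
  have im': "(\<lambda>y. (1 / \<rho>) *\<^sub>R (y - c)) ` sphere c \<rho> = sphere 0 1"
    unfolding im[symmetric] image_image using assms by simp
  have b: "sphere c \<rho> \<in> sets borel" "sphere (0::real^3) 1 \<in> sets borel" by (auto intro: borel_closed)
  let ?S = "ennreal (4 * pi * hausdorff2_const)"
  have S: "hausdorff2_outer (sphere 0 1) = ?S"
    using hausdorff2_sphere b by (simp add: emeasure_hausdorff2 mult_ac)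
  have "hausdorff2_outer (sphere c \<rho>) \<le> ennreal (\<rho>\<^sup>2) * hausdorff2_outer (sphere 0 1)"
    unfolding im[symmetric] using assms
    by (intro hausdorff2_outer_lipschitz_image_le) (auto simp: dist_norm scaleR_diff_right[symmetric])
  moreover have "hausdorff2_outer (sphere 0 1) \<le> ennreal ((1 / \<rho>)\<^sup>2) * hausdorff2_outer (sphere c \<rho>)"
    unfolding im'[symmetric] using assms
    by (intro hausdorff2_outer_lipschitz_image_le) (auto simp: dist_norm scaleR_diff_right[symmetric])
  then have "ennreal (\<rho>\<^sup>2) * hausdorff2_outer (sphere 0 1) \<le> ennreal (\<rho>\<^sup>2) * (ennreal ((1 / \<rho>)\<^sup>2) * hausdorff2_outer (sphere c \<rho>))"
    by (rule mult_left_mono) simp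
  moreover have "ennreal (\<rho>\<^sup>2) * (ennreal ((1 / \<rho>)\<^sup>2) * hausdorff2_outer (sphere c \<rho>)) = hausdorff2_outer (sphere c \<rho>)"
    using assms by (simp add: mult.assoc[symmetric] ennreal_mult[symmetric] power_divide)
  ultimately have "hausdorff2_outer (sphere c \<rho>) = ennreal (\<rho>\<^sup>2) * ?S" unfolding S by (simp add: antisym)
  then show ?thesis using b by (simp add: emeasure_hausdorff2 ennreal_mult')
qed

section \<open>From umbilic patches to the whole sphere\<close>

context closed_surface
begin

text \<open>The patch at a point farthest from the origin fixes the sphere; connectedness carries it
  over the surface.\<close>

lemma subset_sphere:
  assumes "connected M" and umb: "\<And>V \<phi> D \<xi> W a. embedded_patch V \<phi> D \<xi> M W \<Longrightarrow> a \<in> V \<Longrightarrow> embedded_patch.umb D a"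
  shows "\<exists>c \<rho>. 0 < \<rho> \<and> M \<subseteq> sphere c \<rho>"
proof -
  obtain p where p: "p \<in> M" "\<And>q. q \<in> M \<Longrightarrow> norm q \<le> norm p"
    using continuous_attains_sup[OF compact_M nonempty, of norm] continuous_on_norm_id by blast
  have loc: "\<exists>V \<phi> D \<xi> W a U k. embedded_patch V \<phi> D \<xi> M W \<and> \<phi> a = q \<and> a \<in> U \<and> open U \<and> convex U \<and> U \<subseteq> V \<and>
      (\<forall>x\<in>U. \<forall>v. surface_patch.DN D x v = k *\<^sub>R D x v)" if q: "q \<in> M" for q
  proof -
    obtain V \<phi> D \<xi> W a where c: "embedded_patch V \<phi> D \<xi> M W" "a \<in> V" "\<phi> a = q" using q by (rule chart_at)
    interpret embedded_patch V \<phi> D \<xi> M W by fact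
    obtain r where r: "0 < r" "ball a r \<subseteq> V" using open_V c(2) openE by blast
    obtain k where "\<forall>x\<in>ball a r. \<forall>v. DN x v = k *\<^sub>R D x v"
      using umbilic_patch[OF umb[OF c(1)], of "ball a r"] r by auto
    then show ?thesis using c r
      by (intro exI[of _ V] exI[of _ \<phi>] exI[of _ D] exI[of _ \<xi>] exI[of _ W] exI[of _ a] exI[of _ "ball a r"] exI[of _ k]) auto
  qed
  obtain c \<rho> N0 where c: "0 < \<rho>" "open N0" "p \<in> N0" "M \<inter> N0 \<subseteq> sphere c \<rho>"
  proof -
    obtain V \<phi> D \<xi> W a U k where h: "embedded_patch V \<phi> D \<xi> M W" "\<phi> a = p" "a \<in> U" "open U" "convex U" "U \<subseteq> V"
        "\<forall>x\<in>U. \<forall>v. surface_patch.DN D x v = k *\<^sub>R D x v" using loc[OF p(1)] by (elim exE conjE)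
    interpret embedded_patch V \<phi> D \<xi> M W by fact
    have k: "DN x v = k *\<^sub>R D x v" if "x \<in> U" for x v using h(7) that by blast
    have "k \<noteq> 0"
      using image_sub[OF h(6)] h(2) p(2) by (intro farthest_point_not_flat[OF h(4-6) k h(3)]) auto
    obtain N where N: "open N" "\<phi> ` U = M \<inter> N" using open_image[OF h(4,6)] by blast
    show thesis
    proof (rule that[of "\<bar>1 / k\<bar>" N "\<phi> a - (1 / k) *\<^sub>R nrm a"])
      show "p \<in> N" using N h(2,3) by blast
      show "M \<inter> N \<subseteq> sphere (\<phi> a - (1 / k) *\<^sub>R nrm a) \<bar>1 / k\<bar>"
        unfolding N(2)[symmetric]
      proof clarify
        fix x assume x: "x \<in> U"
        have "\<phi> a - (1 / k) *\<^sub>R nrm a = \<phi> x - (1 / k) *\<^sub>R nrm x"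
          by (rule umbilic_center[OF k \<open>k \<noteq> 0\<close> h(5,6) h(3) x])
        then show "\<phi> x \<in> sphere (\<phi> a - (1 / k) *\<^sub>R nrm a) \<bar>1 / k\<bar>"
          using norm_nrm[of x] x h(6) by (auto simp: dist_norm)
      qed
    qed (use \<open>k \<noteq> 0\<close> N in auto)
  qed
  \<comment> \<open>Within one patch, P at any point implies P at every other by
    \<open>sphere_propagates\<close>, which is the local step of the connectedness
    induction.\<close>
  define P where "P = (\<lambda>q. \<exists>N. open N \<and> q \<in> N \<and> M \<inter> N \<subseteq> sphere c \<rho>)"
  have "P q" if q: "q \<in> M" for q
  proof (rule connected_induction_simple[OF \<open>connected M\<close> p(1) q])
    show "P p" unfolding P_def using c by blast
    fix q' assume "q' \<in> M"
    from loc[OF this] obtain V \<phi> D \<xi> W a U k where h: "embedded_patch V \<phi> D \<xi> M W" "\<phi> a = q'" "a \<in> U" "open U" "convex U" "U \<subseteq> V"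
        "\<forall>x\<in>U. \<forall>v. surface_patch.DN D x v = k *\<^sub>R D x v" by (elim exE conjE)
    interpret embedded_patch V \<phi> D \<xi> M W by fact
    have k: "DN x v = k *\<^sub>R D x v" if "x \<in> U" for x v using h(7) that by blast
    obtain N where N: "open N" "\<phi> ` U = M \<inter> N" using open_image[OF h(4,6)] by blast
    have "P y" if x: "x \<in> \<phi> ` U" and y: "y \<in> \<phi> ` U" and "P x" for x y
    proof -
      obtain b where b: "b \<in> U" "x = \<phi> b" using x by blast
      obtain N1 where N1: "open N1" "\<phi> b \<in> N1" "M \<inter> N1 \<subseteq> sphere c \<rho>" using \<open>P x\<close> b unfolding P_def by blast
      have "\<phi> ` U \<subseteq> sphere c \<rho>"
        using sphere_propagates[OF h(4-6) k b(1) N1] by blast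
      then show ?thesis unfolding P_def using N y by blast
    qed
    moreover have "openin (top_of_set M) (\<phi> ` U)" unfolding N(2) using N(1) by (simp add: openin_open_Int)
    ultimately show "\<exists>T. openin (top_of_set M) T \<and> q' \<in> T \<and> (\<forall>x\<in>T. \<forall>y\<in>T. P x \<longrightarrow> P y)"
      using h(2,3) by (intro exI[of _ "\<phi> ` U"]) blast
  qed
  then have "M \<subseteq> sphere c \<rho>" unfolding P_def by blast
  then show ?thesis using c(1) by blast
qed

text \<open>If M missed a point of the sphere, it would embed into a punctured sphere, that is into
  the plane. Its image there would be compact and, by invariance of domain, open, hence empty or the
  whole plane.\<close>

lemma eq_sphere:
  assumes "0 < \<rho>" "M \<subseteq> sphere c \<rho>"
  shows "M = sphere c \<rho>"
proof (rule ccontr)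
  assume "M \<noteq> sphere c \<rho>"
  then obtain b where b: "b \<in> sphere c \<rho>" "b \<notin> M" using assms(2) by blast
  have "(sphere c \<rho> - {b}) homeomorphic (UNIV :: (real^2) set)"
    using assms(1) b(1) by (intro homeomorphic_punctured_sphere_affine) auto
  then obtain f g where fg: "homeomorphism (sphere c \<rho> - {b}) (UNIV :: (real^2) set) f g" unfolding homeomorphic_def by blast
  have sub: "M \<subseteq> sphere c \<rho> - {b}" using assms(2) b(2) by blast
  have cont: "continuous_on M f" using fg sub by (meson continuous_on_subset homeomorphism_def)
  have inj: "inj_on f M"
    by (rule inj_on_subset[OF _ sub], rule inj_on_inverseI[where g = g]) (rule homeomorphism_apply1[OF fg])
  have "compact (f ` M)" by (rule compact_continuous_image[OF cont compact_M])
  moreover have "open (f ` M)"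
  proof (subst open_subopen, clarify)
    fix p assume "p \<in> M"
    then obtain V \<phi> D \<xi> W a where ch: "embedded_patch V \<phi> D \<xi> M W" "a \<in> V" "\<phi> a = p" by (rule chart_at)
    interpret embedded_patch V \<phi> D \<xi> M W by fact
    have VM: "\<phi> ` V \<subseteq> M" by (rule image_sub) simp
    have "open ((f \<circ> \<phi>) ` V)"
    proof (rule invariance_of_domain[OF _ open_V])
      show "continuous_on V (f \<circ> \<phi>)" by (intro continuous_on_compose continuous_on_phi continuous_on_subset[OF cont VM])
      show "inj_on (f \<circ> \<phi>) V" using inj_on_phi inj_on_subset[OF inj VM] by (rule comp_inj_on)
    qed
    then show "\<exists>T. open T \<and> f p \<in> T \<and> T \<subseteq> f ` M"
      using ch VM by (intro exI[of _ "(f \<circ> \<phi>) ` V"]) auto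
  qed
  ultimately have "f ` M = {} \<or> f ` M = UNIV"
    by (intro clopen[THEN iffD1] conjI compact_imp_closed)
  moreover have "\<not> compact (UNIV :: (real^2) set)" using compact_imp_bounded not_bounded_UNIV by auto
  ultimately show False using nonempty \<open>compact (f ` M)\<close> by auto
qed

end

theorem theorem5p9:
  fixes M :: "(real^3) set"
  assumes "compact M" and "connected M" and "smooth_embedded_surface M"
    and "\<forall>r\<ge>0. global_dist_distr M r = global_dist_distr (sphere 0 1) r"
  shows "\<exists>c. M = sphere c 1"
proof -
  interpret S: mm_set "sphere 0 1" by (rule mm_set_sphere)
  \<comment> \<open>The empty set is compact and connected. Its distance distribution is 0, whereas
    that of the sphere tends to 1.\<close>
  have "M \<noteq> {}"
  proof
    assume "M = {}"
    then have "cdf S.dist_law = (\<lambda>r. 0)"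
      using assms(4) by (auto simp: fun_eq_iff S.cdf_dist_law global_dist_distr_def)
    then have "((\<lambda>r::real. 0::real) \<longlongrightarrow> 1) at_top"
      using real_distribution.cdf_lim_at_top_prob[OF S.real_distribution_dist_law] by simp
    then show False by (simp add: tendsto_const_iff)
  qed
  then interpret closed_surface M using assms(1,3) by unfold_locales
  have avg: "gauss_avg t = mm_set.gauss_avg (sphere 0 1) t" for t
    by (rule gauss_avg_cong[OF mm_set_axioms mm_set_sphere assms(4)])
  have up: "gauss_avg t \<le> ennreal (t / 2)" if "0 < t" for t
    unfolding avg by (rule gauss_avg_sphere(1)[OF that])
  have low: "ennreal (t / 2 * (1 - t / 2)) \<le> gauss_avg t" if "0 < t" for t
    unfolding avg by (rule gauss_avg_sphere(2)[OF that])
  have area: "area = 4 * pi * hausdorff2_const"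
    using area_le[OF low] area_ge[OF up] by simp
  have "embedded_patch.umb D a" if "embedded_patch V \<phi> D \<xi> M W" "a \<in> V" for V \<phi> D \<xi> W a
    using up area that by (rule all_umbilic)
  then obtain c \<rho> where \<rho>: "0 < \<rho>" and sub: "M \<subseteq> sphere c \<rho>"
    using subset_sphere[OF assms(2)] by metis
  have M: "M = sphere c \<rho>" by (rule eq_sphere[OF \<rho> sub])
  \<comment> \<open>The area of M is known from the averages and scales with \<rho>^2, which forces
    \<rho> = 1.\<close>
  have "ennreal area = ennreal (\<rho>\<^sup>2 * area)"
    using emeasure_area emeasure_hausdorff2_sphere[OF \<rho>, of c] unfolding M[symmetric] area by simp
  then have "area = \<rho>\<^sup>2 * area" using area_pos by (subst (asm) ennreal_inj) auto
  then have "\<rho>\<^sup>2 = 1" using area_pos by simp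
  then have "\<rho> = 1" using \<rho> by (simp add: power2_eq_1_iff)
  then show ?thesis using M by blast
qed

end
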